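(* Let $U=U_q(\mathfrak g)$ be the quantum Borcherds-Bozec algebra associated with a Borcherds-Cartan datum, a quotient of the algebra $\widehat U$. Let $\Delta:\widehat U\to\widehat U\otimes\widehat U$ be the algebra homomorphism (co-multiplication) given by $$\Delta(q^h)=q^h\otimes q^h,\quad \Delta(e_{il})=\sum_{m+n=l}q_{(i)}^{mn}\,e_{im}\otimes K_i^{-m}e_{in},\quad \Delta(f_{il})=\sum_{m+n=l}q_{(i)}^{-mn}\,f_{im}K_i^{n}\otimes f_{in}$$ for $h\in P^{\vee}$, $(i,l)\in I^{\infty}$ (sums over $m,n\ge0$). Then $\Delta$ induces an algebra homomorphism $\Delta:U\to U\otimes U$ (given by the same formulas on generators).
   Context: **Borcherds-Cartan datum.** $I$ is a (finite or countably infinite) index set. An even symmetrizable Borcherds-Cartan matrix is an integer matrix $A=(a_{ij})_{i,j\in I}$ such that $a_{ii}\in\{2,0,-2,-4,\dots\}$, $a_{ij}\le 0$ for $i\ne j$, and there is $D=\mathrm{diag}(s_i\in\mathbf{Z}_{>0}\mid i\in I)$ with $DA$ symmetric. Put $I^{\mathrm{re}}=\{i: a_{ii}=2\}$, $I^{\mathrm{im}}=\{i: a_{ii}\le 0\}$. A Borcherds-Cartan datum consists of such $A$ (with $D$), a free abelian group $P$ (weight lattice), $P^{\vee}=\mathrm{Hom}(P,\mathbf{Z})$ with pairing $\langle\ ,\ \rangle$, simple roots $\alpha_i\in P$ and simple coroots $h_i\in P^{\vee}$ $(i\in I)$ such that $\langle h_i,\alpha_j\rangle=a_{ij}$, the $\alpha_i$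 are linearly independent over $\mathbf{Q}$, and for each $i$ there is $\Lambda_i\in P$ with $\langle h_j,\Lambda_i\rangle=\delta_{ij}$ for all $j$. **Notation.** $q$ is an indeterminate, $q_i=q^{s_i}$, $q_{(i)}=q_i^{a_{ii}/2}$, $K_i=q^{s_ih_i}$. For $i\in I^{\mathrm{re}}$: $[n]_i=\frac{q_i^{n}-q_i^{-n}}{q_i-q_i^{-1}}$, $[n]_i!=[n]_i\cdots[1]_i$, $\left[\begin{smallmatrix}n\\k\end{smallmatrix}\right]_i=\frac{[n]_i!}{[k]_i!\,[n-k]_i!}$. $I^{\infty}=(I^{\mathrm{re}}\times\{1\})\cup(I^{\mathrm{im}}\times\mathbf{Z}_{>0})$; for $i\in I^{\mathrm{re}}$ write $i=(i,1)$, $e_i=e_{i1}$, $f_i=f_{i1}$. Convention: $e_{i0}=f_{i0}=1$. Fix $\tau_{il}\in\mathbf{Q}(q)$ with $\tau_{il}\in 1+q\mathbf{Z}_{\ge0}[[q]]$ for all $(i,l)\in I^{\infty}$, and put $\tau_{i0}=1$. **Quantum Borcherds-Bozec algebra.** $\widehat U$ is the associative unital $\mathbf{Q}(q)$-algebra generated by $q^h$ $(h\in P^{\vee})$, $e_{il},f_{il}$ $((i,l)\in I^{\infty})$ with relations: $q^0=1$, $q^hq^{h'}=q^{h+h'}$; $q^he_{jl}q^{-h}=q^{l\langle h,\alpha_j\rangle}e_{jl}$, $q^hf_{jl}q^{-h}=q^{-l\langle h,\alpha_j\rangle}f_{jl}$; for $i\in I^{\mathrm{re}}$, $(j,l)\in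 I^{\infty}$, $(j,l)\ne(i,1)$: $\sum_{k=0}^{1-la_{ij}}(-1)^k\left[\begin{smallmatrix}1-la_{ij}\\k\end{smallmatrix}\right]_i e_i^{1-la_{ij}-k}e_{jl}e_i^k=0$ and the same with $e$ replaced by $f$; $e_{ik}e_{jl}=e_{jl}e_{ik}$ and $f_{ik}f_{jl}=f_{jl}f_{ik}$ whenever $a_{ij}=0$ (including $i=j$ with $a_{ii}=0$). $U_q(\mathfrak g)$ is the quotient of $\widehat U$ by the (Drinfeld-type) relations: $e_{jl}f_{ik}=f_{ik}e_{jl}$ for $i\neq j$, $(i,k),(j,l)\in I^\infty$; and for all $i\in I$ and $(i,k),(i,l)\in I^{\infty}$, $$\sum_{\substack{m+n=k\\ n+s=l}}q_{(i)}^{n(m-s)}\tau_{in}\,e_{is}f_{im}K_i^{-n}=\sum_{\substack{m+n=k\\ n+s=l}}q_{(i)}^{-n(m-s)}\tau_{in}\,f_{im}e_{is}K_i^{n},$$ where $m,n,s\ge0$. Tensor products are over $\mathbf{Q}(q)$, and $\widehat U\otimes\widehat U$, $U\otimes U$ carry the usual (untwisted) multiplication. It is known (Bozec) that $\Delta$ is a well-defined algebra homomorphism on $\widehat U$. *)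

theory Defs
  imports
    "HOL-Library.Countable_Set"
    "HOL-Computational_Algebra.Fraction_Field"
    "HOL-Computational_Algebra.Polynomial_FPS"
    "HOL-Algebra.QuotRing"
    "HOL-Algebra.Module"
begin

section \<open>Algebras over a field\<close>

text \<open>
  Algebras over a field \<open>'k\<close> are not necessarily commutative; they are represented by the
  record type \<open>('k, 'a) module\<close> of HOL-Algebra, which extends rings by a scalar multiplication.
\<close>

definition alg_hom :: "('k, 'a) module \<Rightarrow> ('k, 'b) module \<Rightarrow> ('a \<Rightarrow> 'b) set" where
  "alg_hom A B =
     {\<phi> \<in> ring_hom A B. \<forall>c. \<forall>x\<in>carrier A. \<phi> (c \<odot>\<^bsub>A\<^esub> x) = c \<odot>\<^bsub>B\<^esub> \<phi> x}"

definition quotient_algebra :: "('k, 'a) module \<Rightarrow> 'a set \<Rightarrow> ('k, 'a set) module" where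
  "quotient_algebra A J =
     ring.extend (A Quot J) (module.fields (\<lambda>c X. \<Union>x\<in>X. J +>\<^bsub>A\<^esub> (c \<odot>\<^bsub>A\<^esub> x)))"

definition monoid_algebra :: "('m, 'x) monoid_scheme \<Rightarrow> ('k::field, 'm \<Rightarrow> 'k) module" where
  "monoid_algebra M =
     \<lparr>carrier = {f. finite {x. f x \<noteq> 0} \<and> {x. f x \<noteq> 0} \<subseteq> carrier M},
      mult = (\<lambda>f g x. \<Sum>(u, v) \<in> {(u, v). f u \<noteq> 0 \<and> g v \<noteq> 0 \<and> u \<otimes>\<^bsub>M\<^esub> v = x}. f u * g v),
      one = (\<lambda>x. if x = \<one>\<^bsub>M\<^esub> then 1 else 0),
      zero = (\<lambda>x. 0),
      add = (\<lambda>f g x. f x + g x),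
      smult = (\<lambda>c f x. c * f x)\<rparr>"

definition basis_elt :: "'m \<Rightarrow> 'm \<Rightarrow> 'k::field" where
  "basis_elt u = (\<lambda>x. if x = u then 1 else 0)"

definition free_monoid :: "'g set \<Rightarrow> 'g list monoid" where
  "free_monoid S = \<lparr>carrier = lists S, mult = (@), one = []\<rparr>"

definition free_algebra :: "'g set \<Rightarrow> ('k::field, 'g list \<Rightarrow> 'k) module" where
  "free_algebra S = monoid_algebra (free_monoid S)"


section \<open>Tensor products of algebras\<close>

text \<open>
  As a vector space, the tensor product is the free vector space on
  \<open>carrier A \<times> carrier B\<close> modulo the span of the bilinearity relations.  The free vector space,
  equipped with the bilinear extension of \<open>(a, b) (a', b') = (a a', b b')\<close>, is the monoid algebra
  of the product of the multiplicative monoids of \<open>A\<close> and \<open>B\<close>.  Multiplying a bilinearity relation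
  by basis elements on the left and on the right gives again a bilinearity relation, so the span
  of the relations coincides with the two-sided ideal which they generate.
\<close>

definition pair_algebra ::
  "('k::field, 'a) module \<Rightarrow> ('k, 'b) module \<Rightarrow> ('k, 'a \<times> 'b \<Rightarrow> 'k) module" where
  "pair_algebra A B = monoid_algebra (A \<times>\<times> B)"

definition bilinearity_relations ::
  "('k::field, 'a) module \<Rightarrow> ('k, 'b) module \<Rightarrow> ('a \<times> 'b \<Rightarrow> 'k) set" where
  "bilinearity_relations A B = (let R = pair_algebra A B in
      {basis_elt (a \<oplus>\<^bsub>A\<^esub> a', b) \<ominus>\<^bsub>R\<^esub> (basis_elt (a, b) \<oplus>\<^bsub>R\<^esub> basis_elt (a', b))
         | a a' b. a \<in> carrier A \<and> a' \<in> carrier A \<and> b \<in> carrier B}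
    \<union> {basis_elt (a, b \<oplus>\<^bsub>B\<^esub> b') \<ominus>\<^bsub>R\<^esub> (basis_elt (a, b) \<oplus>\<^bsub>R\<^esub> basis_elt (a, b'))
         | a b b'. a \<in> carrier A \<and> b \<in> carrier B \<and> b' \<in> carrier B}
    \<union> {basis_elt (c \<odot>\<^bsub>A\<^esub> a, b) \<ominus>\<^bsub>R\<^esub> c \<odot>\<^bsub>R\<^esub> basis_elt (a, b)
         | c a b. a \<in> carrier A \<and> b \<in> carrier B}
    \<union> {basis_elt (a, c \<odot>\<^bsub>B\<^esub> b) \<ominus>\<^bsub>R\<^esub> c \<odot>\<^bsub>R\<^esub> basis_elt (a, b)
         | c a b. a \<in> carrier A \<and> b \<in> carrier B})"

definition tensor_ideal ::
  "('k::field, 'a) module \<Rightarrow> ('k, 'b) module \<Rightarrow> ('a \<times> 'b \<Rightarrow> 'k) set" where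
  "tensor_ideal A B = Idl\<^bsub>pair_algebra A B\<^esub> (bilinearity_relations A B)"

definition tensor_algebra ::
  "('k::field, 'a) module \<Rightarrow> ('k, 'b) module \<Rightarrow> ('k, ('a \<times> 'b \<Rightarrow> 'k) set) module" where
  "tensor_algebra A B = quotient_algebra (pair_algebra A B) (tensor_ideal A B)"

definition pure_tensor ::
  "('k::field, 'a) module \<Rightarrow> ('k, 'b) module \<Rightarrow> 'a \<Rightarrow> 'b \<Rightarrow> ('a \<times> 'b \<Rightarrow> 'k) set" where
  "pure_tensor A B a b = tensor_ideal A B +>\<^bsub>pair_algebra A B\<^esub> basis_elt (a, b)"

text \<open>
  For linear maps \<open>\<phi> : A \<rightarrow> A'\<close> and \<open>\<psi> : B \<rightarrow> B'\<close> (and only for these is the value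
  independent of the chosen representative), \<open>tensor_map A' B' \<phi> \<psi>\<close> is
  \<open>\<phi> \<otimes> \<psi>\<close> on the carrier of \<open>tensor_algebra A B\<close>.
\<close>

definition tensor_map ::
  "('k::field, 'c) module \<Rightarrow> ('k, 'd) module \<Rightarrow> ('a \<Rightarrow> 'c) \<Rightarrow> ('b \<Rightarrow> 'd)
     \<Rightarrow> ('a \<times> 'b \<Rightarrow> 'k) set \<Rightarrow> ('c \<times> 'd \<Rightarrow> 'k) set" where
  "tensor_map A' B' \<phi> \<psi> X =
     (let f = (SOME f. f \<in> X)
      in \<Oplus>\<^bsub>tensor_algebra A' B'\<^esub> z \<in> {z. f z \<noteq> 0}.
           f z \<odot>\<^bsub>tensor_algebra A' B'\<^esub> pure_tensor A' B' (\<phi> (fst z)) (\<psi> (snd z)))"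


section \<open>Borcherds-Cartan data\<close>

definition zscale :: "int \<Rightarrow> 'a::ab_group_add \<Rightarrow> 'a" where
  "zscale n x = (if 0 \<le> n then ((+) x ^^ nat n) 0 else - ((+) x ^^ nat (- n)) 0)"

lemma zscale_nat: "zscale (int n) x = ((+) x ^^ n) 0"
  by (simp add: zscale_def)

lemma funpow_plus_zero_add: "((+) x ^^ (m + n)) (0::'a::ab_group_add) = ((+) x ^^ m) 0 + ((+) x ^^ n) 0"
  by (induction m) (simp_all add: add.assoc)

lemma zscale_diff: "zscale (int m - int n) x = ((+) x ^^ m) 0 - ((+) x ^^ n) 0"
proof (cases "n \<le> m")
  case True
  then obtain k where "m = k + n" by (metis le_add_diff_inverse2)
  then show ?thesis by (simp add: zscale_nat funpow_plus_zero_add)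
next
  case False
  then obtain k where "n = k + m" "k > 0" by (metis add.commute less_imp_add_positive linorder_not_le)
  then show ?thesis by (simp add: zscale_def funpow_plus_zero_add)
qed

lemma zscale_add_left: "zscale (a + b) x = zscale a x + zscale b x"
proof -
  obtain m n where a: "a = int m - int n" by (metis int_diff_cases)
  obtain k l where b: "b = int k - int l" by (metis int_diff_cases)
  have "a + b = int (m + k) - int (n + l)" using a b by simp
  then show ?thesis by (simp only: a b zscale_diff funpow_plus_zero_add) simp
qed

lemma zscale_add_right: "zscale a (x + y) = zscale a x + zscale a y"
proof -
  have *: "((+) (x + y) ^^ n) 0 = ((+) x ^^ n) 0 + ((+) y ^^ n) 0" for n
    by (induction n) (simp_all add: algebra_simps)
  show ?thesis by (simp add: zscale_def *)
qed

lemma zscale_one: "zscale 1 x = x"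
  by (simp add: zscale_def)

lemma zscale_minus_left: "zscale (- a) x = - zscale a x"
proof -
  have "zscale (- a) x + zscale a x = zscale 0 x" by (simp flip: zscale_add_left)
  also have "\<dots> = 0" by (simp add: zscale_def)
  finally show ?thesis by (simp add: eq_neg_iff_add_eq_0)
qed

lemma zscale_zscale: "zscale a (zscale b x) = zscale (a * b) x"
proof -
  have nat: "zscale (int n) (zscale b x) = zscale (int n * b) x" for n
  proof (induction n)
    case 0 show ?case by (simp add: zscale_def)
  next
    case (Suc n)
    have "zscale (int (Suc n)) (zscale b x) = zscale 1 (zscale b x) + zscale (int n) (zscale b x)"
      by (simp flip: zscale_add_left)
    then show ?case by (simp add: Suc zscale_one distrib_right flip: zscale_add_left)
  qed
  show ?thesis
  proof (cases "0 \<le> a")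
    case True then show ?thesis using nat[of "nat a"] by simp
  next
    case False
    then have "zscale (- a) (zscale b x) = zscale (- a * b) x" using nat[of "nat (- a)"] by simp
    then show ?thesis by (simp add: zscale_minus_left)
  qed
qed

lemma module_zscale: "Modules.module zscale"
  by unfold_locales (simp_all add: zscale_add_left zscale_add_right zscale_one zscale_zscale)

text \<open>
  The weight lattice \<open>P\<close> is the whole type \<open>'p\<close>, and \<open>Hom(P, \<int>)\<close> is the set of additive functions
  \<open>'p \<Rightarrow> int\<close>, so that the pairing is function application.
\<close>

definition coweights :: "('p::ab_group_add \<Rightarrow> int) set" where
  "coweights = {h. additive h}"

record ('i, 'p) bc_datum =
  idx :: "'i set"
  cartan :: "'i \<Rightarrow> 'i \<Rightarrow> int"
  symm :: "'i \<Rightarrow> int"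
  simple_root :: "'i \<Rightarrow> 'p"
  simple_coroot :: "'i \<Rightarrow> 'p \<Rightarrow> int"

text \<open>
  Since \<open>P\<close> is free, it embeds into \<open>\<rat> \<otimes> P\<close>, and elements of \<open>P\<close> are linearly independent over
  \<open>\<rat>\<close> iff they are so over \<open>\<int>\<close> (clear denominators).
\<close>

locale borcherds_cartan_datum =
  fixes D :: "('i, 'p::ab_group_add) bc_datum"
  assumes countable_idx: "countable (idx D)"
    and diag: "i \<in> idx D \<Longrightarrow> cartan D i i \<le> 2 \<and> even (cartan D i i)"
    and off_diag: "i \<in> idx D \<Longrightarrow> j \<in> idx D \<Longrightarrow> i \<noteq> j \<Longrightarrow> cartan D i j \<le> 0"
    and symm_pos: "i \<in> idx D \<Longrightarrow> symm D i > 0"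
    and symmetrizable: "i \<in> idx D \<Longrightarrow> j \<in> idx D \<Longrightarrow>
      symm D i * cartan D i j = symm D j * cartan D j i"
    and free_lattice: "\<exists>B::'p set. \<not> module.dependent zscale B \<and> module.span zscale B = UNIV"
    and coroot_coweight: "i \<in> idx D \<Longrightarrow> simple_coroot D i \<in> coweights"
    and coroot_root: "i \<in> idx D \<Longrightarrow> j \<in> idx D \<Longrightarrow> simple_coroot D i (simple_root D j) = cartan D i j"
    and root_inj: "inj_on (simple_root D) (idx D)"
    and root_indep: "\<not> module.dependent zscale (simple_root D ` idx D)"
    and fundamental: "i \<in> idx D \<Longrightarrow>
      \<exists>\<Lambda>. \<forall>j\<in>idx D. simple_coroot D j \<Lambda> = (if i = j then 1 else 0)"

definition idx_re :: "('i, 'p) bc_datum \<Rightarrow> 'i set" where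
  "idx_re D = {i \<in> idx D. cartan D i i = 2}"

definition idx_im :: "('i, 'p) bc_datum \<Rightarrow> 'i set" where
  "idx_im D = {i \<in> idx D. cartan D i i \<le> 0}"

definition idx_inf :: "('i, 'p) bc_datum \<Rightarrow> ('i \<times> nat) set" where
  "idx_inf D = idx_re D \<times> {1} \<union> idx_im D \<times> {0<..}"


section \<open>Quantum integers\<close>

type_synonym ratfun = "rat poly fract"

definition qvar :: ratfun where
  "qvar = Fraction_Field.Fract [:0, 1:] 1"

definition q_sub :: "('i, 'p) bc_datum \<Rightarrow> 'i \<Rightarrow> ratfun" where
  "q_sub D i = qvar powi symm D i"

definition q_par :: "('i, 'p) bc_datum \<Rightarrow> 'i \<Rightarrow> ratfun" where
  "q_par D i = q_sub D i powi (cartan D i i div 2)"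

definition qint :: "('i, 'p) bc_datum \<Rightarrow> 'i \<Rightarrow> nat \<Rightarrow> ratfun" where
  "qint D i n = (q_sub D i powi int n - q_sub D i powi (- int n))
                  / (q_sub D i - q_sub D i powi (- 1))"

definition qfact :: "('i, 'p) bc_datum \<Rightarrow> 'i \<Rightarrow> nat \<Rightarrow> ratfun" where
  "qfact D i n = (\<Prod>k = 1..n. qint D i k)"

definition qbinom :: "('i, 'p) bc_datum \<Rightarrow> 'i \<Rightarrow> nat \<Rightarrow> nat \<Rightarrow> ratfun" where
  "qbinom D i n k = qfact D i n / (qfact D i k * qfact D i (n - k))"

text \<open>Membership in \<open>1 + q \<int>\<^sub>\<ge>\<^sub>0[[q]]\<close> refers to the Laurent expansion at \<open>q = 0\<close>.\<close>

definition in_one_plus_q_nonneg :: "ratfun \<Rightarrow> bool" where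
  "in_one_plus_q_nonneg x \<longleftrightarrow>
     (\<exists>a b g. b \<noteq> 0 \<and> x = Fraction_Field.Fract a b \<and> fps_of_poly a = g * fps_of_poly b \<and>
        fps_nth g 0 = 1 \<and> (\<forall>n. fps_nth g n \<in> \<nat>))"

definition tau_family :: "('i, 'p) bc_datum \<Rightarrow> ('i \<Rightarrow> nat \<Rightarrow> ratfun) \<Rightarrow> bool" where
  "tau_family D \<tau> \<longleftrightarrow>
     (\<forall>(i, l) \<in> idx_inf D. in_one_plus_q_nonneg (\<tau> i l)) \<and> (\<forall>i\<in>idx D. \<tau> i 0 = 1)"


section \<open>The algebras\<close>

datatype ('i, 'p) gen = Gq "'p \<Rightarrow> int" | Ge 'i nat | Gf 'i nat

definition gens :: "('i, 'p::ab_group_add) bc_datum \<Rightarrow> ('i, 'p) gen set" where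
  "gens D = Gq ` coweights \<union> (\<lambda>(i, l). Ge i l) ` idx_inf D \<union> (\<lambda>(i, l). Gf i l) ` idx_inf D"

type_synonym ('i, 'p) free_elt = "('i, 'p) gen list \<Rightarrow> ratfun"
type_synonym ('i, 'p) hat_elt = "('i, 'p) free_elt set"
type_synonym ('i, 'p) U_elt = "('i, 'p) hat_elt set"

definition FA :: "('i, 'p::ab_group_add) bc_datum \<Rightarrow> (ratfun, ('i, 'p) free_elt) module" where
  "FA D = free_algebra (gens D)"

definition q_free :: "('p \<Rightarrow> int) \<Rightarrow> ('i, 'p) free_elt" where
  "q_free h = basis_elt [Gq h]"

definition e_free :: "'i \<Rightarrow> nat \<Rightarrow> ('i, 'p) free_elt" where
  "e_free i l = (if l = 0 then basis_elt [] else basis_elt [Ge i l])"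

definition f_free :: "'i \<Rightarrow> nat \<Rightarrow> ('i, 'p) free_elt" where
  "f_free i l = (if l = 0 then basis_elt [] else basis_elt [Gf i l])"

definition torus_relations ::
  "('i, 'p::ab_group_add) bc_datum \<Rightarrow> ('i, 'p) free_elt set" where
  "torus_relations D = (let A = FA D in
      {q_free (\<lambda>x. 0) \<ominus>\<^bsub>A\<^esub> \<one>\<^bsub>A\<^esub>}
    \<union> {q_free h \<otimes>\<^bsub>A\<^esub> q_free h' \<ominus>\<^bsub>A\<^esub> q_free (\<lambda>x. h x + h' x)
         | h h'. h \<in> coweights \<and> h' \<in> coweights}
    \<union> {q_free h \<otimes>\<^bsub>A\<^esub> e_free j l \<otimes>\<^bsub>A\<^esub> q_free (\<lambda>x. - h x)
          \<ominus>\<^bsub>A\<^esub> (qvar powi (int l * h (simple_root D j))) \<odot>\<^bsub>A\<^esub> e_free j l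
         | h j l. h \<in> coweights \<and> (j, l) \<in> idx_inf D}
    \<union> {q_free h \<otimes>\<^bsub>A\<^esub> f_free j l \<otimes>\<^bsub>A\<^esub> q_free (\<lambda>x. - h x)
          \<ominus>\<^bsub>A\<^esub> (qvar powi (- (int l * h (simple_root D j)))) \<odot>\<^bsub>A\<^esub> f_free j l
         | h j l. h \<in> coweights \<and> (j, l) \<in> idx_inf D})"

text \<open>
  The Serre and commutation relations are the same for \<open>e\<close> and \<open>f\<close>; the argument \<open>x\<close> below is
  \<open>e_free\<close> or \<open>f_free\<close>.  In the Serre relation \<open>(j, l) \<noteq> (i, 1)\<close> with \<open>i\<close> real forces
  \<open>j \<noteq> i\<close>, so the upper bound is a natural number.
\<close>

definition serre_relations ::
  "('i, 'p::ab_group_add) bc_datum \<Rightarrow> ('i \<Rightarrow> nat \<Rightarrow> ('i, 'p) free_elt)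
     \<Rightarrow> ('i, 'p) free_elt set" where
  "serre_relations D x = (let A = FA D in
      {(let N = nat (1 - int l * cartan D i j) in
          \<Oplus>\<^bsub>A\<^esub> k \<in> {0..N}. ((- 1) ^ k * qbinom D i N k) \<odot>\<^bsub>A\<^esub>
             (x i 1 [^]\<^bsub>A\<^esub> (N - k) \<otimes>\<^bsub>A\<^esub> x j l \<otimes>\<^bsub>A\<^esub> x i 1 [^]\<^bsub>A\<^esub> k))
        | i j l. i \<in> idx_re D \<and> (j, l) \<in> idx_inf D \<and> (j, l) \<noteq> (i, 1)})"

definition commutation_relations ::
  "('i, 'p::ab_group_add) bc_datum \<Rightarrow> ('i \<Rightarrow> nat \<Rightarrow> ('i, 'p) free_elt)
     \<Rightarrow> ('i, 'p) free_elt set" where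
  "commutation_relations D x = (let A = FA D in
      {x i k \<otimes>\<^bsub>A\<^esub> x j l \<ominus>\<^bsub>A\<^esub> x j l \<otimes>\<^bsub>A\<^esub> x i k
        | i k j l. (i, k) \<in> idx_inf D \<and> (j, l) \<in> idx_inf D \<and> cartan D i j = 0})"

definition hat_ideal :: "('i, 'p::ab_group_add) bc_datum \<Rightarrow> ('i, 'p) free_elt set" where
  "hat_ideal D = Idl\<^bsub>FA D\<^esub> (torus_relations D
     \<union> serre_relations D e_free \<union> serre_relations D f_free
     \<union> commutation_relations D e_free \<union> commutation_relations D f_free)"

definition Uhat :: "('i, 'p::ab_group_add) bc_datum \<Rightarrow> (ratfun, ('i, 'p) hat_elt) module" where
  "Uhat D = quotient_algebra (FA D) (hat_ideal D)"

definition q_hat ::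
  "('i, 'p::ab_group_add) bc_datum \<Rightarrow> ('p \<Rightarrow> int) \<Rightarrow> ('i, 'p) hat_elt" where
  "q_hat D h = hat_ideal D +>\<^bsub>FA D\<^esub> q_free h"

definition e_hat :: "('i, 'p::ab_group_add) bc_datum \<Rightarrow> 'i \<Rightarrow> nat \<Rightarrow> ('i, 'p) hat_elt" where
  "e_hat D i l = hat_ideal D +>\<^bsub>FA D\<^esub> e_free i l"

definition f_hat :: "('i, 'p::ab_group_add) bc_datum \<Rightarrow> 'i \<Rightarrow> nat \<Rightarrow> ('i, 'p) hat_elt" where
  "f_hat D i l = hat_ideal D +>\<^bsub>FA D\<^esub> f_free i l"

text \<open>
  \<open>K_coweight D i n\<close> is \<open>n s\<^sub>i h\<^sub>i\<close>, so \<open>K\<^sub>i\<^sup>n = q\<^bsup>n s\<^sub>i h\<^sub>i\<^esup>\<close> for every integer \<open>n\<close>.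
\<close>

definition K_coweight :: "('i, 'p) bc_datum \<Rightarrow> 'i \<Rightarrow> int \<Rightarrow> 'p \<Rightarrow> int" where
  "K_coweight D i n = (\<lambda>x. n * symm D i * simple_coroot D i x)"

definition drinfeld_relations ::
  "('i, 'p::ab_group_add) bc_datum \<Rightarrow> ('i \<Rightarrow> nat \<Rightarrow> ratfun) \<Rightarrow> ('i, 'p) hat_elt set" where
  "drinfeld_relations D \<tau> = (let A = Uhat D; e = e_hat D; f = f_hat D;
        K = (\<lambda>i n. q_hat D (K_coweight D i n)) in
      {e j l \<otimes>\<^bsub>A\<^esub> f i k \<ominus>\<^bsub>A\<^esub> f i k \<otimes>\<^bsub>A\<^esub> e j l
        | i j k l. (i, k) \<in> idx_inf D \<and> (j, l) \<in> idx_inf D \<and> i \<noteq> j}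
    \<union> {finsum A (\<lambda>(m, n, s). (q_par D i powi (int n * (int m - int s)) * \<tau> i n) \<odot>\<^bsub>A\<^esub>
              (e i s \<otimes>\<^bsub>A\<^esub> f i m \<otimes>\<^bsub>A\<^esub> K i (- int n))) {(m, n, s). m + n = k \<and> n + s = l}
        \<ominus>\<^bsub>A\<^esub>
        finsum A (\<lambda>(m, n, s). (q_par D i powi (- (int n * (int m - int s))) * \<tau> i n) \<odot>\<^bsub>A\<^esub>
              (f i m \<otimes>\<^bsub>A\<^esub> e i s \<otimes>\<^bsub>A\<^esub> K i (int n))) {(m, n, s). m + n = k \<and> n + s = l}
        | i k l. (i, k) \<in> idx_inf D \<and> (i, l) \<in> idx_inf D})"

definition drinfeld_ideal ::
  "('i, 'p::ab_group_add) bc_datum \<Rightarrow> ('i \<Rightarrow> nat \<Rightarrow> ratfun) \<Rightarrow> ('i, 'p) hat_elt set" where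
  "drinfeld_ideal D \<tau> = Idl\<^bsub>Uhat D\<^esub> (drinfeld_relations D \<tau>)"

definition Uq ::
  "('i, 'p::ab_group_add) bc_datum \<Rightarrow> ('i \<Rightarrow> nat \<Rightarrow> ratfun)
     \<Rightarrow> (ratfun, ('i, 'p) U_elt) module" where
  "Uq D \<tau> = quotient_algebra (Uhat D) (drinfeld_ideal D \<tau>)"

definition Uq_proj ::
  "('i, 'p::ab_group_add) bc_datum \<Rightarrow> ('i \<Rightarrow> nat \<Rightarrow> ratfun)
     \<Rightarrow> ('i, 'p) hat_elt \<Rightarrow> ('i, 'p) U_elt" where
  "Uq_proj D \<tau> x = drinfeld_ideal D \<tau> +>\<^bsub>Uhat D\<^esub> x"

text \<open>
  \<open>\<Delta> : A \<rightarrow> A \<otimes> A\<close> is an algebra homomorphism given by the co-multiplication formulas on the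
  elements \<open>q\<^sup>h\<close>, \<open>e\<^sub>i\<^sub>l\<close>, \<open>f\<^sub>i\<^sub>l\<close> of \<open>A\<close>, where \<open>A\<close> is \<open>Uhat D\<close> or \<open>Uq D \<tau>\<close>.
\<close>

definition comultiplication ::
  "('i, 'p::ab_group_add) bc_datum \<Rightarrow> (ratfun, 'a) module \<Rightarrow> (('p \<Rightarrow> int) \<Rightarrow> 'a)
     \<Rightarrow> ('i \<Rightarrow> nat \<Rightarrow> 'a) \<Rightarrow> ('i \<Rightarrow> nat \<Rightarrow> 'a) \<Rightarrow> ('a \<Rightarrow> ('a \<times> 'a \<Rightarrow> ratfun) set) \<Rightarrow> bool" where
  "comultiplication D A qh e f \<Delta> \<longleftrightarrow>
    (let T = tensor_algebra A A; t = pure_tensor A A; K = (\<lambda>i n. qh (K_coweight D i n)) in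
      \<Delta> \<in> alg_hom A T \<and>
      (\<forall>h\<in>coweights. \<Delta> (qh h) = t (qh h) (qh h)) \<and>
      (\<forall>(i, l) \<in> idx_inf D.
         \<Delta> (e i l) = finsum T (\<lambda>(m, n). (q_par D i powi (int m * int n)) \<odot>\<^bsub>T\<^esub>
              t (e i m) (K i (- int m) \<otimes>\<^bsub>A\<^esub> e i n)) {(m, n). m + n = l}) \<and>
      (\<forall>(i, l) \<in> idx_inf D.
         \<Delta> (f i l) = finsum T (\<lambda>(m, n). (q_par D i powi (- (int m * int n))) \<odot>\<^bsub>T\<^esub>
              t (f i m \<otimes>\<^bsub>A\<^esub> K i (int n)) (f i n)) {(m, n). m + n = l}))"

end

theory Submission
  imports Defs
begin

text \<open>
  Write \<open>U\<close> for the quotient of the hatted algebra by the Drinfeld relations and \<open>\<pi>\<close> for the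
  projection. The composite \<open>\<Phi> = (\<pi> \<otimes> \<pi>) \<circ> \<Delta>\<close> is an algebra homomorphism into \<open>U \<otimes> U\<close>, and
  \<open>\<Delta>\<close> descends to \<open>U\<close> as soon as \<open>\<Phi>\<close> kills the Drinfeld relations. Only the commutation rules
  of the torus with \<open>e\<close> and \<open>f\<close> and the Drinfeld relations in \<open>U\<close> are needed for this.

  For two distinct indices the products of the coproducts of \<open>e\<^sub>j\<^sub>l\<close> and \<open>f\<^sub>i\<^sub>k\<close> in the two orders
  agree term by term: the scalars from moving \<open>K\<^sub>i\<close> past \<open>e\<^sub>j\<close> in the first factor and \<open>K\<^sub>j\<close> past
  \<open>f\<^sub>i\<close> in the second are inverse to each other, because the matrix is symmetrizable
  (\<open>coprod_commute\<close>).

  For one index, with \<open>v = q\<^sub>(\<^sub>i\<^sub>)\<close> and \<open>K = K\<^sub>i\<close>, so that \<open>K e\<^sub>l = v\<^bsup>2l\<^esup> e\<^sub>l K\<close>, both sides of the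
  relation of levels \<open>k, l\<close> become sums over all \<open>(a, b, c, d, n)\<close> with \<open>a + b + n = l\<close> and
  \<open>c + d + n = k\<close>. The left-hand side consists of the terms
  \<open>e\<^sub>a f\<^sub>c K\<^bsup>d-n\<^esup> \<otimes> K\<^bsup>-a\<^esup> e\<^sub>b f\<^sub>d K\<^bsup>-n\<^esup>\<close> and the right-hand side of the terms
  \<open>f\<^sub>c e\<^sub>a K\<^bsup>d+n\<^esup> \<otimes> K\<^bsup>-a\<^esup> f\<^sub>d e\<^sub>b K\<^bsup>n\<^esup>\<close>, with suitable coefficients. The idea is to meet in the
  middle, at a sum of multiples of
  \<open>f\<^sub>c e\<^sub>a K\<^bsup>n+d\<^esup> \<otimes> K\<^bsup>-(a+n)\<^esup> e\<^sub>b f\<^sub>d\<close>.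
  If \<open>b\<close> and \<open>d\<close> are fixed on the left-hand side, the second factor is a fixed element up to a
  power of \<open>v\<close> and the first factors form one side of the Drinfeld relation of levels
  \<open>k - d, l - b\<close>; exchanging it for the other side gives the middle sum (\<open>coprod_ef\<close>). If \<open>a\<close> and
  \<open>c\<close> are fixed on the right-hand side, the first factor is fixed and the second factors form one
  side of the relation of levels \<open>k - c, l - a\<close>; exchanging it gives the same middle sum
  (\<open>coprod_fe\<close>). This uses the relations of all smaller levels, including level \<open>0\<close>, where they
  are trivial.

  Tensor products are quotients of a monoid algebra, so the existence of \<open>\<pi> \<otimes> \<pi>\<close> rests on the
  linear extension of multiplicative maps (\<open>linear_extension_alg_hom\<close>) and on the vanishing of
  this extension on the bilinearity relations (\<open>tensor_map_alg_hom\<close>).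
\<close>

section \<open>Associative algebras over a field\<close>

text \<open>
  Unital associative algebras, not necessarily commutative. The scalars are all elements of the
  field \<open>'k\<close>, so that only vectors carry a carrier condition.
\<close>

locale assoc_algebra = ring A for A :: "('k::field, 'a) module" (structure) +
  assumes smult_closed [simp]: "x \<in> carrier A \<Longrightarrow> c \<odot> x \<in> carrier A"
    and smult_add_scalar: "x \<in> carrier A \<Longrightarrow> (c + d) \<odot> x = c \<odot> x \<oplus> d \<odot> x"
    and smult_add: "x \<in> carrier A \<Longrightarrow> y \<in> carrier A \<Longrightarrow> c \<odot> (x \<oplus> y) = c \<odot> x \<oplus> c \<odot> y"
    and smult_smult: "x \<in> carrier A \<Longrightarrow> c \<odot> (d \<odot> x) = (c * d) \<odot> x"
    and smult_one: "x \<in> carrier A \<Longrightarrow> 1 \<odot> x = x"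
    and mult_smult_left: "x \<in> carrier A \<Longrightarrow> y \<in> carrier A \<Longrightarrow> (c \<odot> x) \<otimes> y = c \<odot> (x \<otimes> y)"
    and mult_smult_right: "x \<in> carrier A \<Longrightarrow> y \<in> carrier A \<Longrightarrow> x \<otimes> (c \<odot> y) = c \<odot> (x \<otimes> y)"
begin

lemma smult_zero_scalar:
  assumes "x \<in> carrier A" shows "0 \<odot> x = \<zero>"
proof -
  have "0 \<odot> x \<oplus> 0 \<odot> x = 0 \<odot> x"
    using smult_add_scalar[of x 0 0] assms by simp
  then show ?thesis using assms by (simp add: add.r_cancel_one)
qed

lemma smult_zero: "c \<odot> \<zero> = \<zero>"
proof -
  have "c \<odot> \<zero> \<oplus> c \<odot> \<zero> = c \<odot> \<zero>"
    using smult_add[of \<zero> \<zero> c] by simp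
  then show ?thesis by (simp add: add.r_cancel_one)
qed

lemma minus_eq_zero_imp_eq:
  assumes "x \<ominus> y = \<zero>" "x \<in> carrier A" "y \<in> carrier A"
  shows "x = y"
  using assms minus_equality[of x "\<ominus> y"] by (simp add: minus_eq)

lemma finsum_smult:
  assumes "f \<in> I \<rightarrow> carrier A"
  shows "c \<odot> finsum A f I = (\<Oplus>i\<in>I. c \<odot> f i)"
  using assms
proof (induction I rule: infinite_finite_induct)
  case (insert x F)
  then have "f x \<in> carrier A" "f \<in> F \<rightarrow> carrier A" by auto
  with insert show ?case by (simp add: smult_add Pi_def)
qed (simp_all add: smult_zero)

lemma sum_smult:
  assumes "x \<in> carrier A"
  shows "finite I \<Longrightarrow> sum c I \<odot> x = (\<Oplus>i\<in>I. c i \<odot> x)"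
  by (induction I rule: finite_induct)
     (use assms in \<open>simp_all add: smult_zero_scalar smult_add_scalar\<close>)

lemma finsum_Sigma:
  assumes "finite I" "\<And>i. i \<in> I \<Longrightarrow> finite (J i)"
    and "\<And>i j. i \<in> I \<Longrightarrow> j \<in> J i \<Longrightarrow> f i j \<in> carrier A"
  shows "(\<Oplus>i\<in>I. \<Oplus>j\<in>J i. f i j) = finsum A (\<lambda>(i, j). f i j) (Sigma I J)"
  using assms
proof (induction I rule: finite_induct)
  case (insert x F)
  have split: "Sigma (insert x F) J = (Pair x ` J x) \<union> Sigma F J" by auto
  have "finsum A (\<lambda>(i, j). f i j) (Sigma (insert x F) J)
      = finsum A (\<lambda>(i, j). f i j) (Pair x ` J x) \<oplus> finsum A (\<lambda>(i, j). f i j) (Sigma F J)"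
    unfolding split using insert by (intro finsum_Un_disjoint) auto
  also have "finsum A (\<lambda>(i, j). f i j) (Pair x ` J x) = (\<Oplus>j\<in>J x. f x j)"
    using insert by (subst finsum_reindex) (auto simp: inj_on_def)
  also have "finsum A (\<lambda>(i, j). f i j) (Sigma F J) = (\<Oplus>i\<in>F. \<Oplus>j\<in>J i. f i j)"
    using insert by simp
  finally show ?case
    using insert by (subst finsum_insert) (auto intro!: finsum_closed)
qed simp

lemma finsum_bij:
  assumes "bij_betw h I J" "\<And>j. j \<in> J \<Longrightarrow> g j \<in> carrier A" "\<And>i. i \<in> I \<Longrightarrow> f i = g (h i)"
  shows "finsum A f I = finsum A g J"
proof -
  have J: "J = h ` I" "inj_on h I" using assms(1) by (auto simp: bij_betw_def)
  have "finsum A g J = (\<Oplus>i\<in>I. g (h i))"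
    unfolding J(1) using assms(2) J by (intro finsum_reindex) auto
  also have "\<dots> = finsum A f I"
    using assms(2,3) J by (intro finsum_cong') auto
  finally show ?thesis ..
qed

lemma finsum_swap:
  assumes "finite I" "finite J" "\<And>i j. i \<in> I \<Longrightarrow> j \<in> J \<Longrightarrow> f i j \<in> carrier A"
  shows "(\<Oplus>i\<in>I. \<Oplus>j\<in>J. f i j) = (\<Oplus>j\<in>J. \<Oplus>i\<in>I. f i j)"
proof -
  have "(\<Oplus>i\<in>I. \<Oplus>j\<in>J. f i j) = finsum A (\<lambda>(i, j). f i j) (I \<times> J)"
    using assms by (intro finsum_Sigma) auto
  also have "\<dots> = finsum A (\<lambda>(j, i). f i j) (J \<times> I)"
    using assms by (intro finsum_bij[of "\<lambda>(i, j). (j, i)"]) (auto simp: bij_betw_def inj_on_def)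
  also have "\<dots> = (\<Oplus>j\<in>J. \<Oplus>i\<in>I. f i j)"
    using assms by (intro finsum_Sigma[symmetric]) auto
  finally show ?thesis .
qed

lemma finsum_mult_finsum:
  assumes "finite I" "finite J" "f \<in> I \<rightarrow> carrier A" "g \<in> J \<rightarrow> carrier A"
  shows "finsum A f I \<otimes> finsum A g J = finsum A (\<lambda>(i, j). f i \<otimes> g j) (I \<times> J)"
proof -
  have "finsum A f I \<otimes> finsum A g J = (\<Oplus>i\<in>I. f i \<otimes> finsum A g J)"
    using assms by (intro finsum_ldistr) auto
  also have "\<dots> = (\<Oplus>i\<in>I. \<Oplus>j\<in>J. f i \<otimes> g j)"
    using assms by (intro finsum_cong' refl finsum_rdistr) (auto intro!: m_closed finsum_closed)
  also have "\<dots> = finsum A (\<lambda>(i, j). f i \<otimes> g j) (I \<times> J)"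
    using assms by (intro finsum_Sigma) auto
  finally show ?thesis .
qed

lemma smult_finsum_mult:
  assumes "finite I" "f \<in> I \<rightarrow> carrier A" "z \<in> carrier A"
  shows "c \<odot> (finsum A f I \<otimes> z) = (\<Oplus>i\<in>I. c \<odot> (f i \<otimes> z))"
proof -
  have "finsum A f I \<otimes> z = (\<Oplus>i\<in>I. f i \<otimes> z)"
    using assms by (intro finsum_ldistr)
  then show ?thesis using assms by (simp add: finsum_smult Pi_iff)
qed

end

lemma alg_homI:
  assumes "\<phi> \<in> ring_hom A B" "\<And>c x. x \<in> carrier A \<Longrightarrow> \<phi> (c \<odot>\<^bsub>A\<^esub> x) = c \<odot>\<^bsub>B\<^esub> \<phi> x"
  shows "\<phi> \<in> alg_hom A B"
  using assms by (auto simp: alg_hom_def)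

lemma alg_hom_comp:
  assumes "\<phi> \<in> alg_hom A B" "\<psi> \<in> alg_hom B C"
  shows "\<psi> \<circ> \<phi> \<in> alg_hom A C"
  using assms ring_hom_trans[of \<phi> A B \<psi> C] by (auto simp: alg_hom_def dest: ring_hom_closed)

text \<open>A homomorphism is only constrained on the carrier.\<close>

locale assoc_algebra_hom = dom: assoc_algebra A + cod: assoc_algebra B
  for A :: "('k::field, 'a) module" and B :: "('k, 'b) module" +
  fixes \<phi>
  assumes alg_hom: "\<phi> \<in> alg_hom A B"
begin

lemma ring_hom: "\<phi> \<in> ring_hom A B"
  using alg_hom by (simp add: alg_hom_def)

sublocale ring_hom_ring A B \<phi>
  by unfold_locales (rule ring_hom)

lemma hom_smult: "x \<in> carrier A \<Longrightarrow> \<phi> (c \<odot>\<^bsub>A\<^esub> x) = c \<odot>\<^bsub>B\<^esub> \<phi> x"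
  using alg_hom by (simp add: alg_hom_def)

lemma hom_finsum:
  assumes "f \<in> I \<rightarrow> carrier A"
  shows "\<phi> (finsum A f I) = finsum B (\<lambda>i. \<phi> (f i)) I"
  using assms
proof (induction I rule: infinite_finite_induct)
  case (insert x F)
  then have "f x \<in> carrier A" "f \<in> F \<rightarrow> carrier A" by auto
  with insert show ?case
    by (simp add: Pi_def)
qed simp_all

lemma hom_minus: "x \<in> carrier A \<Longrightarrow> y \<in> carrier A \<Longrightarrow> \<phi> (x \<ominus>\<^bsub>A\<^esub> y) = \<phi> x \<ominus>\<^bsub>B\<^esub> \<phi> y"
  by (simp add: a_minus_def)

text \<open>The kernel is an ideal, so vanishing on generators of an ideal implies vanishing on it.\<close>

lemma vanishes_on_genideal:
  assumes "S \<subseteq> carrier A" "\<And>x. x \<in> S \<Longrightarrow> \<phi> x = \<zero>\<^bsub>B\<^esub>" "x \<in> Idl\<^bsub>A\<^esub> S"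
  shows "\<phi> x = \<zero>\<^bsub>B\<^esub>"
proof -
  have "S \<subseteq> a_kernel A B \<phi>"
    using assms(1,2) unfolding a_kernel_def' by blast
  then have "Idl\<^bsub>A\<^esub> S \<subseteq> a_kernel A B \<phi>"
    by (rule dom.genideal_minimal[OF kernel_is_ideal])
  with assms(3) show ?thesis unfolding a_kernel_def' by blast
qed

end


section \<open>Monoid algebras\<close>

lemma monoid_algebra_simps [simp]:
  "carrier (monoid_algebra M) = {f. finite {x. f x \<noteq> 0} \<and> {x. f x \<noteq> 0} \<subseteq> carrier M}"
  "\<one>\<^bsub>monoid_algebra M\<^esub> = basis_elt \<one>\<^bsub>M\<^esub>"
  "\<zero>\<^bsub>monoid_algebra M\<^esub> = (\<lambda>x. 0)"
  "f \<oplus>\<^bsub>monoid_algebra M\<^esub> g = (\<lambda>x. f x + g x)"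
  "c \<odot>\<^bsub>monoid_algebra M\<^esub> f = (\<lambda>x. c * f x)"
  by (auto simp: monoid_algebra_def basis_elt_def)

text \<open>
  The convolution product may be computed over any finite sets that contain the supports; this
  gives sums over fixed index sets, independent of the point of evaluation.
\<close>

lemma monoid_algebra_mult:
  fixes f g :: "'m \<Rightarrow> 'k::field"
  assumes "finite S" "finite T" "{x. f x \<noteq> 0} \<subseteq> S" "{x. g x \<noteq> 0} \<subseteq> T"
  shows "(f \<otimes>\<^bsub>monoid_algebra M\<^esub> g) x = (\<Sum>u\<in>S. \<Sum>v\<in>T. if u \<otimes>\<^bsub>M\<^esub> v = x then f u * g v else 0)"
proof -
  have "(f \<otimes>\<^bsub>monoid_algebra M\<^esub> g) x
      = (\<Sum>(u, v) \<in> {(u, v). f u \<noteq> 0 \<and> g v \<noteq> 0 \<and> u \<otimes>\<^bsub>M\<^esub> v = x}. f u * g v)"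
    by (simp add: monoid_algebra_def)
  also have "\<dots> = (\<Sum>(u, v) \<in> S \<times> T. if u \<otimes>\<^bsub>M\<^esub> v = x then f u * g v else 0)"
    using assms by (intro sum.mono_neutral_cong_left) (auto split: if_splits)
  finally show ?thesis by (simp add: sum.cartesian_product)
qed

lemma basis_elt_mult:
  "basis_elt u \<otimes>\<^bsub>monoid_algebra M\<^esub> basis_elt v = (basis_elt (u \<otimes>\<^bsub>M\<^esub> v) :: 'm \<Rightarrow> 'k::field)"
proof
  fix x
  show "(basis_elt u \<otimes>\<^bsub>monoid_algebra M\<^esub> basis_elt v) x = (basis_elt (u \<otimes>\<^bsub>M\<^esub> v) x :: 'k)"
    by (subst monoid_algebra_mult[of "{u}" "{v}"]) (auto simp: basis_elt_def split: if_splits)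
qed

lemma basis_elt_closed: "u \<in> carrier M \<Longrightarrow> basis_elt u \<in> carrier (monoid_algebra M)"
  by (auto simp: basis_elt_def)

context Group.monoid
begin

lemma mult_support_subset:
  fixes f g :: "'a \<Rightarrow> 'k::field"
  assumes "f \<in> carrier (monoid_algebra G)" "g \<in> carrier (monoid_algebra G)"
  shows "{x. (f \<otimes>\<^bsub>monoid_algebra G\<^esub> g) x \<noteq> 0}
           \<subseteq> (\<lambda>(u, v). u \<otimes> v) ` ({u. f u \<noteq> 0} \<times> {v. g v \<noteq> 0})"
proof
  fix x assume "x \<in> {x. (f \<otimes>\<^bsub>monoid_algebra G\<^esub> g) x \<noteq> 0}"
  then have "(\<Sum>u | f u \<noteq> 0. \<Sum>v | g v \<noteq> 0. if u \<otimes> v = x then f u * g v else 0) \<noteq> 0"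
    using assms by (subst (asm) mem_Collect_eq, subst (asm) monoid_algebra_mult[of "{u. f u \<noteq> 0}" "{v. g v \<noteq> 0}"]) auto
  then obtain u where u: "f u \<noteq> 0" "(\<Sum>v | g v \<noteq> 0. if u \<otimes> v = x then f u * g v else 0) \<noteq> 0"
    by (blast elim: sum.not_neutral_contains_not_neutral)
  from u(2) obtain v where "g v \<noteq> 0" "(if u \<otimes> v = x then f u * g v else 0) \<noteq> 0"
    by (blast elim: sum.not_neutral_contains_not_neutral)
  then have "g v \<noteq> 0" "u \<otimes> v = x" by (auto split: if_splits)
  with u show "x \<in> (\<lambda>(u, v). u \<otimes> v) ` ({u. f u \<noteq> 0} \<times> {v. g v \<noteq> 0})" by force
qed

lemma monoid_algebra_mult_closed:
  fixes f g :: "'a \<Rightarrow> 'k::field"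
  assumes "f \<in> carrier (monoid_algebra G)" "g \<in> carrier (monoid_algebra G)"
  shows "f \<otimes>\<^bsub>monoid_algebra G\<^esub> g \<in> carrier (monoid_algebra G)"
proof -
  let ?W = "(\<lambda>(u, v). u \<otimes> v) ` ({u. f u \<noteq> 0} \<times> {v. g v \<noteq> 0})"
  have "finite ?W" "?W \<subseteq> carrier G" using assms by auto
  with mult_support_subset[OF assms] show ?thesis
    by (auto intro: finite_subset)
qed

lemma monoid_algebra_assoc:
  fixes f g h :: "'a \<Rightarrow> 'k::field"
  assumes f: "f \<in> carrier (monoid_algebra G)" and g: "g \<in> carrier (monoid_algebra G)"
    and h: "h \<in> carrier (monoid_algebra G)"
  shows "(f \<otimes>\<^bsub>monoid_algebra G\<^esub> g) \<otimes>\<^bsub>monoid_algebra G\<^esub> h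
       = f \<otimes>\<^bsub>monoid_algebra G\<^esub> (g \<otimes>\<^bsub>monoid_algebra G\<^esub> h)"
proof
  fix x
  define S where "S = {u. f u \<noteq> 0}"
  define T where "T = {u. g u \<noteq> 0}"
  define Z where "Z = {u. h u \<noteq> 0}"
  have fin: "finite S" "finite T" "finite Z" and sub: "S \<subseteq> carrier G" "T \<subseteq> carrier G" "Z \<subseteq> carrier G"
    using assms by (auto simp: S_def T_def Z_def)
  define ST where "ST = (\<lambda>(u, v). u \<otimes> v) ` (S \<times> T)"
  define TZ where "TZ = (\<lambda>(u, v). u \<otimes> v) ` (T \<times> Z)"
  have fin2: "finite ST" "finite TZ" using fin by (auto simp: ST_def TZ_def)
  have "((f \<otimes>\<^bsub>monoid_algebra G\<^esub> g) \<otimes>\<^bsub>monoid_algebra G\<^esub> h) x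
      = (\<Sum>w\<in>ST. \<Sum>z\<in>Z. if w \<otimes> z = x then (f \<otimes>\<^bsub>monoid_algebra G\<^esub> g) w * h z else 0)"
    using mult_support_subset[OF f g] fin fin2
    by (intro monoid_algebra_mult) (auto simp: S_def T_def ST_def Z_def)
  also have "\<dots> = (\<Sum>w\<in>ST. \<Sum>z\<in>Z. \<Sum>u\<in>S. \<Sum>v\<in>T.
      if u \<otimes> v = w then if w \<otimes> z = x then f u * g v * h z else 0 else 0)"
    by (intro sum.cong refl, subst monoid_algebra_mult[of S T f g])
       (use fin in \<open>auto simp: sum_distrib_right S_def T_def intro!: sum.cong sum.neutral\<close>)
  also have "\<dots> = (\<Sum>z\<in>Z. \<Sum>u\<in>S. \<Sum>v\<in>T. \<Sum>w\<in>ST.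
      if u \<otimes> v = w then if w \<otimes> z = x then f u * g v * h z else 0 else 0)"
    \<comment> \<open>the instantiated swap moves the sum over \<open>ST\<close> to the innermost position\<close>
    by (simp only: sum.swap[where A = ST])
  also have "\<dots> = (\<Sum>z\<in>Z. \<Sum>u\<in>S. \<Sum>v\<in>T. if (u \<otimes> v) \<otimes> z = x then f u * g v * h z else 0)"
    using fin2 by (intro sum.cong refl, subst sum.delta') (auto simp: ST_def)
  also have "\<dots> = (\<Sum>u\<in>S. \<Sum>v\<in>T. \<Sum>z\<in>Z. if u \<otimes> (v \<otimes> z) = x then f u * g v * h z else 0)"
    unfolding sum.swap[where A = Z]
    by (intro sum.cong refl) (use sub in \<open>auto simp: m_assoc subset_iff\<close>)
  also have "\<dots> = (\<Sum>u\<in>S. \<Sum>v\<in>T. \<Sum>z\<in>Z. \<Sum>w\<in>TZ.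
      if v \<otimes> z = w then if u \<otimes> w = x then f u * g v * h z else 0 else 0)"
    using fin2 by (intro sum.cong refl, subst sum.delta') (auto simp: TZ_def)
  also have "\<dots> = (\<Sum>u\<in>S. \<Sum>w\<in>TZ. \<Sum>v\<in>T. \<Sum>z\<in>Z.
      if v \<otimes> z = w then if u \<otimes> w = x then f u * g v * h z else 0 else 0)"
    by (simp only: sum.swap[where A = TZ])
  also have "\<dots> = (\<Sum>u\<in>S. \<Sum>w\<in>TZ. if u \<otimes> w = x then f u * (g \<otimes>\<^bsub>monoid_algebra G\<^esub> h) w else 0)"
    by (intro sum.cong refl, subst monoid_algebra_mult[of T Z g h])
       (use fin in \<open>auto simp: sum_distrib_left mult.assoc T_def Z_def intro!: sum.cong sum.neutral\<close>)
  also have "\<dots> = (f \<otimes>\<^bsub>monoid_algebra G\<^esub> (g \<otimes>\<^bsub>monoid_algebra G\<^esub> h)) x"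
    using mult_support_subset[OF g h] fin fin2
    by (intro monoid_algebra_mult[symmetric]) (auto simp: S_def T_def TZ_def Z_def)
  finally show "((f \<otimes>\<^bsub>monoid_algebra G\<^esub> g) \<otimes>\<^bsub>monoid_algebra G\<^esub> h) x
      = (f \<otimes>\<^bsub>monoid_algebra G\<^esub> (g \<otimes>\<^bsub>monoid_algebra G\<^esub> h)) x" .
qed

lemma assoc_algebra_monoid_algebra: "assoc_algebra (monoid_algebra G :: ('k::field, 'a \<Rightarrow> 'k) module)"
proof -
  let ?R = "monoid_algebra G :: ('k::field, 'a \<Rightarrow> 'k) module"
  have add: "finite {x. f x + g x \<noteq> 0} \<and> {x. f x + g x \<noteq> 0} \<subseteq> carrier G"
    if "f \<in> carrier ?R" "g \<in> carrier ?R" for f g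
  proof -
    have "{x. f x + g x \<noteq> 0} \<subseteq> {x. f x \<noteq> 0} \<union> {x. g x \<noteq> 0}" by auto
    with that show ?thesis by (auto intro: finite_subset)
  qed
  have ab: "abelian_group ?R"
  proof (rule abelian_groupI)
    fix f assume "f \<in> carrier ?R"
    then show "\<exists>g\<in>carrier ?R. g \<oplus>\<^bsub>?R\<^esub> f = \<zero>\<^bsub>?R\<^esub>"
      by (intro bexI[of _ "\<lambda>x. - f x"]) auto
  qed (use add in \<open>auto simp: algebra_simps\<close>)
  have "ring ?R"
  proof (rule ringI[OF ab])
    show "Group.monoid ?R"
    proof (rule monoidI)
      fix f assume f: "f \<in> carrier ?R"
      have fin: "finite {u. f u \<noteq> 0}" using f by simp
      have delta: "(\<Sum>u | f u \<noteq> 0. if u = x then f u else 0) = f x" for x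
        using fin by (simp add: sum.delta)
      have "(basis_elt \<one> \<otimes>\<^bsub>?R\<^esub> f) x = f x" for x
      proof -
        have "(basis_elt \<one> \<otimes>\<^bsub>?R\<^esub> f) x = (\<Sum>u | f u \<noteq> 0. if \<one> \<otimes> u = x then f u else 0)"
          using fin by (subst monoid_algebra_mult[of "{\<one>}" "{u. f u \<noteq> 0}"])
            (auto simp: basis_elt_def intro!: sum.cong)
        also have "\<dots> = (\<Sum>u | f u \<noteq> 0. if u = x then f u else 0)"
          using f by (intro sum.cong refl) auto
        finally show ?thesis using delta by simp
      qed
      then show "\<one>\<^bsub>?R\<^esub> \<otimes>\<^bsub>?R\<^esub> f = f" by auto
      have "(f \<otimes>\<^bsub>?R\<^esub> basis_elt \<one>) x = f x" for x
      proof -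
        have "(f \<otimes>\<^bsub>?R\<^esub> basis_elt \<one>) x = (\<Sum>u | f u \<noteq> 0. if u \<otimes> \<one> = x then f u else 0)"
          using fin by (subst monoid_algebra_mult[of "{u. f u \<noteq> 0}" "{\<one>}"])
            (auto simp: basis_elt_def intro!: sum.cong)
        also have "\<dots> = (\<Sum>u | f u \<noteq> 0. if u = x then f u else 0)"
          using f by (intro sum.cong refl) auto
        finally show ?thesis using delta by simp
      qed
      then show "f \<otimes>\<^bsub>?R\<^esub> \<one>\<^bsub>?R\<^esub> = f" by auto
    qed (use monoid_algebra_mult_closed monoid_algebra_assoc basis_elt_closed[OF one_closed] in
          \<open>auto simp del: monoid_algebra_simps(1) simp: monoid_algebra_simps(2)\<close>)
  next
    fix f g h assume f: "f \<in> carrier ?R" and g: "g \<in> carrier ?R" and h: "h \<in> carrier ?R"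
    let ?s = "\<lambda>f::'a \<Rightarrow> 'k. {x. f x \<noteq> 0}"
    define S where "S = ?s f \<union> ?s g"
    define T where "T = ?s h"
    have fin: "finite S" "finite T" using f g h by (auto simp: S_def T_def)
    have l: "(f' \<otimes>\<^bsub>?R\<^esub> h) x = (\<Sum>u\<in>S. \<Sum>v\<in>T. if u \<otimes> v = x then f' u * h v else 0)"
      if "?s f' \<subseteq> S" for f' x
      using that fin by (intro monoid_algebra_mult) (auto simp: T_def)
    have r: "(h \<otimes>\<^bsub>?R\<^esub> f') x = (\<Sum>u\<in>T. \<Sum>v\<in>S. if u \<otimes> v = x then h u * f' v else 0)"
      if "?s f' \<subseteq> S" for f' x
      using that fin by (intro monoid_algebra_mult) (auto simp: T_def)
    have sub: "?s f \<subseteq> S" "?s g \<subseteq> S" "?s (\<lambda>x. f x + g x) \<subseteq> S" by (auto simp: S_def)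
    show "(f \<oplus>\<^bsub>?R\<^esub> g) \<otimes>\<^bsub>?R\<^esub> h = f \<otimes>\<^bsub>?R\<^esub> h \<oplus>\<^bsub>?R\<^esub> g \<otimes>\<^bsub>?R\<^esub> h"
      unfolding monoid_algebra_simps l[OF sub(1)] l[OF sub(2)] l[OF sub(3)] sum.distrib[symmetric]
      by (intro ext sum.cong refl) (simp add: algebra_simps)
    show "h \<otimes>\<^bsub>?R\<^esub> (f \<oplus>\<^bsub>?R\<^esub> g) = h \<otimes>\<^bsub>?R\<^esub> f \<oplus>\<^bsub>?R\<^esub> h \<otimes>\<^bsub>?R\<^esub> g"
      unfolding monoid_algebra_simps r[OF sub(1)] r[OF sub(2)] r[OF sub(3)] sum.distrib[symmetric]
      by (intro ext sum.cong refl) (simp add: algebra_simps)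
  qed
  then interpret ring ?R .
  show ?thesis
  proof
    fix f g and c :: 'k assume f: "f \<in> carrier ?R" and g: "g \<in> carrier ?R"
    let ?s = "\<lambda>f::'a \<Rightarrow> 'k. {x. f x \<noteq> 0}"
    have fin: "finite (?s f)" "finite (?s g)" using f g by auto
    have eq: "(f' \<otimes>\<^bsub>?R\<^esub> g') x = (\<Sum>u\<in>?s f. \<Sum>v\<in>?s g. if u \<otimes> v = x then f' u * g' v else 0)"
      if "?s f' \<subseteq> ?s f" "?s g' \<subseteq> ?s g" for f' g' x
      using fin that by (intro monoid_algebra_mult)
    have sub: "?s (\<lambda>x. c * f x) \<subseteq> ?s f" "?s (\<lambda>x. c * g x) \<subseteq> ?s g" by auto
    show "(c \<odot>\<^bsub>?R\<^esub> f) \<otimes>\<^bsub>?R\<^esub> g = c \<odot>\<^bsub>?R\<^esub> (f \<otimes>\<^bsub>?R\<^esub> g)"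
      unfolding monoid_algebra_simps eq[OF sub(1) order.refl] eq[OF order.refl order.refl] sum_distrib_left
      by (intro ext sum.cong refl) (simp add: algebra_simps)
    show "f \<otimes>\<^bsub>?R\<^esub> (c \<odot>\<^bsub>?R\<^esub> g) = c \<odot>\<^bsub>?R\<^esub> (f \<otimes>\<^bsub>?R\<^esub> g)"
      unfolding monoid_algebra_simps eq[OF order.refl sub(2)] eq[OF order.refl order.refl] sum_distrib_left
      by (intro ext sum.cong refl) (simp add: algebra_simps)
  qed (auto simp: algebra_simps)
qed

end

subsection \<open>Linear extension of a multiplicative map\<close>

text \<open>
  The extension of \<open>g\<close> from the monoid, that is, from the basis of the monoid algebra, to finite
  linear combinations.
\<close>

definition linear_extension :: "('k::field, 'a) module \<Rightarrow> ('m \<Rightarrow> 'a) \<Rightarrow> ('m \<Rightarrow> 'k) \<Rightarrow> 'a" where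
  "linear_extension A g f = (\<Oplus>\<^bsub>A\<^esub>z\<in>{z. f z \<noteq> 0}. f z \<odot>\<^bsub>A\<^esub> g z)"

context assoc_algebra
begin

lemma linear_extension_superset:
  assumes "finite S" "{z. f z \<noteq> 0} \<subseteq> S" "g \<in> S \<rightarrow> carrier A"
  shows "linear_extension A g f = (\<Oplus>z\<in>S. f z \<odot> g z)"
  unfolding linear_extension_def
  using assms by (intro add.finprod_mono_neutral_cong_left) (auto simp: smult_zero_scalar Pi_iff)

lemma linear_extension_basis_elt:
  assumes "g u \<in> carrier A"
  shows "linear_extension A g (basis_elt u) = g u"
  using assms by (subst linear_extension_superset[of "{u}"]) (auto simp: basis_elt_def smult_one)

lemma linear_extension_add:
  assumes "f \<in> carrier (monoid_algebra M)" "h \<in> carrier (monoid_algebra M)" "g \<in> carrier M \<rightarrow> carrier A"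
  shows "linear_extension A g (\<lambda>x. f x + h x) = linear_extension A g f \<oplus> linear_extension A g h"
proof -
  define S where "S = {z. f z \<noteq> 0} \<union> {z. h z \<noteq> 0}"
  have S: "finite S" "g \<in> S \<rightarrow> carrier A" using assms by (auto simp: S_def)
  have "linear_extension A g (\<lambda>x. f x + h x) = (\<Oplus>z\<in>S. (f z + h z) \<odot> g z)"
    using S by (intro linear_extension_superset) (auto simp: S_def)
  also have "\<dots> = (\<Oplus>z\<in>S. f z \<odot> g z \<oplus> h z \<odot> g z)"
    using S by (intro finsum_cong') (auto simp: smult_add_scalar Pi_iff)
  also have "\<dots> = (\<Oplus>z\<in>S. f z \<odot> g z) \<oplus> (\<Oplus>z\<in>S. h z \<odot> g z)"
    using S by (intro finsum_addf) (auto simp: Pi_iff)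
  also have "\<dots> = linear_extension A g f \<oplus> linear_extension A g h"
    using S by (subst (1 2) linear_extension_superset[of S]) (auto simp: S_def)
  finally show ?thesis .
qed

lemma linear_extension_smult:
  assumes "f \<in> carrier (monoid_algebra M)" "g \<in> carrier M \<rightarrow> carrier A"
  shows "linear_extension A g (\<lambda>x. c * f x) = c \<odot> linear_extension A g f"
proof -
  define S where "S = {z. f z \<noteq> 0}"
  have S: "finite S" "g \<in> S \<rightarrow> carrier A" using assms by (auto simp: S_def)
  have "linear_extension A g (\<lambda>x. c * f x) = (\<Oplus>z\<in>S. (c * f z) \<odot> g z)"
    using S by (intro linear_extension_superset) (auto simp: S_def)
  also have "\<dots> = (\<Oplus>z\<in>S. c \<odot> (f z \<odot> g z))"
    using S by (intro finsum_cong') (auto simp: smult_smult Pi_iff)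
  also have "\<dots> = c \<odot> linear_extension A g f"
    using S unfolding linear_extension_def S_def[symmetric] by (intro finsum_smult[symmetric]) (auto simp: Pi_iff)
  finally show ?thesis .
qed

lemma linear_extension_mult:
  assumes M: "Group.monoid M" and f: "f \<in> carrier (monoid_algebra M)" and h: "h \<in> carrier (monoid_algebra M)"
    and g: "g \<in> carrier M \<rightarrow> carrier A"
    and g_mult: "\<And>u v. u \<in> carrier M \<Longrightarrow> v \<in> carrier M \<Longrightarrow> g (u \<otimes>\<^bsub>M\<^esub> v) = g u \<otimes> g v"
  shows "linear_extension A g (f \<otimes>\<^bsub>monoid_algebra M\<^esub> h)
       = linear_extension A g f \<otimes> linear_extension A g h"
proof -
  interpret M: Group.monoid M by fact
  define S where "S = {u. f u \<noteq> 0}"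
  define T where "T = {v. h v \<noteq> 0}"
  define W where "W = (\<lambda>(u, v). u \<otimes>\<^bsub>M\<^esub> v) ` (S \<times> T)"
  have fin: "finite S" "finite T" "finite W" and sub: "S \<subseteq> carrier M" "T \<subseteq> carrier M"
    using f h by (auto simp: S_def T_def W_def)
  have W: "W \<subseteq> carrier M" using sub by (auto simp: W_def)
  have gW: "w \<in> W \<Longrightarrow> g w \<in> carrier A" for w using g W by auto
  have gS: "u \<in> S \<Longrightarrow> g u \<in> carrier A" and gT: "u \<in> T \<Longrightarrow> g u \<in> carrier A" for u using g sub by auto
  have "linear_extension A g (f \<otimes>\<^bsub>monoid_algebra M\<^esub> h)
      = (\<Oplus>w\<in>W. (f \<otimes>\<^bsub>monoid_algebra M\<^esub> h) w \<odot> g w)"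
    using fin gW M.mult_support_subset[OF f h]
    by (intro linear_extension_superset) (auto simp: W_def S_def T_def)
  also have "\<dots> = (\<Oplus>w\<in>W. \<Oplus>p\<in>S \<times> T.
      (if fst p \<otimes>\<^bsub>M\<^esub> snd p = w then f (fst p) * h (snd p) else 0) \<odot> g w)"
  proof (intro finsum_cong' refl)
    fix w assume w: "w \<in> W"
    have "(f \<otimes>\<^bsub>monoid_algebra M\<^esub> h) w
        = (\<Sum>p\<in>S \<times> T. if fst p \<otimes>\<^bsub>M\<^esub> snd p = w then f (fst p) * h (snd p) else 0)"
      using fin by (subst monoid_algebra_mult[of S T])
        (auto simp: S_def T_def sum.cartesian_product case_prod_beta')
    then show "(f \<otimes>\<^bsub>monoid_algebra M\<^esub> h) w \<odot> g w = (\<Oplus>p\<in>S \<times> T.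
      (if fst p \<otimes>\<^bsub>M\<^esub> snd p = w then f (fst p) * h (snd p) else 0) \<odot> g w)"
      using fin gW[OF w] by (simp add: sum_smult)
  qed (use gW in auto)
  also have "\<dots> = (\<Oplus>p\<in>S \<times> T. \<Oplus>w\<in>W.
      (if fst p \<otimes>\<^bsub>M\<^esub> snd p = w then f (fst p) * h (snd p) else 0) \<odot> g w)"
    using fin gW by (intro finsum_swap) auto
  also have "\<dots> = finsum A (\<lambda>(u, v). (f u \<odot> g u) \<otimes> (h v \<odot> g v)) (S \<times> T)"
  proof (intro finsum_cong' refl)
    fix p assume p: "p \<in> S \<times> T"
    then obtain u v where uv: "p = (u, v)" "u \<in> S" "v \<in> T" by auto
    have uvW: "u \<otimes>\<^bsub>M\<^esub> v \<in> W" using uv by (auto simp: W_def)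
    have "(\<Oplus>w\<in>W. (if u \<otimes>\<^bsub>M\<^esub> v = w then f u * h v else 0) \<odot> g w)
        = (\<Oplus>w\<in>W. if u \<otimes>\<^bsub>M\<^esub> v = w then (f u * h v) \<odot> g w else \<zero>)"
      using gW by (intro finsum_cong') (auto simp: smult_zero_scalar)
    also have "\<dots> = (f u * h v) \<odot> g (u \<otimes>\<^bsub>M\<^esub> v)"
      using fin uvW gW by (intro finsum_singleton) auto
    also have "\<dots> = (f u \<odot> g u) \<otimes> (h v \<odot> g v)"
      using uv gS gT sub by (simp add: g_mult subset_iff mult_smult_left mult_smult_right smult_smult mult.commute)
    finally show "(\<Oplus>w\<in>W. (if fst p \<otimes>\<^bsub>M\<^esub> snd p = w then f (fst p) * h (snd p) else 0) \<odot> g w)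
        = (case p of (u, v) \<Rightarrow> (f u \<odot> g u) \<otimes> (h v \<odot> g v))"
      unfolding uv(1) fst_conv snd_conv case_prod_conv .
  qed (use gS gT in auto)
  also have "\<dots> = linear_extension A g f \<otimes> linear_extension A g h"
    unfolding linear_extension_def S_def[symmetric] T_def[symmetric]
    using fin gS gT by (intro finsum_mult_finsum[symmetric]) auto
  finally show ?thesis .
qed

lemma linear_extension_alg_hom:
  assumes M: "Group.monoid M" and g: "g \<in> carrier M \<rightarrow> carrier A"
    and g_one: "g \<one>\<^bsub>M\<^esub> = \<one>"
    and g_mult: "\<And>u v. u \<in> carrier M \<Longrightarrow> v \<in> carrier M \<Longrightarrow> g (u \<otimes>\<^bsub>M\<^esub> v) = g u \<otimes> g v"
  shows "linear_extension A g \<in> alg_hom (monoid_algebra M) A"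
proof (intro alg_homI ring_hom_memI)
  fix f :: "'b \<Rightarrow> 'k" and c assume f: "f \<in> carrier (monoid_algebra M)"
  have "finite {z. f z \<noteq> 0}" "g \<in> {z. f z \<noteq> 0} \<rightarrow> carrier A" using f g by auto
  then show "linear_extension A g f \<in> carrier A"
    unfolding linear_extension_def by (intro finsum_closed) (auto simp: Pi_iff)
  show "linear_extension A g (c \<odot>\<^bsub>monoid_algebra M\<^esub> f) = c \<odot> linear_extension A g f"
    using linear_extension_smult[OF f g] by simp
  fix h :: "'b \<Rightarrow> 'k" assume h: "h \<in> carrier (monoid_algebra M)"
  show "linear_extension A g (f \<oplus>\<^bsub>monoid_algebra M\<^esub> h) = linear_extension A g f \<oplus> linear_extension A g h"
    using linear_extension_add[OF f h g] by simp
  show "linear_extension A g (f \<otimes>\<^bsub>monoid_algebra M\<^esub> h) = linear_extension A g f \<otimes> linear_extension A g h"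
    using linear_extension_mult[OF M f h g g_mult] .
qed (simp add: linear_extension_basis_elt g_one)

end


section \<open>Quotient algebras\<close>

lemma quotient_algebra_simps:
  "carrier (quotient_algebra A J) = carrier (A Quot J)"
  "mult (quotient_algebra A J) = mult (A Quot J)"
  "one (quotient_algebra A J) = one (A Quot J)"
  "zero (quotient_algebra A J) = zero (A Quot J)"
  "add (quotient_algebra A J) = add (A Quot J)"
  "c \<odot>\<^bsub>quotient_algebra A J\<^esub> X = (\<Union>x\<in>X. J +>\<^bsub>A\<^esub> (c \<odot>\<^bsub>A\<^esub> x))"
  by (simp_all add: quotient_algebra_def ring.extend_def module.fields_def)

text \<open>
  A two-sided ideal \<open>J\<close> of the underlying ring. It is automatically a subspace, since
  \<open>c x = (c 1) x\<close>, and this makes the scalar multiplication of cosets well defined.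
\<close>

locale algebra_ideal = assoc_algebra A + ideal J A for A :: "('k::field, 'a) module" (structure) and J
begin

lemma smult_mem_ideal:
  assumes "x \<in> J" shows "c \<odot> x \<in> J"
proof -
  have "c \<odot> x = (c \<odot> \<one>) \<otimes> x" using assms by (simp add: mult_smult_left Icarr)
  then show ?thesis using assms by (simp add: I_l_closed)
qed

lemma coset_eq_iff:
  assumes "x \<in> carrier A" "y \<in> carrier A"
  shows "J +> x = J +> y \<longleftrightarrow> x \<in> J +> y"
  using a_repr_independence'[of x y] a_rcos_self[of x] assms by metis

lemma coset_eqI:
  assumes "x \<ominus> y \<in> J" "x \<in> carrier A" "y \<in> carrier A"
  shows "J +> x = J +> y"
  using assms by (simp add: coset_eq_iff a_rcos_module_minus[OF ring_axioms])

lemma smult_coset: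
  assumes "x \<in> carrier A"
  shows "c \<odot>\<^bsub>quotient_algebra A J\<^esub> (J +> x) = J +> (c \<odot> x)"
proof -
  have "J +> (c \<odot> y) = J +> (c \<odot> x)" if y: "y \<in> J +> x" for y
  proof -
    obtain j where j: "j \<in> J" "y = j \<oplus> x" using y by (auto simp: a_r_coset_def')
    then have "c \<odot> y = c \<odot> j \<oplus> c \<odot> x" using assms by (simp add: smult_add Icarr)
    then have "c \<odot> y \<in> J +> (c \<odot> x)" using j smult_mem_ideal by (auto simp: a_r_coset_def')
    moreover have "c \<odot> y \<in> carrier A" using j assms by (simp add: Icarr)
    ultimately show ?thesis using assms by (simp add: coset_eq_iff)
  qed
  moreover have "x \<in> J +> x" by (rule a_rcos_self[OF assms])
  ultimately show ?thesis unfolding quotient_algebra_simps by blast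
qed

lemma quotient_carrier: "carrier (quotient_algebra A J) = (\<lambda>x. J +> x) ` carrier A"
  by (auto simp: quotient_algebra_simps FactRing_def A_RCOSETS_def')

lemma quotient_ops:
  assumes "x \<in> carrier A" "y \<in> carrier A"
  shows "(J +> x) \<oplus>\<^bsub>quotient_algebra A J\<^esub> (J +> y) = J +> (x \<oplus> y)"
    and "(J +> x) \<otimes>\<^bsub>quotient_algebra A J\<^esub> (J +> y) = J +> (x \<otimes> y)"
  using rcos_ring_hom assms by (simp_all add: quotient_algebra_simps ring_hom_add ring_hom_mult)

lemma quotient_one: "\<one>\<^bsub>quotient_algebra A J\<^esub> = J +> \<one>"
  by (simp add: quotient_algebra_simps FactRing_def)

lemma quotient_ring: "ring (quotient_algebra A J)"
proof -
  interpret Q: ring "A Quot J" by (rule quotient_is_ring)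
  have "\<exists>Y\<in>carrier (A Quot J). Y \<oplus>\<^bsub>A Quot J\<^esub> X = \<zero>\<^bsub>A Quot J\<^esub>" if "X \<in> carrier (A Quot J)" for X
    using Q.l_neg[OF that] Q.a_inv_closed[OF that] by blast
  then have "abelian_group (quotient_algebra A J)"
    by (intro abelian_groupI; unfold quotient_algebra_simps) (erule (2) Q.a_assoc | erule (1) Q.a_comm | simp)+
  moreover have "Group.monoid (quotient_algebra A J)"
    by (rule monoidI) (auto simp: quotient_algebra_simps Q.m_assoc)
  ultimately show ?thesis
    by (rule ringI) (auto simp: quotient_algebra_simps Q.l_distr Q.r_distr)
qed

lemma assoc_algebra_quotient: "assoc_algebra (quotient_algebra A J)"
proof -
  interpret Q: ring "quotient_algebra A J" by (rule quotient_ring)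
  show ?thesis
    by unfold_locales
       (auto simp: quotient_carrier smult_coset quotient_ops smult_add smult_add_scalar
          smult_smult smult_one mult_smult_left mult_smult_right)
qed

lemma proj_alg_hom: "(\<lambda>x. J +> x) \<in> alg_hom A (quotient_algebra A J)"
  by (intro alg_homI ring_hom_memI) (auto simp: quotient_carrier quotient_ops quotient_one smult_coset)

lemma coset_zero: "x \<in> J \<Longrightarrow> J +> x = \<zero>\<^bsub>quotient_algebra A J\<^esub>"
  by (simp add: quotient_algebra_simps FactRing_def a_coset_join2 a_subgroup Icarr)

text \<open>
  A homomorphism that vanishes on the ideal is constant on each coset, so it factors through the
  quotient.
\<close>

lemma hom_const_on_coset:
  assumes "assoc_algebra B" "\<phi> \<in> alg_hom A B" "\<And>x. x \<in> J \<Longrightarrow> \<phi> x = \<zero>\<^bsub>B\<^esub>"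
    and "x \<in> carrier A" "y \<in> J +> x"
  shows "\<phi> y = \<phi> x"
proof -
  interpret hom: assoc_algebra_hom A B \<phi>
    using assms(1,2) by (simp add: assoc_algebra_hom_def assoc_algebra_hom_axioms_def assoc_algebra_axioms)
  obtain j where j: "j \<in> J" "y = j \<oplus> x" using assms(5) by (auto simp: a_r_coset_def')
  then show ?thesis using assms(3,4) by (simp add: Icarr)
qed

lemma quotient_alg_homI:
  assumes "\<phi> \<in> alg_hom A B" "\<And>x. x \<in> carrier A \<Longrightarrow> F (J +> x) = \<phi> x"
  shows "F \<in> alg_hom (quotient_algebra A J) B"
proof -
  have \<phi>: "\<phi> \<in> ring_hom A B" and s: "\<And>c x. x \<in> carrier A \<Longrightarrow> \<phi> (c \<odot> x) = c \<odot>\<^bsub>B\<^esub> \<phi> x"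
    using assms(1) by (auto simp: alg_hom_def)
  show ?thesis
    by (intro alg_homI ring_hom_memI)
       (auto simp: quotient_carrier quotient_ops quotient_one smult_coset assms(2) s
         ring_hom_closed[OF \<phi>] ring_hom_mult[OF \<phi>] ring_hom_add[OF \<phi>] ring_hom_one[OF \<phi>])
qed

lemma alg_hom_factors:
  assumes "assoc_algebra B" "\<phi> \<in> alg_hom A B" "\<And>x. x \<in> J \<Longrightarrow> \<phi> x = \<zero>\<^bsub>B\<^esub>"
  shows "\<exists>F\<in>alg_hom (quotient_algebra A J) B. \<forall>x\<in>carrier A. F (J +> x) = \<phi> x"
proof (intro bexI ballI)
  let ?F = "\<lambda>X. \<phi> (SOME y. y \<in> X)"
  show *: "?F (J +> x) = \<phi> x" if x: "x \<in> carrier A" for x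
  proof -
    have "(SOME y. y \<in> J +> x) \<in> J +> x"
      using a_rcos_self[OF x] by (rule someI[of "\<lambda>y. y \<in> J +> x"])
    then show ?thesis using hom_const_on_coset[OF assms(1,2) _ x] assms(3) by blast
  qed
  show "?F \<in> alg_hom (quotient_algebra A J) B"
    using assms(2) * by (rule quotient_alg_homI)
qed

end

lemma algebra_ideal_genideal:
  assumes "assoc_algebra A" "S \<subseteq> carrier A"
  shows "algebra_ideal A (Idl\<^bsub>A\<^esub> S)"
proof -
  interpret assoc_algebra A by fact
  show ?thesis using assms genideal_ideal by (simp add: algebra_ideal_def)
qed


section \<open>Tensor products\<close>

text \<open>
  \<open>P\<close> below is the monoid algebra on pairs, \<open>I\<close> the ideal of the bilinearity relations in it and
  \<open>T\<close> the tensor product.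
\<close>

locale tensor_product = A: assoc_algebra A + B: assoc_algebra B
  for A :: "('k::field, 'a) module" and B :: "('k, 'b) module"
begin

abbreviation T where "T \<equiv> tensor_algebra A B"
abbreviation t where "t \<equiv> pure_tensor A B"

lemma monoid_pairs: "Group.monoid (A \<times>\<times> B)"
  by (intro DirProd_monoid A.monoid_axioms B.monoid_axioms)

lemma assoc_algebra_pairs: "assoc_algebra (pair_algebra A B)"
  unfolding pair_algebra_def by (intro monoid.assoc_algebra_monoid_algebra monoid_pairs)

sublocale P: assoc_algebra "pair_algebra A B"
  by (rule assoc_algebra_pairs)

lemma basis_elt_pair_closed:
  "a \<in> carrier A \<Longrightarrow> b \<in> carrier B \<Longrightarrow> basis_elt (a, b) \<in> carrier (pair_algebra A B)"
  unfolding pair_algebra_def by (intro basis_elt_closed) simp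

lemma bilinearity_relations_closed: "bilinearity_relations A B \<subseteq> carrier (pair_algebra A B)"
  unfolding bilinearity_relations_def Let_def
  by (auto simp del: monoid_algebra_simps
      intro!: P.minus_closed P.add.m_closed P.smult_closed basis_elt_pair_closed)

sublocale I: algebra_ideal "pair_algebra A B" "tensor_ideal A B"
  unfolding tensor_ideal_def
  by (intro algebra_ideal_genideal bilinearity_relations_closed assoc_algebra_pairs)

sublocale T: assoc_algebra T
  unfolding tensor_algebra_def by (rule I.assoc_algebra_quotient)

lemma relation_mem: "r \<in> bilinearity_relations A B \<Longrightarrow> r \<in> tensor_ideal A B"
  unfolding tensor_ideal_def using P.genideal_self[OF bilinearity_relations_closed] by blast

lemma pure_closed [simp]: "a \<in> carrier A \<Longrightarrow> b \<in> carrier B \<Longrightarrow> t a b \<in> carrier T"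
  unfolding pure_tensor_def tensor_algebra_def I.quotient_carrier by (intro imageI basis_elt_pair_closed)

lemma pure_add_left:
  assumes "a \<in> carrier A" "a' \<in> carrier A" "b \<in> carrier B"
  shows "t (a \<oplus>\<^bsub>A\<^esub> a') b = t a b \<oplus>\<^bsub>T\<^esub> t a' b"
  unfolding pure_tensor_def tensor_algebra_def using assms
  by (subst I.quotient_ops; (intro I.coset_eqI relation_mem)?)
     (auto intro!: basis_elt_pair_closed P.add.m_closed simp: bilinearity_relations_def Let_def)

lemma pure_add_right:
  assumes "a \<in> carrier A" "b \<in> carrier B" "b' \<in> carrier B"
  shows "t a (b \<oplus>\<^bsub>B\<^esub> b') = t a b \<oplus>\<^bsub>T\<^esub> t a b'"
  unfolding pure_tensor_def tensor_algebra_def using assms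
  by (subst I.quotient_ops; (intro I.coset_eqI relation_mem)?)
     (auto intro!: basis_elt_pair_closed P.add.m_closed simp: bilinearity_relations_def Let_def)

lemma pure_smult_left:
  assumes "a \<in> carrier A" "b \<in> carrier B"
  shows "t (c \<odot>\<^bsub>A\<^esub> a) b = c \<odot>\<^bsub>T\<^esub> t a b"
  unfolding pure_tensor_def tensor_algebra_def using assms
  by (subst I.smult_coset; (intro I.coset_eqI relation_mem)?)
     (auto intro!: basis_elt_pair_closed P.smult_closed simp: bilinearity_relations_def Let_def)

lemma pure_smult_right:
  assumes "a \<in> carrier A" "b \<in> carrier B"
  shows "t a (c \<odot>\<^bsub>B\<^esub> b) = c \<odot>\<^bsub>T\<^esub> t a b"
  unfolding pure_tensor_def tensor_algebra_def using assms
  by (subst I.smult_coset; (intro I.coset_eqI relation_mem)?)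
     (auto intro!: basis_elt_pair_closed P.smult_closed simp: bilinearity_relations_def Let_def)

lemma pure_mult:
  assumes "a \<in> carrier A" "b \<in> carrier B" "a' \<in> carrier A" "b' \<in> carrier B"
  shows "t a b \<otimes>\<^bsub>T\<^esub> t a' b' = t (a \<otimes>\<^bsub>A\<^esub> a') (b \<otimes>\<^bsub>B\<^esub> b')"
  unfolding pure_tensor_def tensor_algebra_def using assms
  by (subst I.quotient_ops)
     (simp_all add: basis_elt_pair_closed, simp add: pair_algebra_def basis_elt_mult)

lemma pure_one: "t \<one>\<^bsub>A\<^esub> \<one>\<^bsub>B\<^esub> = \<one>\<^bsub>T\<^esub>"
  unfolding pure_tensor_def tensor_algebra_def I.quotient_one by (simp add: pair_algebra_def)

lemma pure_zero_left: "b \<in> carrier B \<Longrightarrow> t \<zero>\<^bsub>A\<^esub> b = \<zero>\<^bsub>T\<^esub>"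
  using pure_smult_left[of "\<zero>\<^bsub>A\<^esub>" b 0] by (simp add: A.smult_zero_scalar T.smult_zero_scalar)

lemma pure_zero_right: "a \<in> carrier A \<Longrightarrow> t a \<zero>\<^bsub>B\<^esub> = \<zero>\<^bsub>T\<^esub>"
  using pure_smult_right[of a "\<zero>\<^bsub>B\<^esub>" 0] by (simp add: B.smult_zero_scalar T.smult_zero_scalar)

lemma pure_finsum_left:
  assumes "f \<in> I \<rightarrow> carrier A" "b \<in> carrier B"
  shows "t (finsum A f I) b = (\<Oplus>\<^bsub>T\<^esub>i\<in>I. t (f i) b)"
  using assms(1)
proof (induction I rule: infinite_finite_induct)
  case (insert x F)
  then have "f x \<in> carrier A" "f \<in> F \<rightarrow> carrier A" by auto
  with insert assms(2) show ?case by (simp add: pure_add_left Pi_def)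
qed (simp_all add: pure_zero_left assms(2))

lemma pure_finsum_right:
  assumes "f \<in> I \<rightarrow> carrier B" "a \<in> carrier A"
  shows "t a (finsum B f I) = (\<Oplus>\<^bsub>T\<^esub>i\<in>I. t a (f i))"
  using assms(1)
proof (induction I rule: infinite_finite_induct)
  case (insert x F)
  then have "f x \<in> carrier B" "f \<in> F \<rightarrow> carrier B" by auto
  with insert assms(2) show ?case by (simp add: pure_add_right Pi_def)
qed (simp_all add: pure_zero_right assms(2))

end

subsection \<open>Tensor product of homomorphisms\<close>

text \<open>
  The map \<open>(a, b) \<mapsto> \<phi> a \<otimes> \<psi> b\<close> is multiplicative, so its linear extension \<open>L\<close> to the pair algebra
  is a homomorphism. It kills the bilinearity relations, hence it is constant on cosets; therefore
  the choice of a representative in \<open>tensor_map\<close> does not matter.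
\<close>

lemma
  fixes A :: "('k::field, 'a) module" and B :: "('k, 'b) module"
    and A' :: "('k, 'c) module" and B' :: "('k, 'd) module"
  assumes "assoc_algebra A" "assoc_algebra B" "assoc_algebra A'" "assoc_algebra B'"
    and \<phi>: "\<phi> \<in> alg_hom A A'" and \<psi>: "\<psi> \<in> alg_hom B B'"
  shows tensor_map_alg_hom: "tensor_map A' B' \<phi> \<psi> \<in> alg_hom (tensor_algebra A B) (tensor_algebra A' B')"
    and tensor_map_pure: "\<And>a b. a \<in> carrier A \<Longrightarrow> b \<in> carrier B \<Longrightarrow>
      tensor_map A' B' \<phi> \<psi> (pure_tensor A B a b) = pure_tensor A' B' (\<phi> a) (\<psi> b)"
proof -
  interpret S: tensor_product A B using assms by (simp add: tensor_product_def)
  interpret R: tensor_product A' B' using assms by (simp add: tensor_product_def)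
  interpret f: assoc_algebra_hom A A' \<phi>
    using assms by (simp add: assoc_algebra_hom_def assoc_algebra_hom_axioms_def)
  interpret g: assoc_algebra_hom B B' \<psi>
    using assms by (simp add: assoc_algebra_hom_def assoc_algebra_hom_axioms_def)
  define \<gamma> where "\<gamma> = (\<lambda>z. R.t (\<phi> (fst z)) (\<psi> (snd z)))"
  define L where "L = linear_extension R.T \<gamma>"
  have \<gamma>: "\<gamma> \<in> carrier (A \<times>\<times> B) \<rightarrow> carrier R.T"
    by (auto simp: \<gamma>_def)
  have L: "L \<in> alg_hom (pair_algebra A B) R.T"
    unfolding L_def pair_algebra_def
  proof (rule R.T.linear_extension_alg_hom[OF S.monoid_pairs \<gamma>])
    show "\<gamma> \<one>\<^bsub>A \<times>\<times> B\<^esub> = \<one>\<^bsub>R.T\<^esub>" by (simp add: \<gamma>_def R.pure_one)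
    show "\<gamma> (x \<otimes>\<^bsub>A \<times>\<times> B\<^esub> y) = \<gamma> x \<otimes>\<^bsub>R.T\<^esub> \<gamma> y"
      if "x \<in> carrier (A \<times>\<times> B)" "y \<in> carrier (A \<times>\<times> B)" for x y
      using that by (auto simp: \<gamma>_def R.pure_mult)
  qed
  interpret L: assoc_algebra_hom "pair_algebra A B" R.T L
    using L S.assoc_algebra_pairs R.T.assoc_algebra_axioms
    by (simp add: assoc_algebra_hom_def assoc_algebra_hom_axioms_def)
  have L_basis: "L (basis_elt (a, b)) = R.t (\<phi> a) (\<psi> b)" if "a \<in> carrier A" "b \<in> carrier B" for a b
    unfolding L_def using that by (subst R.T.linear_extension_basis_elt) (auto simp: \<gamma>_def)
  note closed = S.basis_elt_pair_closed S.P.add.m_closed S.P.smult_closed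
  have "L r = \<zero>\<^bsub>R.T\<^esub>" if r: "r \<in> bilinearity_relations A B" for r
  proof -
    have diff: "L (x \<ominus>\<^bsub>pair_algebra A B\<^esub> y) = \<zero>\<^bsub>R.T\<^esub>"
      if "x \<in> carrier (pair_algebra A B)" "y \<in> carrier (pair_algebra A B)" "L x = L y" for x y
      using that L.hom_closed[of y] by (simp add: L.hom_minus R.T.minus_eq R.T.r_neg del: L.hom_closed)
    from r show ?thesis
      unfolding bilinearity_relations_def Let_def
      by (elim UnE CollectE exE conjE; hypsubst; intro diff)
         (simp_all add: L.hom_smult closed L_basis
           R.pure_add_left R.pure_add_right R.pure_smult_left R.pure_smult_right
           f.hom_smult g.hom_smult)
  qed
  then have zero: "L r = \<zero>\<^bsub>R.T\<^esub>" if "r \<in> tensor_ideal A B" for r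
    using L.vanishes_on_genideal[OF S.bilinearity_relations_closed] that
    unfolding tensor_ideal_def by blast
  have *: "tensor_map A' B' \<phi> \<psi> (tensor_ideal A B +>\<^bsub>pair_algebra A B\<^esub> x) = L x"
    if x: "x \<in> carrier (pair_algebra A B)" for x
  proof -
    let ?X = "tensor_ideal A B +>\<^bsub>pair_algebra A B\<^esub> x"
    define y where "y = (SOME y. y \<in> ?X)"
    have "x \<in> ?X" using x by (rule S.I.a_rcos_self)
    then have y: "y \<in> ?X" unfolding y_def by (rule someI[of "\<lambda>y. y \<in> ?X"])
    have "tensor_map A' B' \<phi> \<psi> ?X = L y"
      unfolding tensor_map_def y_def[symmetric] Let_def L_def linear_extension_def \<gamma>_def ..
    also have "\<dots> = L x"
      using S.I.hom_const_on_coset[OF R.T.assoc_algebra_axioms L zero x y] .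
    finally show ?thesis .
  qed
  show "tensor_map A' B' \<phi> \<psi> \<in> alg_hom S.T R.T"
    using S.I.quotient_alg_homI[OF L *] unfolding tensor_algebra_def[of A B] .
  show "tensor_map A' B' \<phi> \<psi> (S.t a b) = R.t (\<phi> a) (\<psi> b)" if "a \<in> carrier A" "b \<in> carrier B" for a b
    unfolding pure_tensor_def[of A B] using that by (simp add: * L_basis S.basis_elt_pair_closed)
qed


section \<open>Coproducts and the Drinfeld relations\<close>

text \<open>
  The index sets of the sums: \<open>drinfeld_idx k l\<close> for the Drinfeld relation of levels \<open>k\<close> and \<open>l\<close>,
  \<open>split_idx l\<close> for a coproduct of level \<open>l\<close>, and \<open>quint_idx k l\<close> for the coproduct of the whole
  relation. In the last one \<open>a\<close> and \<open>b\<close> are the levels of \<open>e\<close>, and \<open>c\<close> and \<open>d\<close> those of \<open>f\<close>, in the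
  two tensor factors.
\<close>

abbreviation drinfeld_idx :: "nat \<Rightarrow> nat \<Rightarrow> (nat \<times> nat \<times> nat) set" where
  "drinfeld_idx k l \<equiv> {(m, n, s). m + n = k \<and> n + s = l}"

abbreviation split_idx :: "nat \<Rightarrow> (nat \<times> nat) set" where
  "split_idx l \<equiv> {(m, n). m + n = l}"

definition quint_idx :: "nat \<Rightarrow> nat \<Rightarrow> (nat \<times> nat \<times> nat \<times> nat \<times> nat) set" where
  "quint_idx k l = {(a, b, c, d, n). a + b + n = l \<and> c + d + n = k}"

lemma finite_split_idx [simp]: "finite (split_idx l)"
  by (rule finite_subset[of _ "{..l} \<times> {..l}"]) auto

lemma finite_drinfeld_idx [simp]: "finite (drinfeld_idx k l)"
  by (rule finite_subset[of _ "{..k} \<times> {..k} \<times> {..l}"]) auto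

context assoc_algebra
begin

text \<open>
  Three ways of grouping a sum over all quintuples: by \<open>n\<close> and the total levels \<open>s = a + b\<close> and
  \<open>m = c + d\<close>, by the levels \<open>b\<close> and \<open>d\<close> of the second tensor factor, and by the levels \<open>a\<close> and \<open>c\<close>
  of the first. In the last two cases the inner sum runs over the index set of a Drinfeld relation
  of smaller levels.
\<close>

lemma quint_sum_split:
  assumes "\<And>a b c d n. (a, b, c, d, n) \<in> quint_idx k l \<Longrightarrow> G a b c d n \<in> carrier A"
  shows "finsum A (\<lambda>(m, n, s). finsum A (\<lambda>((a, b), (c, d)). G a b c d n) (split_idx s \<times> split_idx m)) (drinfeld_idx k l)
       = finsum A (\<lambda>(a, b, c, d, n). G a b c d n) (quint_idx k l)"
proof -
  have "finsum A (\<lambda>(m, n, s). finsum A (\<lambda>((a, b), (c, d)). G a b c d n) (split_idx s \<times> split_idx m)) (drinfeld_idx k l)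
      = (\<Oplus>i\<in>drinfeld_idx k l. \<Oplus>j\<in>split_idx (snd (snd i)) \<times> split_idx (fst i).
           G (fst (fst j)) (snd (fst j)) (fst (snd j)) (snd (snd j)) (fst (snd i)))"
    by (simp add: case_prod_beta')
  also have "\<dots> = finsum A (\<lambda>(i, j).
           G (fst (fst j)) (snd (fst j)) (fst (snd j)) (snd (snd j)) (fst (snd i)))
           (Sigma (drinfeld_idx k l) (\<lambda>i. split_idx (snd (snd i)) \<times> split_idx (fst i)))"
    by (intro finsum_Sigma) (auto intro!: assms simp: quint_idx_def)
  also have "\<dots> = finsum A (\<lambda>(a, b, c, d, n). G a b c d n) (quint_idx k l)"
    by (intro finsum_bij[of "\<lambda>((m, n, s), (a, b), (c, d)). (a, b, c, d, n)"]
          bij_betw_byWitness[where f' = "\<lambda>(a, b, c, d, n). ((c + d, n, a + b), (a, b), (c, d))"])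
       (auto intro!: assms simp: quint_idx_def)
  finally show ?thesis .
qed

lemma quint_sum_by_second:
  assumes "\<And>a b c d n. (a, b, c, d, n) \<in> quint_idx k l \<Longrightarrow> G a b c d n \<in> carrier A"
  shows "finsum A (\<lambda>(b, d). finsum A (\<lambda>(m, n, s). G s b m d n) (drinfeld_idx (k - d) (l - b))) ({..l} \<times> {..k})
       = finsum A (\<lambda>(a, b, c, d, n). G a b c d n) (quint_idx k l)"
proof -
  have "finsum A (\<lambda>(b, d). finsum A (\<lambda>(m, n, s). G s b m d n) (drinfeld_idx (k - d) (l - b))) ({..l} \<times> {..k})
      = (\<Oplus>i\<in>{..l} \<times> {..k}. \<Oplus>j\<in>drinfeld_idx (k - snd i) (l - fst i).
           G (snd (snd j)) (fst i) (fst j) (snd i) (fst (snd j)))"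
    by (simp add: case_prod_beta')
  also have "\<dots> = finsum A (\<lambda>(i, j).
           G (snd (snd j)) (fst i) (fst j) (snd i) (fst (snd j)))
           (Sigma ({..l} \<times> {..k}) (\<lambda>i. drinfeld_idx (k - snd i) (l - fst i)))"
    by (intro finsum_Sigma) (auto intro!: assms simp: quint_idx_def)
  also have "\<dots> = finsum A (\<lambda>(a, b, c, d, n). G a b c d n) (quint_idx k l)"
    by (intro finsum_bij[of "\<lambda>((b, d), (m, n, s)). (s, b, m, d, n)"]
          bij_betw_byWitness[where f' = "\<lambda>(a, b, c, d, n). ((b, d), (c, n, a))"])
       (auto intro!: assms simp: quint_idx_def)
  finally show ?thesis .
qed

lemma quint_sum_by_first:
  assumes "\<And>a b c d n. (a, b, c, d, n) \<in> quint_idx k l \<Longrightarrow> G a b c d n \<in> carrier A"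
  shows "finsum A (\<lambda>(a, c). finsum A (\<lambda>(m, n, s). G a s c m n) (drinfeld_idx (k - c) (l - a))) ({..l} \<times> {..k})
       = finsum A (\<lambda>(a, b, c, d, n). G a b c d n) (quint_idx k l)"
proof -
  have "finsum A (\<lambda>(a, c). finsum A (\<lambda>(m, n, s). G a s c m n) (drinfeld_idx (k - c) (l - a))) ({..l} \<times> {..k})
      = (\<Oplus>i\<in>{..l} \<times> {..k}. \<Oplus>j\<in>drinfeld_idx (k - snd i) (l - fst i).
           G (fst i) (snd (snd j)) (snd i) (fst j) (fst (snd j)))"
    by (simp add: case_prod_beta')
  also have "\<dots> = finsum A (\<lambda>(i, j).
           G (fst i) (snd (snd j)) (snd i) (fst j) (fst (snd j)))
           (Sigma ({..l} \<times> {..k}) (\<lambda>i. drinfeld_idx (k - snd i) (l - fst i)))"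
    by (intro finsum_Sigma) (auto intro!: assms simp: quint_idx_def)
  also have "\<dots> = finsum A (\<lambda>(a, b, c, d, n). G a b c d n) (quint_idx k l)"
    by (intro finsum_bij[of "\<lambda>((a, c), (m, n, s)). (a, s, c, m, n)"]
          bij_betw_byWitness[where f' = "\<lambda>(a, b, c, d, n). ((a, c), (d, n, b))"])
       (auto intro!: assms simp: quint_idx_def)
  finally show ?thesis .
qed

end

text \<open>
  The values of the co-multiplication on \<open>e\<^sub>l\<close> and \<open>f\<^sub>l\<close> for a fixed index, as elements of the tensor
  square of \<open>U\<close>; here \<open>v\<close> stands for \<open>q\<^sub>(\<^sub>i\<^sub>)\<close> and \<open>K n\<close> for \<open>K\<^sub>i\<^sup>n\<close>.
\<close>

definition coprod_e ::
  "('k::field, 'a) module \<Rightarrow> 'k \<Rightarrow> (nat \<Rightarrow> 'a) \<Rightarrow> (int \<Rightarrow> 'a) \<Rightarrow> nat \<Rightarrow> ('a \<times> 'a \<Rightarrow> 'k) set" where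
  "coprod_e U v e K l = finsum (tensor_algebra U U) (\<lambda>(m, n).
     (v powi (int m * int n)) \<odot>\<^bsub>tensor_algebra U U\<^esub>
     pure_tensor U U (e m) (K (- int m) \<otimes>\<^bsub>U\<^esub> e n)) (split_idx l)"

definition coprod_f ::
  "('k::field, 'a) module \<Rightarrow> 'k \<Rightarrow> (nat \<Rightarrow> 'a) \<Rightarrow> (int \<Rightarrow> 'a) \<Rightarrow> nat \<Rightarrow> ('a \<times> 'a \<Rightarrow> 'k) set" where
  "coprod_f U v f K l = finsum (tensor_algebra U U) (\<lambda>(m, n).
     (v powi (- (int m * int n))) \<odot>\<^bsub>tensor_algebra U U\<^esub>
     pure_tensor U U (f m \<otimes>\<^bsub>U\<^esub> K (int n)) (f n)) (split_idx l)"

text \<open>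
  A family \<open>e\<close> with torus elements \<open>K\<close> and a family \<open>f\<close> with torus elements \<open>L\<close>, for two indices
  that may coincide. \<open>R\<close> and \<open>S\<close> are the sets of admissible levels; they are \<open>{0, 1}\<close> for a real
  and all of the natural numbers for an imaginary index. The rules for moving \<open>L\<close> past \<open>e\<close> and \<open>K\<close> past
  \<open>f\<close> involve the same scalar \<open>u\<close>, which is \<open>q\<close> to the symmetric exponent
  \<open>s\<^sub>i a\<^sub>i\<^sub>j = s\<^sub>j a\<^sub>j\<^sub>i\<close>. The scalars \<open>v\<close> and \<open>w\<close> are the parameters in the coproducts of \<open>e\<close> and \<open>f\<close>.
\<close>

locale torus_pair = assoc_algebra U for U :: "('k::field, 'a) module" (structure) +
  fixes v w u :: 'k and e f :: "nat \<Rightarrow> 'a" and K L :: "int \<Rightarrow> 'a" and R S :: "nat set"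
  assumes u_nz: "u \<noteq> 0"
    and R_down: "l \<in> R \<Longrightarrow> m \<le> l \<Longrightarrow> m \<in> R"
    and S_down: "l \<in> S \<Longrightarrow> m \<le> l \<Longrightarrow> m \<in> S"
    and e_closed: "l \<in> R \<Longrightarrow> e l \<in> carrier U"
    and f_closed: "l \<in> S \<Longrightarrow> f l \<in> carrier U"
    and K_closed [simp]: "K n \<in> carrier U"
    and L_closed [simp]: "L n \<in> carrier U"
    and L_e: "l \<in> R \<Longrightarrow> L n \<otimes> e l = (u powi (n * int l)) \<odot> (e l \<otimes> L n)"
    and f_K: "l \<in> S \<Longrightarrow> f l \<otimes> K n = (u powi (n * int l)) \<odot> (K n \<otimes> f l)"
begin

sublocale T: tensor_product U U
  by unfold_locales

abbreviation E where "E \<equiv> coprod_e U v e K"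
abbreviation F where "F \<equiv> coprod_f U w f L"

lemma e_mem: "l \<in> R \<Longrightarrow> m \<le> l \<Longrightarrow> e m \<in> carrier U"
  using R_down e_closed by blast

lemma f_mem: "l \<in> S \<Longrightarrow> m \<le> l \<Longrightarrow> f m \<in> carrier U"
  using S_down f_closed by blast

lemma coprod_e_summand:
  assumes "l \<in> R"
  shows "(\<lambda>(m, n). (v powi (int m * int n)) \<odot>\<^bsub>T.T\<^esub> T.t (e m) (K (- int m) \<otimes> e n))
    \<in> split_idx l \<rightarrow> carrier T.T"
  by (auto simp: e_mem[OF assms])

lemma coprod_f_summand:
  assumes "l \<in> S"
  shows "(\<lambda>(m, n). (w powi (- (int m * int n))) \<odot>\<^bsub>T.T\<^esub> T.t (f m \<otimes> L (int n)) (f n))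
    \<in> split_idx l \<rightarrow> carrier T.T"
  by (auto simp: f_mem[OF assms])

lemma E_closed: "l \<in> R \<Longrightarrow> E l \<in> carrier T.T"
  unfolding coprod_e_def by (intro T.T.finsum_closed coprod_e_summand)

lemma F_closed: "l \<in> S \<Longrightarrow> F l \<in> carrier T.T"
  unfolding coprod_f_def by (intro T.T.finsum_closed coprod_f_summand)

lemma E_mult_F:
  assumes "l \<in> R" "k \<in> S"
  shows "E l \<otimes>\<^bsub>T.T\<^esub> F k =
    finsum T.T (\<lambda>((a, b), (c, d)). (v powi (int a * int b) * w powi (- (int c * int d))) \<odot>\<^bsub>T.T\<^esub>
      T.t (e a \<otimes> (f c \<otimes> L (int d))) ((K (- int a) \<otimes> e b) \<otimes> f d)) (split_idx l \<times> split_idx k)"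
    (is "_ = finsum T.T ?g _")
proof -
  note closed = e_mem[OF assms(1)] f_mem[OF assms(2)]
  show ?thesis
    unfolding coprod_e_def coprod_f_def
      T.T.finsum_mult_finsum[OF finite_split_idx finite_split_idx
        coprod_e_summand[OF assms(1)] coprod_f_summand[OF assms(2)]]
  proof (intro T.T.finsum_cong' refl)
    show "?g \<in> split_idx l \<times> split_idx k \<rightarrow> carrier T.T" by (auto simp: closed)
  qed (elim SigmaE CollectE case_prodE; hypsubst; unfold prod.case,
       simp add: closed T.pure_mult T.T.mult_smult_left T.T.mult_smult_right T.T.smult_smult mult.commute)
qed

text \<open>
  In the other order, the scalars \<open>u\<^bsup>da\<^esup>\<close> from the first and \<open>u\<^bsup>-da\<^esup>\<close> from the second tensor factor
  cancel.
\<close>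

lemma F_mult_E:
  assumes "l \<in> R" "k \<in> S"
  shows "F k \<otimes>\<^bsub>T.T\<^esub> E l =
    finsum T.T (\<lambda>((a, b), (c, d)). (v powi (int a * int b) * w powi (- (int c * int d))) \<odot>\<^bsub>T.T\<^esub>
      T.t ((f c \<otimes> e a) \<otimes> L (int d)) (K (- int a) \<otimes> (f d \<otimes> e b))) (split_idx l \<times> split_idx k)"
    (is "_ = finsum T.T ?g _")
proof -
  note e = e_mem[OF assms(1)] note f = f_mem[OF assms(2)]
  note mem = R_down[OF assms(1)] S_down[OF assms(2)]
  have Le: "(f c \<otimes> L (int d)) \<otimes> e a = (u powi (int d * int a)) \<odot> ((f c \<otimes> e a) \<otimes> L (int d))"
    if "a \<le> l" "c \<le> k" for a c d
    using that by (simp add: m_assoc L_e mem e f mult_smult_right)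
  have fK: "f d \<otimes> (K (- int a) \<otimes> e b) = (u powi (- (int d * int a))) \<odot> (K (- int a) \<otimes> (f d \<otimes> e b))"
    if "d \<le> k" "b \<le> l" for a b d
    using that f_K[of d "- int a"] by (simp add: m_assoc[symmetric] mem e f mult_smult_left mult.commute)
  have swap: "T.t (f c \<otimes> L (int d)) (f d) \<otimes>\<^bsub>T.T\<^esub> T.t (e a) (K (- int a) \<otimes> e b)
      = T.t ((f c \<otimes> e a) \<otimes> L (int d)) (K (- int a) \<otimes> (f d \<otimes> e b))"
    if "a \<le> l" "b \<le> l" "c \<le> k" "d \<le> k" for a b c d
  proof -
    have "u powi (- (int d * int a)) * u powi (int d * int a) = 1"
      using u_nz by (simp flip: power_int_add)
    then show ?thesis
      using that by (simp add: T.pure_mult e f Le fK T.pure_smult_left T.pure_smult_right T.T.smult_smult T.T.smult_one)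
  qed
  have "F k \<otimes>\<^bsub>T.T\<^esub> E l = finsum T.T (\<lambda>(y, x). ?g (x, y)) (split_idx k \<times> split_idx l)"
    unfolding coprod_e_def coprod_f_def
      T.T.finsum_mult_finsum[OF finite_split_idx finite_split_idx
        coprod_f_summand[OF assms(2)] coprod_e_summand[OF assms(1)]]
  proof (intro T.T.finsum_cong' refl)
    show "(\<lambda>(y, x). ?g (x, y)) \<in> split_idx k \<times> split_idx l \<rightarrow> carrier T.T" by (auto simp: e f)
  qed (elim SigmaE CollectE case_prodE; hypsubst; unfold prod.case,
       simp add: e f swap T.T.mult_smult_left T.T.mult_smult_right T.T.smult_smult)
  also have "\<dots> = finsum T.T ?g (split_idx l \<times> split_idx k)"
    by (intro T.T.finsum_bij[of "\<lambda>(x, y). (y, x)"] bij_betw_byWitness[where f' = "\<lambda>(x, y). (y, x)"])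
       (auto simp: e f)
  finally show ?thesis .
qed

text \<open>Distinct indices: if the two families commute, so do their coproducts.\<close>

lemma coprod_commute:
  assumes "\<And>a c. a \<in> R \<Longrightarrow> c \<in> S \<Longrightarrow> e a \<otimes> f c = f c \<otimes> e a" and "l \<in> R" "k \<in> S"
  shows "E l \<otimes>\<^bsub>T.T\<^esub> F k = F k \<otimes>\<^bsub>T.T\<^esub> E l"
proof -
  note e = e_mem[OF assms(2)] note f = f_mem[OF assms(3)]
  have c: "f c \<otimes> e a = e a \<otimes> f c" if "a \<le> l" "c \<le> k" for a c
    using assms that R_down S_down by simp
  show ?thesis
    unfolding E_mult_F[OF assms(2,3)] F_mult_E[OF assms(2,3)]
  proof (intro T.T.finsum_cong' refl)
  qed (auto simp: e f c m_assoc del: equalityI)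
qed

end


text \<open>
  The situation of a single index: the two families share the torus elements, \<open>u = v\<^sup>2\<close>, and the
  Drinfeld relations hold for all admissible levels. Since \<open>m - s = k - l\<close> on the index set, their
  coefficients depend on \<open>n\<close> only.
\<close>

locale drinfeld_pair = torus_pair U v v "v\<^sup>2" e f K K R R
  for U :: "('k::field, 'a) module" (structure) and v e f K R +
  fixes \<tau> :: "nat \<Rightarrow> 'k"
  assumes K_add: "K m \<otimes> K n = K (m + n)"
    and drinfeld: "k \<in> R \<Longrightarrow> l \<in> R \<Longrightarrow>
      finsum U (\<lambda>(m, n, s). (v powi (int n * (int m - int s)) * \<tau> n) \<odot> (e s \<otimes> f m \<otimes> K (- int n))) (drinfeld_idx k l)
    = finsum U (\<lambda>(m, n, s). (v powi (- (int n * (int m - int s))) * \<tau> n) \<odot> (f m \<otimes> e s \<otimes> K (int n))) (drinfeld_idx k l)"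
begin

lemma v_nz: "v \<noteq> 0"
  using u_nz by simp

lemma v2_powi: "v\<^sup>2 powi x = v powi (2 * x)"
  by (simp add: power_int_mult)

lemma torus_past_ef:
  assumes "b \<in> R" "d \<in> R"
  shows "(e b \<otimes> f d) \<otimes> K n = (v powi (2 * n * (int d - int b))) \<odot> (K n \<otimes> (e b \<otimes> f d))"
proof -
  note closed = e_closed[OF assms(1)] f_closed[OF assms(2)]
  have "e b \<otimes> K n = v powi (2 * (- n * int b)) \<odot> (v powi (2 * (n * int b)) \<odot> (e b \<otimes> K n))"
    using closed v_nz by (simp add: smult_smult smult_one flip: power_int_add)
  also have "\<dots> = v powi (2 * (- n * int b)) \<odot> (K n \<otimes> e b)"
    using L_e[OF assms(1), of n] by (simp add: v2_powi)
  finally have eK: "e b \<otimes> K n = v powi (2 * (- n * int b)) \<odot> (K n \<otimes> e b)" .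
  have "(e b \<otimes> f d) \<otimes> K n = v powi (2 * (n * int d)) \<odot> ((e b \<otimes> K n) \<otimes> f d)"
    using closed f_K[OF assms(2), of n] by (simp add: v2_powi m_assoc mult_smult_right)
  also have "\<dots> = (v powi (2 * (n * int d)) * v powi (2 * (- n * int b))) \<odot> (K n \<otimes> (e b \<otimes> f d))"
    using closed by (simp add: eK m_assoc mult_smult_left smult_smult)
  also have "v powi (2 * (n * int d)) * v powi (2 * (- n * int b)) = v powi (2 * n * (int d - int b))"
    using v_nz by (simp add: algebra_simps flip: power_int_add)
  finally show ?thesis .
qed

lemma pull_left:
  assumes "\<And>i. i \<in> I \<Longrightarrow> X i \<in> carrier U" "Z \<in> carrier U" "Y \<in> carrier U"
  shows "c \<odot>\<^bsub>T.T\<^esub> T.t (finsum U (\<lambda>i. w i \<odot> X i) I \<otimes> Z) Y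
       = (\<Oplus>\<^bsub>T.T\<^esub>i\<in>I. (c * w i) \<odot>\<^bsub>T.T\<^esub> T.t (X i \<otimes> Z) Y)"
proof (cases "finite I")
  case True
  have "finsum U (\<lambda>i. w i \<odot> X i) I \<otimes> Z = finsum U (\<lambda>i. w i \<odot> X i \<otimes> Z) I"
    using assms True by (intro finsum_ldistr) auto
  also have "\<dots> = finsum U (\<lambda>i. w i \<odot> (X i \<otimes> Z)) I"
    using assms by (intro finsum_cong') (auto simp: mult_smult_left)
  finally show ?thesis
    using assms
    by (simp add: T.pure_finsum_left T.T.finsum_smult Pi_iff)
       (intro T.T.finsum_cong'; simp add: T.pure_smult_left T.T.smult_smult)
qed (use assms in \<open>simp add: T.pure_zero_left T.T.smult_zero\<close>)

lemma pull_right: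
  assumes "\<And>i. i \<in> I \<Longrightarrow> X i \<in> carrier U" "Z \<in> carrier U" "Y \<in> carrier U"
  shows "c \<odot>\<^bsub>T.T\<^esub> T.t Y (Z \<otimes> finsum U (\<lambda>i. w i \<odot> X i) I)
       = (\<Oplus>\<^bsub>T.T\<^esub>i\<in>I. (c * w i) \<odot>\<^bsub>T.T\<^esub> T.t Y (Z \<otimes> X i))"
proof (cases "finite I")
  case True
  have "Z \<otimes> finsum U (\<lambda>i. w i \<odot> X i) I = finsum U (\<lambda>i. Z \<otimes> (w i \<odot> X i)) I"
    using assms True by (intro finsum_rdistr) auto
  also have "\<dots> = finsum U (\<lambda>i. w i \<odot> (Z \<otimes> X i)) I"
    using assms by (intro finsum_cong') (auto simp: mult_smult_right)
  finally show ?thesis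
    using assms
    by (simp add: T.pure_finsum_right T.T.finsum_smult Pi_iff)
       (intro T.T.finsum_cong'; simp add: T.pure_smult_right T.T.smult_smult)
qed (use assms in \<open>simp add: T.pure_zero_right T.T.smult_zero\<close>)

lemma powi_merge: "x + y = z \<Longrightarrow> v powi x * (v powi y * t) = v powi z * t"
  using v_nz by (auto simp: power_int_add)

text \<open>The Drinfeld relation may be applied inside the first or the second tensor factor.\<close>

lemma exchange_left:
  assumes kl: "k \<in> R" "l \<in> R" and "Z \<in> carrier U" "Y \<in> carrier U"
  shows "finsum T.T (\<lambda>(m, n, s). (c * (v powi (int n * (int m - int s)) * \<tau> n)) \<odot>\<^bsub>T.T\<^esub>
             T.t (e s \<otimes> f m \<otimes> K (- int n) \<otimes> Z) Y) (drinfeld_idx k l)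
       = finsum T.T (\<lambda>(m, n, s). (c * (v powi (- (int n * (int m - int s))) * \<tau> n)) \<odot>\<^bsub>T.T\<^esub>
             T.t (f m \<otimes> e s \<otimes> K (int n) \<otimes> Z) Y) (drinfeld_idx k l)"
proof -
  note closed = e_mem[OF kl(2)] f_mem[OF kl(1)]
  have "c \<odot>\<^bsub>T.T\<^esub> T.t (finsum U (\<lambda>(m, n, s). (v powi (int n * (int m - int s)) * \<tau> n) \<odot> (e s \<otimes> f m \<otimes> K (- int n))) (drinfeld_idx k l) \<otimes> Z) Y
      = finsum T.T (\<lambda>(m, n, s). (c * (v powi (int n * (int m - int s)) * \<tau> n)) \<odot>\<^bsub>T.T\<^esub>
             T.t (e s \<otimes> f m \<otimes> K (- int n) \<otimes> Z) Y) (drinfeld_idx k l)"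
    using pull_left[of "drinfeld_idx k l" "\<lambda>(m, n, s). e s \<otimes> f m \<otimes> K (- int n)" Z Y c
      "\<lambda>(m, n, s). v powi (int n * (int m - int s)) * \<tau> n"] assms(3,4)
    by (force simp: case_prod_beta' closed)
  moreover
  have "c \<odot>\<^bsub>T.T\<^esub> T.t (finsum U (\<lambda>(m, n, s). (v powi (- (int n * (int m - int s))) * \<tau> n) \<odot> (f m \<otimes> e s \<otimes> K (int n))) (drinfeld_idx k l) \<otimes> Z) Y
      = finsum T.T (\<lambda>(m, n, s). (c * (v powi (- (int n * (int m - int s))) * \<tau> n)) \<odot>\<^bsub>T.T\<^esub>
             T.t (f m \<otimes> e s \<otimes> K (int n) \<otimes> Z) Y) (drinfeld_idx k l)"
    using pull_left[of "drinfeld_idx k l" "\<lambda>(m, n, s). f m \<otimes> e s \<otimes> K (int n)" Z Y c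
      "\<lambda>(m, n, s). v powi (- (int n * (int m - int s))) * \<tau> n"] assms(3,4)
    by (force simp: case_prod_beta' closed)
  ultimately show ?thesis by (simp only: drinfeld[OF kl])
qed

lemma exchange_right:
  assumes kl: "k \<in> R" "l \<in> R" and "Z \<in> carrier U" "Y \<in> carrier U"
  shows "finsum T.T (\<lambda>(m, n, s). (c * (v powi (int n * (int m - int s)) * \<tau> n)) \<odot>\<^bsub>T.T\<^esub>
             T.t Y (Z \<otimes> (e s \<otimes> f m \<otimes> K (- int n)))) (drinfeld_idx k l)
       = finsum T.T (\<lambda>(m, n, s). (c * (v powi (- (int n * (int m - int s))) * \<tau> n)) \<odot>\<^bsub>T.T\<^esub>
             T.t Y (Z \<otimes> (f m \<otimes> e s \<otimes> K (int n)))) (drinfeld_idx k l)"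
proof -
  note closed = e_mem[OF kl(2)] f_mem[OF kl(1)]
  have "c \<odot>\<^bsub>T.T\<^esub> T.t Y (Z \<otimes> finsum U (\<lambda>(m, n, s). (v powi (int n * (int m - int s)) * \<tau> n) \<odot> (e s \<otimes> f m \<otimes> K (- int n))) (drinfeld_idx k l))
      = finsum T.T (\<lambda>(m, n, s). (c * (v powi (int n * (int m - int s)) * \<tau> n)) \<odot>\<^bsub>T.T\<^esub>
             T.t Y (Z \<otimes> (e s \<otimes> f m \<otimes> K (- int n)))) (drinfeld_idx k l)"
    using pull_right[of "drinfeld_idx k l" "\<lambda>(m, n, s). e s \<otimes> f m \<otimes> K (- int n)" Z Y c
      "\<lambda>(m, n, s). v powi (int n * (int m - int s)) * \<tau> n"] assms(3,4)
    by (force simp: case_prod_beta' closed)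
  moreover
  have "c \<odot>\<^bsub>T.T\<^esub> T.t Y (Z \<otimes> finsum U (\<lambda>(m, n, s). (v powi (- (int n * (int m - int s))) * \<tau> n) \<odot> (f m \<otimes> e s \<otimes> K (int n))) (drinfeld_idx k l))
      = finsum T.T (\<lambda>(m, n, s). (c * (v powi (- (int n * (int m - int s))) * \<tau> n)) \<odot>\<^bsub>T.T\<^esub>
             T.t Y (Z \<otimes> (f m \<otimes> e s \<otimes> K (int n)))) (drinfeld_idx k l)"
    using pull_right[of "drinfeld_idx k l" "\<lambda>(m, n, s). f m \<otimes> e s \<otimes> K (int n)" Z Y c
      "\<lambda>(m, n, s). v powi (- (int n * (int m - int s))) * \<tau> n"] assms(3,4)
    by (force simp: case_prod_beta' closed)
  ultimately show ?thesis by (simp only: drinfeld[OF kl])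
qed

text \<open>The summands of the middle sum, which both sides of the coproduct of a relation reduce to.\<close>

definition mid :: "nat \<Rightarrow> nat \<Rightarrow> nat \<Rightarrow> nat \<Rightarrow> nat \<Rightarrow> ('a \<times> 'a \<Rightarrow> 'k) set" where
  "mid a b c d n =
     (v powi (int b * (int a + int n) - int d * (int c + int n) - int n * (int c - int a)) * \<tau> n) \<odot>\<^bsub>T.T\<^esub>
     T.t (f c \<otimes> e a \<otimes> K (int n + int d)) (K (- (int a + int n)) \<otimes> (e b \<otimes> f d))"

context
  fixes k l assumes k: "k \<in> R" and l: "l \<in> R"
begin

lemma le_closed [simp]:
  "m \<le> l \<Longrightarrow> e m \<in> carrier U" "m \<le> k \<Longrightarrow> f m \<in> carrier U" "m \<le> l \<Longrightarrow> m \<in> R" "m \<le> k \<Longrightarrow> m \<in> R"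
  using k l R_down e_closed f_closed by blast+

lemma quint_le:
  assumes "(a, b, c, d, n) \<in> quint_idx k l"
  shows "a \<le> l" "b \<le> l" "c \<le> k" "d \<le> k"
  using assms by (auto simp: quint_idx_def)

text \<open>
  The summands \<open>G\<close> below are those of the expanded coproduct, after \<open>K\<^bsup>-n\<^esup>\<close> has been moved to the
  left of the second tensor factor. There it joins \<open>K\<^bsup>-a\<^esup>\<close> to \<open>K\<^bsup>-(l-b)\<^esup>\<close>, so that the second factor
  depends on \<open>b\<close> and \<open>d\<close> only.
\<close>

lemma coprod_ef:
  "finsum T.T (\<lambda>(m, n, s). (v powi (int n * (int m - int s)) * \<tau> n) \<odot>\<^bsub>T.T\<^esub>
       (E s \<otimes>\<^bsub>T.T\<^esub> F m \<otimes>\<^bsub>T.T\<^esub> T.t (K (- int n)) (K (- int n)))) (drinfeld_idx k l)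
   = finsum T.T (\<lambda>(a, b, c, d, n). mid a b c d n) (quint_idx k l)"
proof -
  define G where "G a b c d n =
     (v powi (int n * (int c - int a) + int b * (int a + int n) - int d * (int c + int n)) * \<tau> n) \<odot>\<^bsub>T.T\<^esub>
     T.t ((e a \<otimes> f c \<otimes> K (- int n)) \<otimes> K (int d)) (K (- (int a + int n)) \<otimes> (e b \<otimes> f d))" for a b c d n :: nat
  have G: "G a b c d n \<in> carrier T.T" if "(a, b, c, d, n) \<in> quint_idx k l" for a b c d n
    using quint_le[OF that] by (simp add: G_def)
  have mid: "mid a b c d n \<in> carrier T.T" if "(a, b, c, d, n) \<in> quint_idx k l" for a b c d n
    using quint_le[OF that] by (simp add: mid_def)
  have "finsum T.T (\<lambda>(m, n, s). (v powi (int n * (int m - int s)) * \<tau> n) \<odot>\<^bsub>T.T\<^esub>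
       (E s \<otimes>\<^bsub>T.T\<^esub> F m \<otimes>\<^bsub>T.T\<^esub> T.t (K (- int n)) (K (- int n)))) (drinfeld_idx k l)
     = finsum T.T (\<lambda>(m, n, s). finsum T.T (\<lambda>((a, b), (c, d)). G a b c d n) (split_idx s \<times> split_idx m)) (drinfeld_idx k l)"
  proof (intro T.T.finsum_cong' refl)
    fix i assume "i \<in> drinfeld_idx k l"
    then obtain m n s where i: "i = (m, n, s)" "m + n = k" "n + s = l" by auto
    then have ms: "m \<le> k" "s \<le> l" by auto
    let ?Z = "T.t (K (- int n)) (K (- int n))"
    let ?c = "v powi (int n * (int m - int s)) * \<tau> n"
    have "?c \<odot>\<^bsub>T.T\<^esub> (E s \<otimes>\<^bsub>T.T\<^esub> F m \<otimes>\<^bsub>T.T\<^esub> ?Z)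
        = finsum T.T (\<lambda>j. ?c \<odot>\<^bsub>T.T\<^esub> (((\<lambda>((a, b), (c, d)). (v powi (int a * int b) * v powi (- (int c * int d))) \<odot>\<^bsub>T.T\<^esub>
      T.t (e a \<otimes> (f c \<otimes> K (int d))) ((K (- int a) \<otimes> e b) \<otimes> f d)) j) \<otimes>\<^bsub>T.T\<^esub> ?Z)) (split_idx s \<times> split_idx m)"
      unfolding E_mult_F[OF le_closed(3)[OF ms(2)] le_closed(4)[OF ms(1)]]
      using ms by (intro T.T.smult_finsum_mult) auto
    also have "\<dots> = finsum T.T (\<lambda>((a, b), (c, d)). G a b c d n) (split_idx s \<times> split_idx m)"
    proof (intro T.T.finsum_cong' refl)
      fix j assume "j \<in> split_idx s \<times> split_idx m"
      then obtain a b c d where j: "j = ((a, b), (c, d))" "a + b = s" "c + d = m" by auto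
      then have q: "a \<le> l" "b \<le> l" "c \<le> k" "d \<le> k" using ms by auto
      have t1: "e a \<otimes> (f c \<otimes> K (int d)) \<otimes> K (- int n) = (e a \<otimes> f c \<otimes> K (- int n)) \<otimes> K (int d)"
        using q by (simp add: m_assoc K_add add.commute)
      have "K (- int a) \<otimes> e b \<otimes> f d \<otimes> K (- int n) = K (- int a) \<otimes> ((e b \<otimes> f d) \<otimes> K (- int n))"
        using q by (simp add: m_assoc)
      also have "\<dots> = (v powi (2 * (- int n) * (int d - int b))) \<odot> (K (- int a) \<otimes> (K (- int n) \<otimes> (e b \<otimes> f d)))"
        using q by (simp only: torus_past_ef le_closed) (simp add: mult_smult_right)
      also have "K (- int a) \<otimes> (K (- int n) \<otimes> (e b \<otimes> f d)) = K (- (int a + int n)) \<otimes> (e b \<otimes> f d)"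
        using q by (simp add: m_assoc[symmetric] K_add)
      finally have t2: "K (- int a) \<otimes> e b \<otimes> f d \<otimes> K (- int n)
         = (v powi (2 * (- int n) * (int d - int b))) \<odot> (K (- (int a + int n)) \<otimes> (e b \<otimes> f d))" .
      have coeff: "?c * (v powi (int a * int b) * v powi (- (int c * int d))) * v powi (2 * (- int n) * (int d - int b))
         = v powi (int n * (int c - int a) + int b * (int a + int n) - int d * (int c + int n)) * \<tau> n"
      proof -
        have "int n * (int m - int s) + (int a * int b + (- (int c * int d))) + 2 * (- int n) * (int d - int b)
          = int n * (int c - int a) + int b * (int a + int n) - int d * (int c + int n)"
          unfolding j(2,3)[symmetric] by (simp add: algebra_simps)
        moreover have "?c * (v powi (int a * int b) * v powi (- (int c * int d))) * v powi (2 * (- int n) * (int d - int b))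
          = v powi (int n * (int m - int s) + (int a * int b + (- (int c * int d))) + 2 * (- int n) * (int d - int b)) * \<tau> n"
          by (simp only: power_int_add[OF disjI1[OF v_nz]] mult_ac)
        ultimately show ?thesis by simp
      qed
      show "?c \<odot>\<^bsub>T.T\<^esub> (((\<lambda>((a, b), (c, d)). (v powi (int a * int b) * v powi (- (int c * int d))) \<odot>\<^bsub>T.T\<^esub>
          T.t (e a \<otimes> (f c \<otimes> K (int d))) ((K (- int a) \<otimes> e b) \<otimes> f d)) j) \<otimes>\<^bsub>T.T\<^esub> ?Z)
        = ((\<lambda>((a, b), (c, d)). G a b c d n) j)"
        unfolding j(1) prod.case G_def coeff[symmetric]
        using q by (simp add: T.T.mult_smult_left T.pure_mult t1 t2 T.pure_smult_right T.T.smult_smult mult.assoc)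
    next
      show "(\<lambda>((a, b), c, d). G a b c d n) \<in> split_idx s \<times> split_idx m \<rightarrow> carrier T.T"
        using i by (auto intro!: G simp: quint_idx_def)
    qed
    finally show "(case i of (m, n, s) \<Rightarrow> (v powi (int n * (int m - int s)) * \<tau> n) \<odot>\<^bsub>T.T\<^esub>
       (E s \<otimes>\<^bsub>T.T\<^esub> F m \<otimes>\<^bsub>T.T\<^esub> T.t (K (- int n)) (K (- int n))))
      = (case i of (m, n, s) \<Rightarrow> finsum T.T (\<lambda>((a, b), (c, d)). G a b c d n) (split_idx s \<times> split_idx m))"
      unfolding i(1) prod.case .
  next
    show "(\<lambda>(m, n, s). finsum T.T (\<lambda>((a, b), (c, d)). G a b c d n) (split_idx s \<times> split_idx m)) \<in> drinfeld_idx k l \<rightarrow> carrier T.T"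
      by (auto intro!: T.T.finsum_closed G simp: quint_idx_def)
  qed
  also have "\<dots> = finsum T.T (\<lambda>(a, b, c, d, n). G a b c d n) (quint_idx k l)"
    by (rule T.T.quint_sum_split[OF G])
  also have "\<dots> = finsum T.T (\<lambda>(b, d). finsum T.T (\<lambda>(m, n, s). G s b m d n) (drinfeld_idx (k - d) (l - b))) ({..l} \<times> {..k})"
    by (rule T.T.quint_sum_by_second[OF G, symmetric])
  also have "\<dots> = finsum T.T (\<lambda>(b, d). finsum T.T (\<lambda>(m, n, s). mid s b m d n) (drinfeld_idx (k - d) (l - b))) ({..l} \<times> {..k})"
  proof (intro T.T.finsum_cong' refl)
    fix p assume "p \<in> {..l} \<times> {..k}"
    then obtain b d where p: "p = (b, d)" "b \<le> l" "d \<le> k" by auto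
    define c where "c = v powi (int b * int (l - b) - int d * int (k - d))"
    define Y where "Y = K (- int (l - b)) \<otimes> (e b \<otimes> f d)"
    have Y: "Y \<in> carrier U" using p by (simp add: Y_def)
    have R: "k - d \<in> R" "l - b \<in> R" by simp_all
    have "finsum T.T (\<lambda>(m, n, s). G s b m d n) (drinfeld_idx (k - d) (l - b))
        = finsum T.T (\<lambda>(m, n, s). (c * (v powi (int n * (int m - int s)) * \<tau> n)) \<odot>\<^bsub>T.T\<^esub>
             T.t (e s \<otimes> f m \<otimes> K (- int n) \<otimes> K (int d)) Y) (drinfeld_idx (k - d) (l - b))"
    proof (intro T.T.finsum_cong' refl)
      fix i assume "i \<in> drinfeld_idx (k - d) (l - b)"
      then obtain m n s where i: "i = (m, n, s)" "m + n = k - d" "n + s = l - b" by auto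
      have coeff: "c * (v powi (int n * (int m - int s)) * \<tau> n)
          = v powi (int n * (int m - int s) + int b * (int s + int n) - int d * (int m + int n)) * \<tau> n"
        unfolding c_def i(2,3)[symmetric] by (rule powi_merge) (simp add: algebra_simps)
      show "(case i of (m, n, s) \<Rightarrow> G s b m d n) = (case i of (m, n, s) \<Rightarrow> (c * (v powi (int n * (int m - int s)) * \<tau> n)) \<odot>\<^bsub>T.T\<^esub>
             T.t (e s \<otimes> f m \<otimes> K (- int n) \<otimes> K (int d)) Y)"
        unfolding i(1) prod.case G_def Y_def coeff i(3)[symmetric] by (simp add: add.commute)
    qed (use Y in auto)
    also have "\<dots> = finsum T.T (\<lambda>(m, n, s). (c * (v powi (- (int n * (int m - int s))) * \<tau> n)) \<odot>\<^bsub>T.T\<^esub>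
             T.t (f m \<otimes> e s \<otimes> K (int n) \<otimes> K (int d)) Y) (drinfeld_idx (k - d) (l - b))"
      by (rule exchange_left[OF R K_closed Y])
    also have "\<dots> = finsum T.T (\<lambda>(m, n, s). mid s b m d n) (drinfeld_idx (k - d) (l - b))"
    proof (intro T.T.finsum_cong' refl)
      fix i assume "i \<in> drinfeld_idx (k - d) (l - b)"
      then obtain m n s where i: "i = (m, n, s)" "m + n = k - d" "n + s = l - b" by auto
      then have q: "m \<le> k" "s \<le> l" by auto
      have coeff: "c * (v powi (- (int n * (int m - int s))) * \<tau> n)
          = v powi (int b * (int s + int n) - int d * (int m + int n) - int n * (int m - int s)) * \<tau> n"
        unfolding c_def i(2,3)[symmetric] by (rule powi_merge) (simp add: algebra_simps)
      show "(case i of (m, n, s) \<Rightarrow> (c * (v powi (- (int n * (int m - int s))) * \<tau> n)) \<odot>\<^bsub>T.T\<^esub>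
             T.t (f m \<otimes> e s \<otimes> K (int n) \<otimes> K (int d)) Y) = (case i of (m, n, s) \<Rightarrow> mid s b m d n)"
        unfolding i(1) prod.case mid_def Y_def coeff i(3)[symmetric] using q by (simp add: add.commute m_assoc K_add)
    next
      show "(\<lambda>(m, n, s). mid s b m d n) \<in> drinfeld_idx (k - d) (l - b) \<rightarrow> carrier T.T"
        using p by (auto intro!: mid simp: quint_idx_def)
    qed
    finally show "(case p of (b, d) \<Rightarrow> finsum T.T (\<lambda>(m, n, s). G s b m d n) (drinfeld_idx (k - d) (l - b)))
      = (case p of (b, d) \<Rightarrow> finsum T.T (\<lambda>(m, n, s). mid s b m d n) (drinfeld_idx (k - d) (l - b)))"
      unfolding p(1) prod.case .
  next
    show "(\<lambda>(b, d). finsum T.T (\<lambda>(m, n, s). mid s b m d n) (drinfeld_idx (k - d) (l - b))) \<in> {..l} \<times> {..k} \<rightarrow> carrier T.T"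
      by (auto intro!: T.T.finsum_closed mid simp: quint_idx_def)
  qed
  also have "\<dots> = finsum T.T (\<lambda>(a, b, c, d, n). mid a b c d n) (quint_idx k l)"
    by (rule T.T.quint_sum_by_second[OF mid])
  finally show ?thesis .
qed

text \<open>
  Here the first tensor factor contains \<open>K\<^bsup>d+n\<^esup> = K\<^bsup>k-c\<^esup>\<close> and depends on \<open>a\<close> and \<open>c\<close> only, while the
  second one is \<open>K\<^bsup>-a\<^esup>\<close> times a summand of the Drinfeld relation.
\<close>

lemma coprod_fe:
  "finsum T.T (\<lambda>(m, n, s). (v powi (- (int n * (int m - int s))) * \<tau> n) \<odot>\<^bsub>T.T\<^esub>
       (F m \<otimes>\<^bsub>T.T\<^esub> E s \<otimes>\<^bsub>T.T\<^esub> T.t (K (int n)) (K (int n)))) (drinfeld_idx k l)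
   = finsum T.T (\<lambda>(a, b, c, d, n). mid a b c d n) (quint_idx k l)"
proof -
  define G where "G a b c d n =
     (v powi (int a * (int b + int n) - int c * (int d + int n) - int n * (int d - int b)) * \<tau> n) \<odot>\<^bsub>T.T\<^esub>
     T.t (f c \<otimes> e a \<otimes> K (int d + int n)) (K (- int a) \<otimes> (f d \<otimes> e b \<otimes> K (int n)))" for a b c d n :: nat
  have G: "G a b c d n \<in> carrier T.T" if "(a, b, c, d, n) \<in> quint_idx k l" for a b c d n
    using quint_le[OF that] by (simp add: G_def)
  have mid: "mid a b c d n \<in> carrier T.T" if "(a, b, c, d, n) \<in> quint_idx k l" for a b c d n
    using quint_le[OF that] by (simp add: mid_def)
  have "finsum T.T (\<lambda>(m, n, s). (v powi (- (int n * (int m - int s))) * \<tau> n) \<odot>\<^bsub>T.T\<^esub>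
       (F m \<otimes>\<^bsub>T.T\<^esub> E s \<otimes>\<^bsub>T.T\<^esub> T.t (K (int n)) (K (int n)))) (drinfeld_idx k l)
     = finsum T.T (\<lambda>(m, n, s). finsum T.T (\<lambda>((a, b), (c, d)). G a b c d n) (split_idx s \<times> split_idx m)) (drinfeld_idx k l)"
  proof (intro T.T.finsum_cong' refl)
    fix i assume "i \<in> drinfeld_idx k l"
    then obtain m n s where i: "i = (m, n, s)" "m + n = k" "n + s = l" by auto
    then have ms: "m \<le> k" "s \<le> l" by auto
    let ?Z = "T.t (K (int n)) (K (int n))"
    let ?c = "v powi (- (int n * (int m - int s))) * \<tau> n"
    have "?c \<odot>\<^bsub>T.T\<^esub> (F m \<otimes>\<^bsub>T.T\<^esub> E s \<otimes>\<^bsub>T.T\<^esub> ?Z)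
        = finsum T.T (\<lambda>j. ?c \<odot>\<^bsub>T.T\<^esub> (((\<lambda>((a, b), (c, d)). (v powi (int a * int b) * v powi (- (int c * int d))) \<odot>\<^bsub>T.T\<^esub>
      T.t ((f c \<otimes> e a) \<otimes> K (int d)) (K (- int a) \<otimes> (f d \<otimes> e b))) j) \<otimes>\<^bsub>T.T\<^esub> ?Z)) (split_idx s \<times> split_idx m)"
      unfolding F_mult_E[OF le_closed(3)[OF ms(2)] le_closed(4)[OF ms(1)]]
      using ms by (intro T.T.smult_finsum_mult) auto
    also have "\<dots> = finsum T.T (\<lambda>((a, b), (c, d)). G a b c d n) (split_idx s \<times> split_idx m)"
    proof (intro T.T.finsum_cong' refl)
      fix j assume "j \<in> split_idx s \<times> split_idx m"
      then obtain a b c d where j: "j = ((a, b), (c, d))" "a + b = s" "c + d = m" by auto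
      then have q: "a \<le> l" "b \<le> l" "c \<le> k" "d \<le> k" using ms by auto
      have t1: "f c \<otimes> e a \<otimes> K (int d) \<otimes> K (int n) = f c \<otimes> e a \<otimes> K (int d + int n)"
        using q by (simp add: m_assoc K_add)
      have t2: "K (- int a) \<otimes> (f d \<otimes> e b) \<otimes> K (int n) = K (- int a) \<otimes> (f d \<otimes> e b \<otimes> K (int n))"
        using q by (simp add: m_assoc)
      have coeff: "?c * (v powi (int a * int b) * v powi (- (int c * int d)))
         = v powi (int a * (int b + int n) - int c * (int d + int n) - int n * (int d - int b)) * \<tau> n"
      proof -
        have "- (int n * (int m - int s)) + (int a * int b + (- (int c * int d)))
          = int a * (int b + int n) - int c * (int d + int n) - int n * (int d - int b)"
          unfolding j(2,3)[symmetric] by (simp add: algebra_simps)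
        moreover have "?c * (v powi (int a * int b) * v powi (- (int c * int d)))
          = v powi (- (int n * (int m - int s)) + (int a * int b + (- (int c * int d)))) * \<tau> n"
          by (simp only: power_int_add[OF disjI1[OF v_nz]] mult_ac)
        ultimately show ?thesis by simp
      qed
      show "?c \<odot>\<^bsub>T.T\<^esub> (((\<lambda>((a, b), (c, d)). (v powi (int a * int b) * v powi (- (int c * int d))) \<odot>\<^bsub>T.T\<^esub>
          T.t ((f c \<otimes> e a) \<otimes> K (int d)) (K (- int a) \<otimes> (f d \<otimes> e b))) j) \<otimes>\<^bsub>T.T\<^esub> ?Z)
        = ((\<lambda>((a, b), (c, d)). G a b c d n) j)"
        unfolding j(1) prod.case G_def coeff[symmetric]
        using q by (simp add: T.T.mult_smult_left T.pure_mult t1 t2 T.T.smult_smult)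
    next
      show "(\<lambda>((a, b), c, d). G a b c d n) \<in> split_idx s \<times> split_idx m \<rightarrow> carrier T.T"
        using i by (auto intro!: G simp: quint_idx_def)
    qed
    finally show "(case i of (m, n, s) \<Rightarrow> (v powi (- (int n * (int m - int s))) * \<tau> n) \<odot>\<^bsub>T.T\<^esub>
       (F m \<otimes>\<^bsub>T.T\<^esub> E s \<otimes>\<^bsub>T.T\<^esub> T.t (K (int n)) (K (int n))))
      = (case i of (m, n, s) \<Rightarrow> finsum T.T (\<lambda>((a, b), (c, d)). G a b c d n) (split_idx s \<times> split_idx m))"
      unfolding i(1) prod.case .
  next
    show "(\<lambda>(m, n, s). finsum T.T (\<lambda>((a, b), (c, d)). G a b c d n) (split_idx s \<times> split_idx m)) \<in> drinfeld_idx k l \<rightarrow> carrier T.T"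
      by (auto intro!: T.T.finsum_closed G simp: quint_idx_def)
  qed
  also have "\<dots> = finsum T.T (\<lambda>(a, b, c, d, n). G a b c d n) (quint_idx k l)"
    by (rule T.T.quint_sum_split[OF G])
  also have "\<dots> = finsum T.T (\<lambda>(a, c). finsum T.T (\<lambda>(m, n, s). G a s c m n) (drinfeld_idx (k - c) (l - a))) ({..l} \<times> {..k})"
    by (rule T.T.quint_sum_by_first[OF G, symmetric])
  also have "\<dots> = finsum T.T (\<lambda>(a, c). finsum T.T (\<lambda>(m, n, s). mid a s c m n) (drinfeld_idx (k - c) (l - a))) ({..l} \<times> {..k})"
  proof (intro T.T.finsum_cong' refl)
    fix p assume "p \<in> {..l} \<times> {..k}"
    then obtain a c where p: "p = (a, c)" "a \<le> l" "c \<le> k" by auto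
    define C where "C = v powi (int a * int (l - a) - int c * int (k - c))"
    define Y where "Y = f c \<otimes> e a \<otimes> K (int (k - c))"
    have Y: "Y \<in> carrier U" using p by (simp add: Y_def)
    have R: "k - c \<in> R" "l - a \<in> R" by simp_all
    have "finsum T.T (\<lambda>(m, n, s). G a s c m n) (drinfeld_idx (k - c) (l - a))
        = finsum T.T (\<lambda>(m, n, s). (C * (v powi (- (int n * (int m - int s))) * \<tau> n)) \<odot>\<^bsub>T.T\<^esub>
             T.t Y (K (- int a) \<otimes> (f m \<otimes> e s \<otimes> K (int n)))) (drinfeld_idx (k - c) (l - a))"
    proof (intro T.T.finsum_cong' refl)
      fix i assume "i \<in> drinfeld_idx (k - c) (l - a)"
      then obtain m n s where i: "i = (m, n, s)" "m + n = k - c" "n + s = l - a" by auto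
      have coeff: "C * (v powi (- (int n * (int m - int s))) * \<tau> n)
          = v powi (int a * (int s + int n) - int c * (int m + int n) - int n * (int m - int s)) * \<tau> n"
        unfolding C_def i(2,3)[symmetric] by (rule powi_merge) (simp add: algebra_simps)
      show "(case i of (m, n, s) \<Rightarrow> G a s c m n) = (case i of (m, n, s) \<Rightarrow> (C * (v powi (- (int n * (int m - int s))) * \<tau> n)) \<odot>\<^bsub>T.T\<^esub>
             T.t Y (K (- int a) \<otimes> (f m \<otimes> e s \<otimes> K (int n))))"
        unfolding i(1) prod.case G_def Y_def coeff i(2)[symmetric] by simp
    next
      show "(\<lambda>(m, n, s). (C * (v powi (- (int n * (int m - int s))) * \<tau> n)) \<odot>\<^bsub>T.T\<^esub>
             T.t Y (K (- int a) \<otimes> (f m \<otimes> e s \<otimes> K (int n)))) \<in> drinfeld_idx (k - c) (l - a) \<rightarrow> carrier T.T"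
        using Y by auto
    qed
    also have "\<dots> = finsum T.T (\<lambda>(m, n, s). (C * (v powi (int n * (int m - int s)) * \<tau> n)) \<odot>\<^bsub>T.T\<^esub>
             T.t Y (K (- int a) \<otimes> (e s \<otimes> f m \<otimes> K (- int n)))) (drinfeld_idx (k - c) (l - a))"
      by (rule exchange_right[OF R K_closed Y, symmetric])
    also have "\<dots> = finsum T.T (\<lambda>(m, n, s). mid a s c m n) (drinfeld_idx (k - c) (l - a))"
    proof (intro T.T.finsum_cong' refl)
      fix i assume "i \<in> drinfeld_idx (k - c) (l - a)"
      then obtain m n s where i: "i = (m, n, s)" "m + n = k - c" "n + s = l - a" by auto
      then have q: "m \<le> k" "s \<le> l" by auto
      have "K (- int a) \<otimes> (e s \<otimes> f m \<otimes> K (- int n))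
          = (v powi (2 * (- int n) * (int m - int s))) \<odot> (K (- int a) \<otimes> (K (- int n) \<otimes> (e s \<otimes> f m)))"
        using q by (simp only: torus_past_ef le_closed) (simp add: mult_smult_right)
      also have "K (- int a) \<otimes> (K (- int n) \<otimes> (e s \<otimes> f m)) = K (- (int a + int n)) \<otimes> (e s \<otimes> f m)"
        using q by (simp add: m_assoc[symmetric] K_add)
      finally have t: "K (- int a) \<otimes> (e s \<otimes> f m \<otimes> K (- int n))
          = (v powi (2 * (- int n) * (int m - int s))) \<odot> (K (- (int a + int n)) \<otimes> (e s \<otimes> f m))" .
      have coeff: "C * (v powi (int n * (int m - int s)) * \<tau> n) * v powi (2 * (- int n) * (int m - int s))
          = v powi (int s * (int a + int n) - int m * (int c + int n) - int n * (int c - int a)) * \<tau> n"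
      proof -
        have "(int a * int (l - a) - int c * int (k - c)) + int n * (int m - int s) + 2 * (- int n) * (int m - int s)
          = int s * (int a + int n) - int m * (int c + int n) - int n * (int c - int a)"
          unfolding i(2,3)[symmetric] by (simp add: algebra_simps)
        moreover have "C * (v powi (int n * (int m - int s)) * \<tau> n) * v powi (2 * (- int n) * (int m - int s))
          = v powi ((int a * int (l - a) - int c * int (k - c)) + int n * (int m - int s) + 2 * (- int n) * (int m - int s)) * \<tau> n"
          unfolding C_def by (simp only: power_int_add[OF disjI1[OF v_nz]] mult_ac)
        ultimately show ?thesis by simp
      qed
      have kc: "int (k - c) = int n + int m" using i(2) by simp
      show "(case i of (m, n, s) \<Rightarrow> (C * (v powi (int n * (int m - int s)) * \<tau> n)) \<odot>\<^bsub>T.T\<^esub>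
             T.t Y (K (- int a) \<otimes> (e s \<otimes> f m \<otimes> K (- int n)))) = (case i of (m, n, s) \<Rightarrow> mid a s c m n)"
        unfolding i(1) prod.case mid_def t coeff[symmetric]
        using q p Y by (simp add: T.pure_smult_right T.T.smult_smult) (simp add: Y_def kc)
    next
      show "(\<lambda>(m, n, s). mid a s c m n) \<in> drinfeld_idx (k - c) (l - a) \<rightarrow> carrier T.T"
        using p by (auto intro!: mid simp: quint_idx_def)
    qed
    finally show "(case p of (a, c) \<Rightarrow> finsum T.T (\<lambda>(m, n, s). G a s c m n) (drinfeld_idx (k - c) (l - a)))
      = (case p of (a, c) \<Rightarrow> finsum T.T (\<lambda>(m, n, s). mid a s c m n) (drinfeld_idx (k - c) (l - a)))"
      unfolding p(1) prod.case .
  next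
    show "(\<lambda>(a, c). finsum T.T (\<lambda>(m, n, s). mid a s c m n) (drinfeld_idx (k - c) (l - a))) \<in> {..l} \<times> {..k} \<rightarrow> carrier T.T"
      by (auto intro!: T.T.finsum_closed mid simp: quint_idx_def)
  qed
  also have "\<dots> = finsum T.T (\<lambda>(a, b, c, d, n). mid a b c d n) (quint_idx k l)"
    by (rule T.T.quint_sum_by_first[OF mid])
  finally show ?thesis .
qed

end

end

section \<open>Torus relations in the algebra before the quotient\<close>

lemma qvar_nz: "qvar \<noteq> 0"
  by (simp add: qvar_def Zero_fract_def eq_fract)

lemma coweights_zero: "(\<lambda>x. 0) \<in> coweights"
  by (simp add: coweights_def additive_def)

lemma coweights_add: "h \<in> coweights \<Longrightarrow> h' \<in> coweights \<Longrightarrow> (\<lambda>x. h x + h' x) \<in> coweights"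
  by (simp add: coweights_def additive_def)

lemma coweights_uminus: "h \<in> coweights \<Longrightarrow> (\<lambda>x. - h x) \<in> coweights"
  by (simp add: coweights_def additive_def)

lemma coweights_scale:
  assumes "h \<in> coweights" shows "(\<lambda>x. c * h x) \<in> coweights"
proof -
  have "h (x + y) = h x + h y" for x y
    using assms by (simp add: coweights_def additive_def)
  then show ?thesis by (simp add: coweights_def additive_def distrib_left)
qed

lemma monoid_free_monoid: "Group.monoid (free_monoid S)"
  by (rule monoidI) (auto simp: free_monoid_def)

lemma assoc_algebra_FA: "assoc_algebra (FA D)"
  unfolding FA_def free_algebra_def
  by (rule monoid.assoc_algebra_monoid_algebra[OF monoid_free_monoid])

lemma FA_one: "\<one>\<^bsub>FA D\<^esub> = basis_elt []"
  by (simp add: FA_def free_algebra_def free_monoid_def)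

lemma basis_elt_FA: "set xs \<subseteq> gens D \<Longrightarrow> basis_elt xs \<in> carrier (FA D)"
  unfolding FA_def free_algebra_def
  by (rule basis_elt_closed) (auto simp: free_monoid_def)

text \<open>
  The admissible levels of an index: all \<open>l\<close> with \<open>(i, l)\<close> in \<open>I\<^sup>\<infinity>\<close>, and \<open>0\<close>, where \<open>e\<close> and \<open>f\<close>
  are \<open>1\<close>. This set is closed downwards.
\<close>

definition levels :: "('i, 'p) bc_datum \<Rightarrow> 'i \<Rightarrow> nat set" where
  "levels D i = {l. l = 0 \<or> (i, l) \<in> idx_inf D}"

lemma levels_down: "l \<in> levels D i \<Longrightarrow> m \<le> l \<Longrightarrow> m \<in> levels D i"
  by (auto simp: levels_def idx_inf_def)

lemma idx_inf_idx: "(i, l) \<in> idx_inf D \<Longrightarrow> i \<in> idx D"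
  by (auto simp: idx_inf_def idx_re_def idx_im_def)

lemma q_free_closed: "h \<in> coweights \<Longrightarrow> q_free h \<in> carrier (FA D)"
  unfolding q_free_def by (rule basis_elt_FA) (auto simp: gens_def)

lemma e_free_closed: "l \<in> levels D i \<Longrightarrow> e_free i l \<in> carrier (FA D)"
  unfolding e_free_def by (auto intro!: basis_elt_FA simp: gens_def levels_def)

lemma f_free_closed: "l \<in> levels D i \<Longrightarrow> f_free i l \<in> carrier (FA D)"
  unfolding f_free_def by (auto intro!: basis_elt_FA simp: gens_def levels_def)

lemma idx_inf_levels: "(i, l) \<in> idx_inf D \<Longrightarrow> l \<in> levels D i"
  by (simp add: levels_def)

lemma idx_re_levels: "i \<in> idx_re D \<Longrightarrow> Suc 0 \<in> levels D i"
  by (simp add: levels_def idx_inf_def)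

lemma torus_relations_closed: "torus_relations D \<subseteq> carrier (FA D)"
proof -
  interpret A: assoc_algebra "FA D" by (rule assoc_algebra_FA)
  show ?thesis
    unfolding torus_relations_def Let_def
    by (auto intro!: A.minus_closed A.m_closed A.smult_closed q_free_closed e_free_closed f_free_closed
        idx_inf_levels coweights_zero coweights_add coweights_uminus)
qed

lemma serre_relations_closed:
  assumes "\<And>i l. l \<in> levels D i \<Longrightarrow> x i l \<in> carrier (FA D)"
  shows "serre_relations D x \<subseteq> carrier (FA D)"
proof -
  interpret A: assoc_algebra "FA D" by (rule assoc_algebra_FA)
  show ?thesis
    unfolding serre_relations_def Let_def
    by (auto intro!: A.finsum_closed A.m_closed A.smult_closed A.nat_pow_closed assms idx_inf_levels idx_re_levels)
qed

lemma commutation_relations_closed: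
  assumes "\<And>i l. l \<in> levels D i \<Longrightarrow> x i l \<in> carrier (FA D)"
  shows "commutation_relations D x \<subseteq> carrier (FA D)"
proof -
  interpret A: assoc_algebra "FA D" by (rule assoc_algebra_FA)
  show ?thesis
    unfolding commutation_relations_def Let_def
    by (auto intro!: A.minus_closed A.m_closed assms idx_inf_levels)
qed

lemma hat_relations_closed:
  "torus_relations D \<union> serre_relations D e_free \<union> serre_relations D f_free
     \<union> commutation_relations D e_free \<union> commutation_relations D f_free \<subseteq> carrier (FA D)"
  using torus_relations_closed serre_relations_closed commutation_relations_closed
    e_free_closed f_free_closed by (metis Un_least)

lemma algebra_ideal_hat: "algebra_ideal (FA D) (hat_ideal D)"
  unfolding hat_ideal_def by (intro algebra_ideal_genideal assoc_algebra_FA hat_relations_closed)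

lemma assoc_algebra_Uhat: "assoc_algebra (Uhat D)"
  unfolding Uhat_def by (intro algebra_ideal.assoc_algebra_quotient algebra_ideal_hat)

lemma hat_proj_alg_hom: "(\<lambda>x. hat_ideal D +>\<^bsub>FA D\<^esub> x) \<in> alg_hom (FA D) (Uhat D)"
  unfolding Uhat_def by (intro algebra_ideal.proj_alg_hom algebra_ideal_hat)

lemma hat_closed: "x \<in> carrier (FA D) \<Longrightarrow> hat_ideal D +>\<^bsub>FA D\<^esub> x \<in> carrier (Uhat D)"
  using hat_proj_alg_hom[of D] by (auto simp: alg_hom_def dest: ring_hom_closed)

lemma q_hat_closed: "h \<in> coweights \<Longrightarrow> q_hat D h \<in> carrier (Uhat D)"
  unfolding q_hat_def by (intro hat_closed q_free_closed)

lemma e_hat_closed: "l \<in> levels D i \<Longrightarrow> e_hat D i l \<in> carrier (Uhat D)"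
  unfolding e_hat_def by (intro hat_closed e_free_closed)

lemma f_hat_closed: "l \<in> levels D i \<Longrightarrow> f_hat D i l \<in> carrier (Uhat D)"
  unfolding f_hat_def by (intro hat_closed f_free_closed)

lemma e_hat_zero: "e_hat D i 0 = \<one>\<^bsub>Uhat D\<^esub>"
proof -
  interpret algebra_ideal "FA D" "hat_ideal D" by (rule algebra_ideal_hat)
  show ?thesis by (simp add: e_hat_def e_free_def Uhat_def quotient_one FA_one)
qed

lemma f_hat_zero: "f_hat D i 0 = \<one>\<^bsub>Uhat D\<^esub>"
proof -
  interpret algebra_ideal "FA D" "hat_ideal D" by (rule algebra_ideal_hat)
  show ?thesis by (simp add: f_hat_def f_free_def Uhat_def quotient_one FA_one)
qed

lemma hat_relation_eq:
  assumes "x \<ominus>\<^bsub>FA D\<^esub> y \<in> torus_relations D" "x \<in> carrier (FA D)" "y \<in> carrier (FA D)"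
  shows "hat_ideal D +>\<^bsub>FA D\<^esub> x = hat_ideal D +>\<^bsub>FA D\<^esub> y"
proof -
  interpret A: algebra_ideal "FA D" "hat_ideal D" by (rule algebra_ideal_hat)
  show ?thesis
    using assms A.genideal_self[OF hat_relations_closed[of D]]
    by (intro A.coset_eqI) (auto simp: hat_ideal_def)
qed

lemma assoc_algebra_homI:
  "assoc_algebra A \<Longrightarrow> assoc_algebra B \<Longrightarrow> \<phi> \<in> alg_hom A B \<Longrightarrow> assoc_algebra_hom A B \<phi>"
  by (simp add: assoc_algebra_hom_def assoc_algebra_hom_axioms_def)

context
  fixes D :: "('i, 'p::ab_group_add) bc_datum"
begin

interpretation A: assoc_algebra "FA D" by (rule assoc_algebra_FA)
interpretation U: assoc_algebra "Uhat D" by (rule assoc_algebra_Uhat)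
interpretation p: assoc_algebra_hom "FA D" "Uhat D" "\<lambda>x. hat_ideal D +>\<^bsub>FA D\<^esub> x"
  by (intro assoc_algebra_homI assoc_algebra_FA assoc_algebra_Uhat hat_proj_alg_hom)

lemma q_hat_zero: "q_hat D (\<lambda>x. 0) = \<one>\<^bsub>Uhat D\<^esub>"
  unfolding q_hat_def p.hom_one[symmetric]
  by (intro hat_relation_eq q_free_closed coweights_zero A.one_closed)
     (simp add: torus_relations_def Let_def)

lemma q_hat_add:
  assumes "h \<in> coweights" "h' \<in> coweights"
  shows "q_hat D h \<otimes>\<^bsub>Uhat D\<^esub> q_hat D h' = q_hat D (\<lambda>x. h x + h' x)"
  unfolding q_hat_def
  using assms
  by (subst p.hom_mult[symmetric]; (intro hat_relation_eq)?)
     (auto intro!: q_free_closed coweights_add A.m_closed simp: torus_relations_def Let_def)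

lemma commute_past_torus:
  assumes h: "h \<in> coweights" and x: "x \<in> carrier (Uhat D)"
    and rel: "q_hat D h \<otimes>\<^bsub>Uhat D\<^esub> x \<otimes>\<^bsub>Uhat D\<^esub> q_hat D (\<lambda>x. - h x) = c \<odot>\<^bsub>Uhat D\<^esub> x"
  shows "q_hat D h \<otimes>\<^bsub>Uhat D\<^esub> x = c \<odot>\<^bsub>Uhat D\<^esub> (x \<otimes>\<^bsub>Uhat D\<^esub> q_hat D h)"
proof -
  have inv: "q_hat D (\<lambda>x. - h x) \<otimes>\<^bsub>Uhat D\<^esub> q_hat D h = \<one>\<^bsub>Uhat D\<^esub>"
    using h by (simp add: q_hat_add coweights_uminus q_hat_zero)
  note closed = q_hat_closed[OF h, where D = D] q_hat_closed[OF coweights_uminus[OF h], where D = D] x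
  have "q_hat D h \<otimes>\<^bsub>Uhat D\<^esub> x = (q_hat D h \<otimes>\<^bsub>Uhat D\<^esub> x \<otimes>\<^bsub>Uhat D\<^esub> q_hat D (\<lambda>x. - h x)) \<otimes>\<^bsub>Uhat D\<^esub> q_hat D h"
    using closed by (simp add: U.m_assoc inv)
  then show ?thesis
    using closed by (simp add: rel U.mult_smult_left)
qed

lemma q_hat_e_hat:
  assumes h: "h \<in> coweights" and l: "l \<in> levels D j"
  shows "q_hat D h \<otimes>\<^bsub>Uhat D\<^esub> e_hat D j l =
    (qvar powi (int l * h (simple_root D j))) \<odot>\<^bsub>Uhat D\<^esub> (e_hat D j l \<otimes>\<^bsub>Uhat D\<^esub> q_hat D h)"
proof (cases "l = 0")
  case True
  then show ?thesis using q_hat_closed[OF h, where D = D] by (simp add: e_hat_zero U.smult_one)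
next
  case False
  then have jl: "(j, l) \<in> idx_inf D" using l by (simp add: levels_def)
  note closed = q_free_closed[OF h, where D = D] q_free_closed[OF coweights_uminus[OF h], where D = D] e_free_closed[OF l]
  have "hat_ideal D +>\<^bsub>FA D\<^esub> (q_free h \<otimes>\<^bsub>FA D\<^esub> e_free j l \<otimes>\<^bsub>FA D\<^esub> q_free (\<lambda>x. - h x))
      = hat_ideal D +>\<^bsub>FA D\<^esub> ((qvar powi (int l * h (simple_root D j))) \<odot>\<^bsub>FA D\<^esub> e_free j l)"
  proof (intro hat_relation_eq A.m_closed A.smult_closed closed)
    show "q_free h \<otimes>\<^bsub>FA D\<^esub> e_free j l \<otimes>\<^bsub>FA D\<^esub> q_free (\<lambda>x. - h x)
       \<ominus>\<^bsub>FA D\<^esub> (qvar powi (int l * h (simple_root D j))) \<odot>\<^bsub>FA D\<^esub> e_free j l \<in> torus_relations D"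
      unfolding torus_relations_def Let_def using h jl by blast
  qed
  then show ?thesis
    using closed by (intro commute_past_torus[OF h e_hat_closed[OF l]])
      (simp add: q_hat_def e_hat_def p.hom_smult)
qed

lemma q_hat_f_hat:
  assumes h: "h \<in> coweights" and l: "l \<in> levels D j"
  shows "q_hat D h \<otimes>\<^bsub>Uhat D\<^esub> f_hat D j l =
    (qvar powi (- (int l * h (simple_root D j)))) \<odot>\<^bsub>Uhat D\<^esub> (f_hat D j l \<otimes>\<^bsub>Uhat D\<^esub> q_hat D h)"
proof (cases "l = 0")
  case True
  then show ?thesis using q_hat_closed[OF h, where D = D] by (simp add: f_hat_zero U.smult_one)
next
  case False
  then have jl: "(j, l) \<in> idx_inf D" using l by (simp add: levels_def)
  note closed = q_free_closed[OF h, where D = D] q_free_closed[OF coweights_uminus[OF h], where D = D] f_free_closed[OF l]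
  have "hat_ideal D +>\<^bsub>FA D\<^esub> (q_free h \<otimes>\<^bsub>FA D\<^esub> f_free j l \<otimes>\<^bsub>FA D\<^esub> q_free (\<lambda>x. - h x))
      = hat_ideal D +>\<^bsub>FA D\<^esub> ((qvar powi (- (int l * h (simple_root D j)))) \<odot>\<^bsub>FA D\<^esub> f_free j l)"
  proof (intro hat_relation_eq A.m_closed A.smult_closed closed)
    show "q_free h \<otimes>\<^bsub>FA D\<^esub> f_free j l \<otimes>\<^bsub>FA D\<^esub> q_free (\<lambda>x. - h x)
       \<ominus>\<^bsub>FA D\<^esub> (qvar powi (- (int l * h (simple_root D j)))) \<odot>\<^bsub>FA D\<^esub> f_free j l \<in> torus_relations D"
      unfolding torus_relations_def Let_def using h jl by blast
  qed
  then show ?thesis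
    using closed by (intro commute_past_torus[OF h f_hat_closed[OF l]])
      (simp add: q_hat_def f_hat_def p.hom_smult)
qed

end

section \<open>The quantum Borcherds-Bozec algebra\<close>

lemma drinfeld_relations_closed:
  assumes "borcherds_cartan_datum D"
  shows "drinfeld_relations D \<tau> \<subseteq> carrier (Uhat D)"
proof -
  interpret U: assoc_algebra "Uhat D" by (rule assoc_algebra_Uhat)
  interpret borcherds_cartan_datum D by fact
  have K: "K_coweight D i n \<in> coweights" if "(i, l) \<in> idx_inf D" for i l n
    unfolding K_coweight_def by (intro coweights_scale coroot_coweight idx_inf_idx[OF that])
  have lev: "m \<in> levels D i" "n \<in> levels D i" if "(i, m + n) \<in> idx_inf D" for i m n
    using levels_down[OF idx_inf_levels[OF that]] by simp_all
  show ?thesis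
    unfolding drinfeld_relations_def Let_def
    by (auto intro!: U.minus_closed U.m_closed U.finsum_closed U.smult_closed
        e_hat_closed f_hat_closed q_hat_closed intro: idx_inf_levels K lev)
qed

text \<open>
  The quotient \<open>U\<close> and its generators, the images under the projection \<open>\<pi>\<close>; \<open>K_U i n\<close> is \<open>K\<^sub>i\<^sup>n\<close>.
\<close>

locale bb_algebra = borcherds_cartan_datum D
  for D :: "('i, 'p::ab_group_add) bc_datum" +
  fixes \<tau> :: "'i \<Rightarrow> nat \<Rightarrow> ratfun"
begin

abbreviation U where "U \<equiv> Uq D \<tau>"
abbreviation \<pi> where "\<pi> \<equiv> Uq_proj D \<tau>"
abbreviation q_U where "q_U h \<equiv> \<pi> (q_hat D h)"
abbreviation e_U where "e_U i l \<equiv> \<pi> (e_hat D i l)"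
abbreviation f_U where "f_U i l \<equiv> \<pi> (f_hat D i l)"
abbreviation K_U where "K_U i n \<equiv> q_U (K_coweight D i n)"

sublocale hat: assoc_algebra "Uhat D" by (rule assoc_algebra_Uhat)

sublocale I: algebra_ideal "Uhat D" "drinfeld_ideal D \<tau>"
  unfolding drinfeld_ideal_def
  by (intro algebra_ideal_genideal assoc_algebra_Uhat drinfeld_relations_closed borcherds_cartan_datum_axioms)

sublocale U: assoc_algebra U
  unfolding Uq_def by (rule I.assoc_algebra_quotient)

lemma proj_eq: "\<pi> = (\<lambda>x. drinfeld_ideal D \<tau> +>\<^bsub>Uhat D\<^esub> x)"
  by (simp add: Uq_proj_def fun_eq_iff)

lemma proj_hom: "\<pi> \<in> alg_hom (Uhat D) U"
  unfolding proj_eq Uq_def by (rule I.proj_alg_hom)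

sublocale p: assoc_algebra_hom "Uhat D" U \<pi>
  by (intro assoc_algebra_homI hat.assoc_algebra_axioms U.assoc_algebra_axioms proj_hom)

lemma K_coweight_mem: "i \<in> idx D \<Longrightarrow> K_coweight D i n \<in> coweights"
  unfolding K_coweight_def by (intro coweights_scale coroot_coweight)

lemma K_U_add:
  assumes "i \<in> idx D" shows "K_U i m \<otimes>\<^bsub>U\<^esub> K_U i n = K_U i (m + n)"
proof -
  note K = K_coweight_mem[OF assms]
  have "(\<lambda>x. K_coweight D i m x + K_coweight D i n x) = K_coweight D i (m + n)"
    by (simp add: K_coweight_def algebra_simps fun_eq_iff)
  then show ?thesis using q_hat_add[OF K[of m] K[of n], where D = D] q_hat_closed[OF K, where D = D] by (simp flip: p.hom_mult)
qed

lemma K_U_e: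
  assumes "i \<in> idx D" "j \<in> idx D" "l \<in> levels D j"
  shows "K_U i n \<otimes>\<^bsub>U\<^esub> e_U j l = ((qvar powi (symm D i * cartan D i j)) powi (n * int l)) \<odot>\<^bsub>U\<^esub> (e_U j l \<otimes>\<^bsub>U\<^esub> K_U i n)"
proof -
  have "K_U i n \<otimes>\<^bsub>U\<^esub> e_U j l = \<pi> (q_hat D (K_coweight D i n) \<otimes>\<^bsub>Uhat D\<^esub> e_hat D j l)"
    using assms by (simp add: q_hat_closed e_hat_closed K_coweight_mem)
  also have "\<dots> = (qvar powi (int l * K_coweight D i n (simple_root D j))) \<odot>\<^bsub>U\<^esub> (e_U j l \<otimes>\<^bsub>U\<^esub> K_U i n)"
    using assms by (simp add: q_hat_e_hat q_hat_closed e_hat_closed K_coweight_mem p.hom_smult)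
  also have "qvar powi (int l * K_coweight D i n (simple_root D j)) = (qvar powi (symm D i * cartan D i j)) powi (n * int l)"
    unfolding power_int_mult[symmetric] using assms by (simp add: K_coweight_def coroot_root mult_ac)
  finally show ?thesis .
qed

lemma f_U_K:
  assumes "i \<in> idx D" "j \<in> idx D" "l \<in> levels D j"
  shows "f_U j l \<otimes>\<^bsub>U\<^esub> K_U i n = ((qvar powi (symm D i * cartan D i j)) powi (n * int l)) \<odot>\<^bsub>U\<^esub> (K_U i n \<otimes>\<^bsub>U\<^esub> f_U j l)"
proof -
  define u where "u = (qvar powi (symm D i * cartan D i j)) powi (n * int l)"
  note closed = q_hat_closed[OF K_coweight_mem[OF assms(1), of n], where D = D] f_hat_closed[OF assms(3)]
  have u: "qvar powi (- (int l * K_coweight D i n (simple_root D j))) = inverse u"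
    unfolding u_def power_int_mult[symmetric] power_int_minus[symmetric]
    using assms by (simp add: K_coweight_def coroot_root mult_ac)
  have "K_U i n \<otimes>\<^bsub>U\<^esub> f_U j l = \<pi> (q_hat D (K_coweight D i n) \<otimes>\<^bsub>Uhat D\<^esub> f_hat D j l)"
    using closed by simp
  also have "\<dots> = inverse u \<odot>\<^bsub>U\<^esub> (f_U j l \<otimes>\<^bsub>U\<^esub> K_U i n)"
    using assms closed by (simp add: q_hat_f_hat K_coweight_mem p.hom_smult u)
  moreover have "u \<noteq> 0" using qvar_nz by (simp add: u_def)
  ultimately show ?thesis
    unfolding u_def[symmetric] using closed by (simp add: U.smult_smult U.smult_one)
qed

lemma e_U_zero: "e_U i 0 = \<one>\<^bsub>U\<^esub>" and f_U_zero: "f_U i 0 = \<one>\<^bsub>U\<^esub>"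
  by (simp_all add: e_hat_zero f_hat_zero)

lemma relation_zero: "r \<in> drinfeld_relations D \<tau> \<Longrightarrow> \<pi> r = \<zero>\<^bsub>U\<^esub>"
proof -
  assume r: "r \<in> drinfeld_relations D \<tau>"
  have "drinfeld_relations D \<tau> \<subseteq> drinfeld_ideal D \<tau>"
    unfolding drinfeld_ideal_def
    by (rule hat.genideal_self[OF drinfeld_relations_closed[OF borcherds_cartan_datum_axioms]])
  with r have "r \<in> drinfeld_ideal D \<tau>" by blast
  then show ?thesis unfolding proj_eq Uq_def by (rule I.coset_zero)
qed

lemma relation_eq:
  assumes "x \<ominus>\<^bsub>Uhat D\<^esub> y \<in> drinfeld_relations D \<tau>" "x \<in> carrier (Uhat D)" "y \<in> carrier (Uhat D)"
  shows "\<pi> x = \<pi> y"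
proof (rule U.minus_eq_zero_imp_eq)
  show "\<pi> x \<ominus>\<^bsub>U\<^esub> \<pi> y = \<zero>\<^bsub>U\<^esub>"
    using relation_zero[OF assms(1)] p.hom_minus[OF assms(2,3)] by simp
qed (use assms(2,3) in simp_all)

lemma torus_pair_U:
  assumes "i \<in> idx D" "j \<in> idx D"
  shows "torus_pair U (qvar powi (symm D i * cartan D i j))
    (e_U j) (f_U i) (K_U j) (K_U i) (levels D j) (levels D i)"
proof
  show "f_U i l \<otimes>\<^bsub>U\<^esub> K_U j n = ((qvar powi (symm D i * cartan D i j)) powi (n * int l)) \<odot>\<^bsub>U\<^esub> (K_U j n \<otimes>\<^bsub>U\<^esub> f_U i l)"
    if "l \<in> levels D i" for l n
    using f_U_K[OF assms(2,1) that] symmetrizable[OF assms] by simp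
  show "K_U i n \<otimes>\<^bsub>U\<^esub> e_U j l = ((qvar powi (symm D i * cartan D i j)) powi (n * int l)) \<odot>\<^bsub>U\<^esub> (e_U j l \<otimes>\<^bsub>U\<^esub> K_U i n)"
    if "l \<in> levels D j" for l n
    using K_U_e[OF assms that] .
  show "l \<in> levels D i \<Longrightarrow> m \<le> l \<Longrightarrow> m \<in> levels D i" "l \<in> levels D j \<Longrightarrow> m \<le> l \<Longrightarrow> m \<in> levels D j" for l m
    by (rule levels_down; assumption)+
qed (use assms in \<open>simp_all add: qvar_nz e_hat_closed f_hat_closed q_hat_closed K_coweight_mem\<close>)

lemma e_f_commute:
  assumes "i \<noteq> j" "l \<in> levels D j" "k \<in> levels D i"
  shows "e_U j l \<otimes>\<^bsub>U\<^esub> f_U i k = f_U i k \<otimes>\<^bsub>U\<^esub> e_U j l"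
proof (cases "l = 0 \<or> k = 0")
  case True
  moreover have "e_U j l \<in> carrier U" "f_U i k \<in> carrier U"
    using assms by (simp_all add: e_hat_closed f_hat_closed)
  ultimately show ?thesis
    by (elim disjE; hypsubst) (simp_all add: e_U_zero f_U_zero)
next
  case False
  then have idx: "(i, k) \<in> idx_inf D" "(j, l) \<in> idx_inf D" using assms by (auto simp: levels_def)
  note closed = e_hat_closed[OF assms(2)] f_hat_closed[OF assms(3)]
  have "\<pi> (e_hat D j l \<otimes>\<^bsub>Uhat D\<^esub> f_hat D i k) = \<pi> (f_hat D i k \<otimes>\<^bsub>Uhat D\<^esub> e_hat D j l)"
  proof (intro relation_eq hat.m_closed closed)
    show "e_hat D j l \<otimes>\<^bsub>Uhat D\<^esub> f_hat D i k \<ominus>\<^bsub>Uhat D\<^esub> f_hat D i k \<otimes>\<^bsub>Uhat D\<^esub> e_hat D j l \<in> drinfeld_relations D \<tau>"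
      unfolding drinfeld_relations_def Let_def using idx assms(1) by blast
  qed
  then show ?thesis using closed by simp
qed

text \<open>
  If one of the levels is \<open>0\<close>, then only \<open>n = 0\<close> occurs, one of \<open>e\<close> and \<open>f\<close> is \<open>1\<close>, and both sides
  are equal without any relation.
\<close>

lemma drinfeld_U:
  assumes "i \<in> idx D" "k \<in> levels D i" "l \<in> levels D i"
  shows "finsum U (\<lambda>(m, n, s). (q_par D i powi (int n * (int m - int s)) * \<tau> i n) \<odot>\<^bsub>U\<^esub>
            (e_U i s \<otimes>\<^bsub>U\<^esub> f_U i m \<otimes>\<^bsub>U\<^esub> K_U i (- int n))) (drinfeld_idx k l)
       = finsum U (\<lambda>(m, n, s). (q_par D i powi (- (int n * (int m - int s))) * \<tau> i n) \<odot>\<^bsub>U\<^esub>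
            (f_U i m \<otimes>\<^bsub>U\<^esub> e_U i s \<otimes>\<^bsub>U\<^esub> K_U i (int n))) (drinfeld_idx k l)"
proof (cases "k = 0 \<or> l = 0")
  case True
  then have "drinfeld_idx k l = {(k, 0, l)}" by auto
  moreover have "K_U i 0 \<in> carrier U" "e_U i l \<in> carrier U" "f_U i k \<in> carrier U"
    using assms by (auto simp: q_hat_closed K_coweight_mem e_hat_closed f_hat_closed)
  ultimately show ?thesis
    using True by (elim disjE; hypsubst) (simp_all add: e_U_zero f_U_zero)
next
  case False
  then have idx: "(i, k) \<in> idx_inf D" "(i, l) \<in> idx_inf D" using assms by (auto simp: levels_def)
  note e = e_hat_closed[OF levels_down[OF assms(3)]] note f = f_hat_closed[OF levels_down[OF assms(2)]]
  note K = q_hat_closed[OF K_coweight_mem[OF assms(1)], where D = D]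
  let ?x = "finsum (Uhat D) (\<lambda>(m, n, s). (q_par D i powi (int n * (int m - int s)) * \<tau> i n) \<odot>\<^bsub>Uhat D\<^esub>
     (e_hat D i s \<otimes>\<^bsub>Uhat D\<^esub> f_hat D i m \<otimes>\<^bsub>Uhat D\<^esub> q_hat D (K_coweight D i (- int n)))) (drinfeld_idx k l)"
  let ?y = "finsum (Uhat D) (\<lambda>(m, n, s). (q_par D i powi (- (int n * (int m - int s))) * \<tau> i n) \<odot>\<^bsub>Uhat D\<^esub>
     (f_hat D i m \<otimes>\<^bsub>Uhat D\<^esub> e_hat D i s \<otimes>\<^bsub>Uhat D\<^esub> q_hat D (K_coweight D i (int n)))) (drinfeld_idx k l)"
  have xy: "?x \<in> carrier (Uhat D)" "?y \<in> carrier (Uhat D)"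
    by (auto intro!: hat.finsum_closed hat.smult_closed hat.m_closed e f K)
  have mem: "?x \<ominus>\<^bsub>Uhat D\<^esub> ?y \<in> drinfeld_relations D \<tau>"
    unfolding drinfeld_relations_def Let_def using idx by blast
  have "\<pi> ?x = finsum U (\<lambda>(m, n, s). (q_par D i powi (int n * (int m - int s)) * \<tau> i n) \<odot>\<^bsub>U\<^esub>
            (e_U i s \<otimes>\<^bsub>U\<^esub> f_U i m \<otimes>\<^bsub>U\<^esub> K_U i (- int n))) (drinfeld_idx k l)"
    by (subst p.hom_finsum; (intro U.finsum_cong' refl)?) (auto simp: p.hom_smult e f K del: equalityI)
  moreover have "\<pi> ?y = finsum U (\<lambda>(m, n, s). (q_par D i powi (- (int n * (int m - int s))) * \<tau> i n) \<odot>\<^bsub>U\<^esub>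
            (f_U i m \<otimes>\<^bsub>U\<^esub> e_U i s \<otimes>\<^bsub>U\<^esub> K_U i (int n))) (drinfeld_idx k l)"
    by (subst p.hom_finsum; (intro U.finsum_cong' refl)?) (auto simp: p.hom_smult e f K del: equalityI)
  ultimately show ?thesis using relation_eq[OF mem xy] by simp
qed

lemma drinfeld_pair_U:
  assumes i: "i \<in> idx D"
  shows "drinfeld_pair U (q_par D i) (e_U i) (f_U i) (K_U i) (levels D i) (\<tau> i)"
proof -
  \<comment> \<open>the diagonal entry is even, so the integer quotient in \<open>q_par\<close> is exact\<close>
  obtain c where c: "cartan D i i = 2 * c" using diag[OF i] by (auto elim: evenE)
  have "qvar powi (symm D i * cartan D i i) = (q_par D i)\<^sup>2"
    using power_int_mult[of qvar "symm D i * c" 2]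
    by (simp add: q_par_def q_sub_def c power_int_mult[symmetric] mult_ac)
  then have "torus_pair U ((q_par D i)\<^sup>2) (e_U i) (f_U i) (K_U i) (K_U i) (levels D i) (levels D i)"
    using torus_pair_U[OF i i] by simp
  then show ?thesis
    by (intro drinfeld_pair.intro drinfeld_pair_axioms.intro) (simp_all add: K_U_add i drinfeld_U)
qed

end

section \<open>Descent of the co-multiplication\<close>

locale hat_comultiplication = bb_algebra D \<tau>
  for D :: "('i, 'p::ab_group_add) bc_datum" and \<tau> +
  fixes \<Delta>
  assumes comult: "comultiplication D (Uhat D) (q_hat D) (e_hat D) (f_hat D) \<Delta>"
begin

sublocale That: tensor_product "Uhat D" "Uhat D"
  by unfold_locales

sublocale T: tensor_product U U
  by unfold_locales

text \<open>The composite \<open>(\<pi> \<otimes> \<pi>) \<circ> \<Delta>\<close>; the aim is to show that it kills the Drinfeld relations.\<close>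

definition \<Phi> where "\<Phi> x = tensor_map U U \<pi> \<pi> (\<Delta> x)"

lemma \<pi>\<pi>_hom: "tensor_map U U \<pi> \<pi> \<in> alg_hom That.T T.T"
  by (intro tensor_map_alg_hom assoc_algebra_Uhat U.assoc_algebra_axioms proj_hom)

lemma \<pi>\<pi>_pure: "a \<in> carrier (Uhat D) \<Longrightarrow> b \<in> carrier (Uhat D) \<Longrightarrow>
    tensor_map U U \<pi> \<pi> (That.t a b) = T.t (\<pi> a) (\<pi> b)"
  by (intro tensor_map_pure assoc_algebra_Uhat U.assoc_algebra_axioms proj_hom)

sublocale \<pi>\<pi>: assoc_algebra_hom That.T T.T "tensor_map U U \<pi> \<pi>"
  by (intro assoc_algebra_homI That.T.assoc_algebra_axioms T.T.assoc_algebra_axioms \<pi>\<pi>_hom)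

lemma \<Delta>_hom: "\<Delta> \<in> alg_hom (Uhat D) That.T"
  using comult by (simp add: comultiplication_def Let_def)

lemma \<Phi>_hom: "\<Phi> \<in> alg_hom (Uhat D) T.T"
proof -
  have "\<Phi> = tensor_map U U \<pi> \<pi> \<circ> \<Delta>" by (simp add: \<Phi>_def fun_eq_iff)
  then show ?thesis using alg_hom_comp[OF \<Delta>_hom \<pi>\<pi>_hom] by simp
qed

sublocale \<Phi>: assoc_algebra_hom "Uhat D" T.T \<Phi>
  by (intro assoc_algebra_homI assoc_algebra_Uhat T.T.assoc_algebra_axioms \<Phi>_hom)

lemma \<Phi>_q: "h \<in> coweights \<Longrightarrow> \<Phi> (q_hat D h) = T.t (q_U h) (q_U h)"
  using comult by (simp add: comultiplication_def Let_def \<Phi>_def \<pi>\<pi>_pure q_hat_closed)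

lemma \<Phi>_e:
  assumes "i \<in> idx D" "l \<in> levels D i"
  shows "\<Phi> (e_hat D i l) = coprod_e U (q_par D i) (e_U i) (K_U i) l"
proof (cases "l = 0")
  case True
  have idx0: "split_idx 0 = {(0, 0)}" by auto
  have "K_U i 0 = \<one>\<^bsub>U\<^esub>"
    using q_hat_zero[of D] by (simp add: K_coweight_def)
  then show ?thesis
    unfolding True coprod_e_def idx0
    by (simp add: e_hat_zero T.pure_one T.T.smult_one)
next
  case False
  then have il: "(i, l) \<in> idx_inf D" using assms by (simp add: levels_def)
  note e = e_hat_closed[OF levels_down[OF assms(2)]]
  note K = q_hat_closed[OF K_coweight_mem[OF assms(1)], where D = D]
  have "\<Phi> (e_hat D i l) = tensor_map U U \<pi> \<pi> (finsum That.T (\<lambda>(m, n). (q_par D i powi (int m * int n)) \<odot>\<^bsub>That.T\<^esub>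
      That.t (e_hat D i m) (q_hat D (K_coweight D i (- int m)) \<otimes>\<^bsub>Uhat D\<^esub> e_hat D i n)) (split_idx l))"
    using comult il by (auto simp: comultiplication_def Let_def \<Phi>_def del: equalityI)
  also have "\<dots> = coprod_e U (q_par D i) (e_U i) (K_U i) l"
    unfolding coprod_e_def
    by (subst \<pi>\<pi>.hom_finsum; (intro T.T.finsum_cong' refl)?)
       (auto simp: e K \<pi>\<pi>.hom_smult \<pi>\<pi>_pure del: equalityI)
  finally show ?thesis .
qed

lemma \<Phi>_f:
  assumes "i \<in> idx D" "l \<in> levels D i"
  shows "\<Phi> (f_hat D i l) = coprod_f U (q_par D i) (f_U i) (K_U i) l"
proof (cases "l = 0")
  case True
  have idx0: "split_idx 0 = {(0, 0)}" by auto
  have "K_U i 0 = \<one>\<^bsub>U\<^esub>"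
    using q_hat_zero[of D] by (simp add: K_coweight_def)
  then show ?thesis
    unfolding True coprod_f_def idx0
    by (simp add: f_hat_zero T.pure_one T.T.smult_one)
next
  case False
  then have il: "(i, l) \<in> idx_inf D" using assms by (simp add: levels_def)
  note f = f_hat_closed[OF levels_down[OF assms(2)]]
  note K = q_hat_closed[OF K_coweight_mem[OF assms(1)], where D = D]
  have "\<Phi> (f_hat D i l) = tensor_map U U \<pi> \<pi> (finsum That.T (\<lambda>(m, n). (q_par D i powi (- (int m * int n))) \<odot>\<^bsub>That.T\<^esub>
      That.t (f_hat D i m \<otimes>\<^bsub>Uhat D\<^esub> q_hat D (K_coweight D i (int n))) (f_hat D i n)) (split_idx l))"
    using comult il by (auto simp: comultiplication_def Let_def \<Phi>_def del: equalityI)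
  also have "\<dots> = coprod_f U (q_par D i) (f_U i) (K_U i) l"
    unfolding coprod_f_def
    by (subst \<pi>\<pi>.hom_finsum; (intro T.T.finsum_cong' refl)?)
       (auto simp: f K \<pi>\<pi>.hom_smult \<pi>\<pi>_pure del: equalityI)
  finally show ?thesis .
qed

lemma \<Phi>_commute:
  assumes "(i, k) \<in> idx_inf D" "(j, l) \<in> idx_inf D" "i \<noteq> j"
  shows "\<Phi> (e_hat D j l \<otimes>\<^bsub>Uhat D\<^esub> f_hat D i k) = \<Phi> (f_hat D i k \<otimes>\<^bsub>Uhat D\<^esub> e_hat D j l)"
proof -
  note idx = idx_inf_idx[OF assms(1)] idx_inf_idx[OF assms(2)]
  note lev = idx_inf_levels[OF assms(1)] idx_inf_levels[OF assms(2)]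
  interpret pair: torus_pair U "q_par D j" "q_par D i" "qvar powi (symm D i * cartan D i j)"
    "e_U j" "f_U i" "K_U j" "K_U i" "levels D j" "levels D i"
    by (rule torus_pair_U[OF idx])
  show ?thesis
    using pair.coprod_commute[OF e_f_commute[OF assms(3)] lev(2,1)] idx lev
    by (simp add: e_hat_closed f_hat_closed \<Phi>_e \<Phi>_f)
qed

lemma \<Phi>_drinfeld:
  assumes "(i, k) \<in> idx_inf D" "(i, l) \<in> idx_inf D"
  shows "\<Phi> (finsum (Uhat D) (\<lambda>(m, n, s). (q_par D i powi (int n * (int m - int s)) * \<tau> i n) \<odot>\<^bsub>Uhat D\<^esub>
      (e_hat D i s \<otimes>\<^bsub>Uhat D\<^esub> f_hat D i m \<otimes>\<^bsub>Uhat D\<^esub> q_hat D (K_coweight D i (- int n)))) (drinfeld_idx k l))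
    = \<Phi> (finsum (Uhat D) (\<lambda>(m, n, s). (q_par D i powi (- (int n * (int m - int s))) * \<tau> i n) \<odot>\<^bsub>Uhat D\<^esub>
      (f_hat D i m \<otimes>\<^bsub>Uhat D\<^esub> e_hat D i s \<otimes>\<^bsub>Uhat D\<^esub> q_hat D (K_coweight D i (int n)))) (drinfeld_idx k l))"
    (is "\<Phi> ?x = \<Phi> ?y")
proof -
  note i = idx_inf_idx[OF assms(1)]
  note lev = idx_inf_levels[OF assms(1)] idx_inf_levels[OF assms(2)]
  note down = levels_down[OF lev(1)] levels_down[OF lev(2)]
  note K = K_coweight_mem[OF i]
  interpret pair: drinfeld_pair U "q_par D i" "e_U i" "f_U i" "K_U i" "levels D i" "\<tau> i"
    by (rule drinfeld_pair_U[OF i])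
  note closed = e_hat_closed[OF down(2)] f_hat_closed[OF down(1)] q_hat_closed[OF K, where D = D]
  note eq = \<Phi>_e[OF i down(2)] \<Phi>_f[OF i down(1)] \<Phi>_q[OF K]
  note mem = pair.E_closed[OF down(2)] pair.F_closed[OF down(1)]
  have "\<Phi> ?x = finsum T.T (\<lambda>(m, n, s). (q_par D i powi (int n * (int m - int s)) * \<tau> i n) \<odot>\<^bsub>T.T\<^esub>
       (pair.E s \<otimes>\<^bsub>T.T\<^esub> pair.F m \<otimes>\<^bsub>T.T\<^esub> T.t (K_U i (- int n)) (K_U i (- int n)))) (drinfeld_idx k l)"
    by (subst \<Phi>.hom_finsum; (intro T.T.finsum_cong' refl)?)
       (auto simp: closed eq mem \<Phi>.hom_smult del: equalityI)
  also have "\<dots> = finsum T.T (\<lambda>(m, n, s). (q_par D i powi (- (int n * (int m - int s))) * \<tau> i n) \<odot>\<^bsub>T.T\<^esub>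
       (pair.F m \<otimes>\<^bsub>T.T\<^esub> pair.E s \<otimes>\<^bsub>T.T\<^esub> T.t (K_U i (int n)) (K_U i (int n)))) (drinfeld_idx k l)"
    unfolding pair.coprod_ef[OF lev] pair.coprod_fe[OF lev] ..
  also have "\<dots> = \<Phi> ?y"
    by (subst \<Phi>.hom_finsum; (intro T.T.finsum_cong' refl)?)
       (auto simp: closed eq mem \<Phi>.hom_smult del: equalityI)
  finally show ?thesis .
qed

lemma \<Phi>_relation:
  assumes "r \<in> drinfeld_relations D \<tau>" shows "\<Phi> r = \<zero>\<^bsub>T.T\<^esub>"
proof -
  have diff: "\<Phi> (x \<ominus>\<^bsub>Uhat D\<^esub> y) = \<zero>\<^bsub>T.T\<^esub>"
    if "\<Phi> x = \<Phi> y" "x \<in> carrier (Uhat D)" "y \<in> carrier (Uhat D)" for x y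
    using that \<Phi>.hom_closed[of y] by (simp add: \<Phi>.hom_minus T.T.minus_eq T.T.r_neg del: \<Phi>.hom_closed)
  from assms consider
    (mixed) i j k l where "(i, k) \<in> idx_inf D" "(j, l) \<in> idx_inf D" "i \<noteq> j"
      "r = e_hat D j l \<otimes>\<^bsub>Uhat D\<^esub> f_hat D i k \<ominus>\<^bsub>Uhat D\<^esub> f_hat D i k \<otimes>\<^bsub>Uhat D\<^esub> e_hat D j l"
  | (same) i k l where "(i, k) \<in> idx_inf D" "(i, l) \<in> idx_inf D"
      "r = finsum (Uhat D) (\<lambda>(m, n, s). (q_par D i powi (int n * (int m - int s)) * \<tau> i n) \<odot>\<^bsub>Uhat D\<^esub>
      (e_hat D i s \<otimes>\<^bsub>Uhat D\<^esub> f_hat D i m \<otimes>\<^bsub>Uhat D\<^esub> q_hat D (K_coweight D i (- int n)))) (drinfeld_idx k l)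
      \<ominus>\<^bsub>Uhat D\<^esub> finsum (Uhat D) (\<lambda>(m, n, s). (q_par D i powi (- (int n * (int m - int s))) * \<tau> i n) \<odot>\<^bsub>Uhat D\<^esub>
      (f_hat D i m \<otimes>\<^bsub>Uhat D\<^esub> e_hat D i s \<otimes>\<^bsub>Uhat D\<^esub> q_hat D (K_coweight D i (int n)))) (drinfeld_idx k l)"
    unfolding drinfeld_relations_def Let_def by blast
  then show ?thesis
  proof cases
    case mixed
    show ?thesis
      unfolding mixed(4) using mixed(1,2)
      by (intro diff \<Phi>_commute mixed(1-3)) (simp_all add: e_hat_closed f_hat_closed idx_inf_levels)
  next
    case same
    note closed = e_hat_closed[OF levels_down[OF idx_inf_levels[OF same(2)]]]
      f_hat_closed[OF levels_down[OF idx_inf_levels[OF same(1)]]]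
      q_hat_closed[OF K_coweight_mem[OF idx_inf_idx[OF same(1)]], where D = D]
    show ?thesis
      unfolding same(3)
      by (intro diff \<Phi>_drinfeld same(1,2)) (auto intro!: hat.finsum_closed hat.smult_closed hat.m_closed closed)
  qed
qed

lemma \<Phi>_ideal:
  assumes "x \<in> drinfeld_ideal D \<tau>" shows "\<Phi> x = \<zero>\<^bsub>T.T\<^esub>"
proof (rule \<Phi>.vanishes_on_genideal)
  show "drinfeld_relations D \<tau> \<subseteq> carrier (Uhat D)"
    by (rule drinfeld_relations_closed[OF borcherds_cartan_datum_axioms])
  show "x \<in> Idl\<^bsub>Uhat D\<^esub> (drinfeld_relations D \<tau>)"
    using assms unfolding drinfeld_ideal_def .
  show "\<Phi> r = \<zero>\<^bsub>T.T\<^esub>" if "r \<in> drinfeld_relations D \<tau>" for r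
    by (rule \<Phi>_relation[OF that])
qed

lemma comultiplication_on_quotient:
  "\<exists>\<Delta>'. comultiplication D U q_U e_U f_U \<Delta>'
      \<and> (\<forall>x\<in>carrier (Uhat D). \<Delta>' (\<pi> x) = tensor_map U U \<pi> \<pi> (\<Delta> x))"
proof -
  have "\<exists>F\<in>alg_hom (quotient_algebra (Uhat D) (drinfeld_ideal D \<tau>)) T.T.
      \<forall>x\<in>carrier (Uhat D). F (drinfeld_ideal D \<tau> +>\<^bsub>Uhat D\<^esub> x) = \<Phi> x"
  proof (rule I.alg_hom_factors)
    show "assoc_algebra T.T" by (rule T.T.assoc_algebra_axioms)
    show "\<Phi> \<in> alg_hom (Uhat D) T.T" by (rule \<Phi>_hom)
    show "\<Phi> x = \<zero>\<^bsub>T.T\<^esub>" if "x \<in> drinfeld_ideal D \<tau>" for x by (rule \<Phi>_ideal[OF that])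
  qed
  then obtain \<Delta>' where hom: "\<Delta>' \<in> alg_hom (quotient_algebra (Uhat D) (drinfeld_ideal D \<tau>)) T.T"
    and factor: "\<forall>x\<in>carrier (Uhat D). \<Delta>' (drinfeld_ideal D \<tau> +>\<^bsub>Uhat D\<^esub> x) = \<Phi> x"
    by (elim bexE)
  have \<Delta>': "\<Delta>' (\<pi> x) = \<Phi> x" if "x \<in> carrier (Uhat D)" for x
    unfolding proj_eq by (rule bspec[OF factor that])
  have "comultiplication D U q_U e_U f_U \<Delta>'"
    unfolding comultiplication_def Let_def
  proof (intro conjI ballI)
    show "\<Delta>' \<in> alg_hom U T.T" using hom by (simp add: Uq_def)
    show "\<Delta>' (q_U h) = T.t (q_U h) (q_U h)" if "h \<in> coweights" for h
      using that by (simp add: \<Delta>' q_hat_closed \<Phi>_q)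
  next
    fix p assume "p \<in> idx_inf D"
    then obtain i l where p: "p = (i, l)" "(i, l) \<in> idx_inf D" by (cases p) auto
    note il = idx_inf_idx[OF p(2)] idx_inf_levels[OF p(2)]
    show "case p of (i, l) \<Rightarrow> \<Delta>' (e_U i l) = finsum T.T (\<lambda>(m, n). (q_par D i powi (int m * int n)) \<odot>\<^bsub>T.T\<^esub>
        T.t (e_U i m) (K_U i (- int m) \<otimes>\<^bsub>U\<^esub> e_U i n)) (split_idx l)"
      unfolding p(1) prod.case \<Delta>'[OF e_hat_closed[OF il(2)]] \<Phi>_e[OF il] coprod_e_def ..
    show "case p of (i, l) \<Rightarrow> \<Delta>' (f_U i l) = finsum T.T (\<lambda>(m, n). (q_par D i powi (- (int m * int n))) \<odot>\<^bsub>T.T\<^esub>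
        T.t (f_U i m \<otimes>\<^bsub>U\<^esub> K_U i (int n)) (f_U i n)) (split_idx l)"
      unfolding p(1) prod.case \<Delta>'[OF f_hat_closed[OF il(2)]] \<Phi>_f[OF il] coprod_f_def ..
  qed
  moreover have "\<forall>x\<in>carrier (Uhat D). \<Delta>' (\<pi> x) = tensor_map U U \<pi> \<pi> (\<Delta> x)"
    unfolding \<Phi>_def[symmetric] by (intro ballI \<Delta>')
  ultimately show ?thesis by (intro exI[of _ \<Delta>'] conjI)
qed

end

theorem proposition2p5:
  fixes D :: "('i, 'p::ab_group_add) bc_datum"
    and \<tau> :: "'i \<Rightarrow> nat \<Rightarrow> ratfun"
    and \<Delta> :: "('i, 'p) hat_elt \<Rightarrow> (('i, 'p) hat_elt \<times> ('i, 'p) hat_elt \<Rightarrow> ratfun) set"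
  assumes "borcherds_cartan_datum D"
    and "tau_family D \<tau>"
    and "comultiplication D (Uhat D) (q_hat D) (e_hat D) (f_hat D) \<Delta>"
  shows "\<exists>\<Delta>'. comultiplication D (Uq D \<tau>)
                  (\<lambda>h. Uq_proj D \<tau> (q_hat D h))
                  (\<lambda>i l. Uq_proj D \<tau> (e_hat D i l))
                  (\<lambda>i l. Uq_proj D \<tau> (f_hat D i l)) \<Delta>'
           \<and> (\<forall>x\<in>carrier (Uhat D).
                \<Delta>' (Uq_proj D \<tau> x)
                  = tensor_map (Uq D \<tau>) (Uq D \<tau>) (Uq_proj D \<tau>) (Uq_proj D \<tau>) (\<Delta> x))"
proof -
  have "hat_comultiplication D \<Delta>"
    using assms(1,3) by (simp add: hat_comultiplication_def hat_comultiplication_axioms_def bb_algebra_def)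
  then show ?thesis by (rule hat_comultiplication.comultiplication_on_quotient)
qed

end
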